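(* Let $G$ be a compactly generated nilpotent Lie group (not necessarily connected; possibly discrete) and let $\varphi\in\mathrm{Aut}(G)$. Then $R(\varphi)=\infty$ if and only if $|\mathrm{Fix}(\varphi)|=\infty$.
   Context: For a Lie group $G$, $\mathrm{Aut}(G)$ denotes the group of continuous automorphisms of $G$. A topological group is compactly generated if some compact subset generates it. For an automorphism $\varphi$ of a group $G$, the $\varphi$-twisted conjugacy classes are the equivalence classes of the relation $x\sim_\varphi y$ iff $y=gx\varphi(g)^{-1}$ for some $g\in G$; $R(\varphi)\in\mathbb{N}\cup\{\infty\}$ is the number of these classes, and $\mathrm{Fix}(\varphi)=\{x\in G:\varphi(x)=x\}$. *)

theory Defs
  imports "HOL-Analysis.Analysis" "HOL-Algebra.Algebra"
begin

fun higher_deriv :: "'e::real_normed_vector list \<Rightarrow> ('e \<Rightarrow> 'f::real_normed_vector) \<Rightarrow> 'e \<Rightarrow> 'f" where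
  "higher_deriv [] f = f"
| "higher_deriv (v # vs) f = (\<lambda>x. frechet_derivative (higher_deriv vs f) (at x) v)"

definition smooth_on :: "'e::euclidean_space set \<Rightarrow> ('e \<Rightarrow> 'f::euclidean_space) \<Rightarrow> bool" where
  "smooth_on U f \<longleftrightarrow> (\<forall>vs. \<forall>x\<in>U. higher_deriv vs f differentiable (at x))"

definition topological_group :: "('a, 'b) monoid_scheme \<Rightarrow> 'a topology \<Rightarrow> bool" where
  "topological_group G T \<longleftrightarrow> group G \<and> topspace T = carrier G \<and>
     continuous_map (prod_topology T T) T (\<lambda>(x, y). x \<otimes>\<^bsub>G\<^esub> y) \<and>
     continuous_map T T (\<lambda>x. inv\<^bsub>G\<^esub> x)"

definition is_chart :: "'a topology \<Rightarrow> ('a \<Rightarrow> 'e::euclidean_space) \<Rightarrow> 'a set \<Rightarrow> bool" where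
  "is_chart T c U \<longleftrightarrow> openin T U \<and> open (c ` U) \<and>
     homeomorphic_map (subtopology T U) (subtopology euclidean (c ` U)) c"

definition lie_atlas :: "('a, 'b) monoid_scheme \<Rightarrow> 'a topology \<Rightarrow> (('a \<Rightarrow> 'e::euclidean_space) \<times> 'a set) set \<Rightarrow> bool" where
  "lie_atlas G T A \<longleftrightarrow>
     (\<forall>(c, U)\<in>A. is_chart T c U) \<and>
     (\<Union>(c, U)\<in>A. U) = topspace T \<and>
     (\<forall>(c, U)\<in>A. \<forall>(d, V)\<in>A.
        smooth_on (c ` (U \<inter> V)) (\<lambda>z. d (inv_into U c z))) \<and>
     (\<forall>(c1, U1)\<in>A. \<forall>(c2, U2)\<in>A. \<forall>(d, V)\<in>A.
        smooth_on {(z1, z2). z1 \<in> c1 ` U1 \<and> z2 \<in> c2 ` U2 \<and>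
                     inv_into U1 c1 z1 \<otimes>\<^bsub>G\<^esub> inv_into U2 c2 z2 \<in> V}
          (\<lambda>(z1, z2). d (inv_into U1 c1 z1 \<otimes>\<^bsub>G\<^esub> inv_into U2 c2 z2))) \<and>
     (\<forall>(c, U)\<in>A. \<forall>(d, V)\<in>A.
        smooth_on {z. z \<in> c ` U \<and> inv\<^bsub>G\<^esub> (inv_into U c z) \<in> V}
          (\<lambda>z. d (inv\<^bsub>G\<^esub> (inv_into U c z))))"

text \<open>(G, T) is a Lie group of dimension DIM('e), or of dimension 0 (a discrete group).
  The type 'e fixes the model space R^n, n = DIM('e) >= 1.\<close>
definition lie_group :: "'e::euclidean_space itself \<Rightarrow> ('a, 'b) monoid_scheme \<Rightarrow> 'a topology \<Rightarrow> bool" where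
  "lie_group (E :: 'e itself) G T \<longleftrightarrow> topological_group G T \<and> Hausdorff_space T \<and>
     (T = discrete_topology (carrier G) \<or>
      (\<exists>A :: (('a \<Rightarrow> 'e) \<times> 'a set) set. lie_atlas G T A))"

definition compactly_generated :: "('a, 'b) monoid_scheme \<Rightarrow> 'a topology \<Rightarrow> bool" where
  "compactly_generated G T \<longleftrightarrow> (\<exists>K. compactin T K \<and> generate G K = carrier G)"

fun lower_central :: "('a, 'b) monoid_scheme \<Rightarrow> nat \<Rightarrow> 'a set" where
  "lower_central G 0 = carrier G"
| "lower_central G (Suc n) = generate G
     (\<Union>g \<in> carrier G. \<Union>h \<in> lower_central G n.
        {g \<otimes>\<^bsub>G\<^esub> h \<otimes>\<^bsub>G\<^esub> inv\<^bsub>G\<^esub> g \<otimes>\<^bsub>G\<^esub> inv\<^bsub>G\<^esub> h})"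

definition nilpotent_group :: "('a, 'b) monoid_scheme \<Rightarrow> bool" where
  "nilpotent_group G \<longleftrightarrow> group G \<and> (\<exists>n. lower_central G n = {\<one>\<^bsub>G\<^esub>})"

definition cont_aut :: "('a, 'b) monoid_scheme \<Rightarrow> 'a topology \<Rightarrow> ('a \<Rightarrow> 'a) \<Rightarrow> bool" where
  "cont_aut G T \<phi> \<longleftrightarrow> \<phi> \<in> iso G G \<and> continuous_map T T \<phi>"

definition twisted_conj :: "('a, 'b) monoid_scheme \<Rightarrow> ('a \<Rightarrow> 'a) \<Rightarrow> ('a \<times> 'a) set" where
  "twisted_conj G \<phi> = {(x, y). x \<in> carrier G \<and> y \<in> carrier G \<and>
     (\<exists>g\<in>carrier G. y = g \<otimes>\<^bsub>G\<^esub> x \<otimes>\<^bsub>G\<^esub> inv\<^bsub>G\<^esub> (\<phi> g))}"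

definition twisted_classes :: "('a, 'b) monoid_scheme \<Rightarrow> ('a \<Rightarrow> 'a) \<Rightarrow> 'a set set" where
  "twisted_classes G \<phi> = carrier G // twisted_conj G \<phi>"

definition Fix :: "('a, 'b) monoid_scheme \<Rightarrow> ('a \<Rightarrow> 'a) \<Rightarrow> 'a set" where
  "Fix G \<phi> = {x \<in> carrier G. \<phi> x = x}"

end

theory Submission
  imports Defs
begin

text \<open>
  Call an endomorphism balanced if it has finitely many twisted conjugacy classes exactly when it
  has finitely many fixed points. Balance passes from an invariant central subgroup \<open>N\<close>
  and the quotient by \<open>N\<close> to the whole group.

  For a finitely generated nilpotent group the induction runs along the lower central series. The
  abelian case compares growth: the image of \<open>g \<mapsto> g \<phi>(g)\<^sup>-\<^sup>1\<close> has finite index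
  exactly when its kernel, the fixed subgroup, is finite.

  A Lie group enters only through an exponential map. In a chart, multiplication is addition up to a
  quadratic error, so squaring is conjugate near the identity to multiplication by two, and iterated
  square roots give one-parameter subgroups. The adjoint action is then linear, and nilpotency
  yields a nonzero subspace of vectors fixed by it. Its image is a central subgroup, on which a
  surjective continuous endomorphism acts linearly, and the quotient has a tangent space of smaller
  dimension.
\<close>

text \<open>The obstacle is that the induction leaves Lie groups with a given atlas: a quotient by a
  central subgroup would need a new topology and new charts. The locale \<open>exp_group\<close>
  therefore keeps only what a linear projection carries over to such a quotient: a map
  \<open>ex\<close> on a subspace, the product near the identity in these coordinates, continuity of
  conjugation at the identity, and generation by finitely many elements together with the range of
  \<open>ex\<close>. Outside the discrete case, compact generation enters only through the last
  condition, which turns into finite generation once the subspace is zero.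

  Homomorphisms are carried along instead of automorphisms, so that injectivity of an induced map is
  never at issue. Surjectivity passes to quotients at once, and it makes the induced linear map
  \<open>f\<close> preserve the fixed vectors.

  On the central subgroup balance is a dichotomy for \<open>id - f\<close> modulo a discrete kernel:
  if this map is injective there is one class, and compactness bounds the fixed points; otherwise a
  line of fixed points appears, and the image is too thin for finitely many classes.\<close>

section \<open>Twisted conjugacy and balance\<close>

text \<open>Finiteness of the number of classes is phrased through finitely many representatives. In
  this form it makes sense for an invariant subgroup \<open>N\<close> with the operations of
  \<open>G\<close>; representatives and twisting elements are both taken from
  \<open>N\<close>.\<close>

definition twisted_finite :: "('a, 'b) monoid_scheme \<Rightarrow> ('a \<Rightarrow> 'a) \<Rightarrow> 'a set \<Rightarrow> bool" where
  "twisted_finite G \<phi> N \<longleftrightarrow>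
     (\<exists>Y. finite Y \<and> Y \<subseteq> N \<and> (\<forall>x\<in>N. \<exists>y\<in>Y. \<exists>g\<in>N. x = g \<otimes>\<^bsub>G\<^esub> y \<otimes>\<^bsub>G\<^esub> inv\<^bsub>G\<^esub> (\<phi> g)))"

definition balanced :: "('a, 'b) monoid_scheme \<Rightarrow> ('a \<Rightarrow> 'a) \<Rightarrow> 'a set \<Rightarrow> bool" where
  "balanced G \<phi> N \<longleftrightarrow> (twisted_finite G \<phi> N \<longleftrightarrow> finite {x \<in> N. \<phi> x = x})"

lemma equiv_twisted_conj:
  fixes G (structure)
  assumes "group G" "\<phi> \<in> hom G G"
  shows "equiv (carrier G) (twisted_conj G \<phi>)"
proof -
  interpret group G by fact
  interpret h: group_hom G G \<phi> by (simp add: assms group_hom.intro group_hom_axioms_def)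
  show ?thesis
  proof (rule equivI)
    show "twisted_conj G \<phi> \<subseteq> carrier G \<times> carrier G"
      by (auto simp: twisted_conj_def)
    show "refl_on (carrier G) (twisted_conj G \<phi>)"
      by (auto simp: refl_on_def twisted_conj_def intro!: bexI[of _ \<one>])
    show "sym (twisted_conj G \<phi>)"
    proof (rule symI)
      fix x y assume "(x, y) \<in> twisted_conj G \<phi>"
      then obtain g where g: "x \<in> carrier G" "y \<in> carrier G" "g \<in> carrier G"
        "y = g \<otimes> x \<otimes> inv (\<phi> g)" by (auto simp: twisted_conj_def)
      then have "x = inv g \<otimes> y \<otimes> inv (\<phi> (inv g))"
        by (simp add: m_assoc) (simp flip: m_assoc)
      then show "(y, x) \<in> twisted_conj G \<phi>"
        using g by (auto simp: twisted_conj_def intro!: bexI[of _ "inv g"])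
    qed
    show "trans (twisted_conj G \<phi>)"
    proof (rule transI)
      fix x y z assume "(x, y) \<in> twisted_conj G \<phi>" "(y, z) \<in> twisted_conj G \<phi>"
      then obtain g h where g: "x \<in> carrier G" "g \<in> carrier G" "h \<in> carrier G"
        "z = h \<otimes> (g \<otimes> x \<otimes> inv (\<phi> g)) \<otimes> inv (\<phi> h)"  by (auto simp: twisted_conj_def)
      then have "z = (h \<otimes> g) \<otimes> x \<otimes> inv (\<phi> (h \<otimes> g))"
        by (simp add: m_assoc inv_mult_group)
      then show "(x, z) \<in> twisted_conj G \<phi>"
        using g by (auto simp: twisted_conj_def intro!: bexI[of _ "h \<otimes> g"])
    qed
  qed
qed

lemma twisted_finite_carrier_iff:
  "twisted_finite G \<phi> (carrier G) \<longleftrightarrow>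
     (\<exists>Y. finite Y \<and> Y \<subseteq> carrier G \<and> (\<forall>x\<in>carrier G. \<exists>y\<in>Y. (y, x) \<in> twisted_conj G \<phi>))"
  unfolding twisted_finite_def
  by (intro arg_cong[where f = Ex] ext conj_cong ball_cong bex_cong refl)
     (auto simp: twisted_conj_def)

lemma finite_twisted_classes_iff:
  assumes "group G" "\<phi> \<in> hom G G"
  shows "finite (twisted_classes G \<phi>) \<longleftrightarrow> twisted_finite G \<phi> (carrier G)"
proof
  let ?R = "twisted_conj G \<phi>"
  assume fin: "finite (twisted_classes G \<phi>)"
  define Y where "Y = (\<lambda>C. SOME x. x \<in> C) ` twisted_classes G \<phi>"
  have rep: "(SOME y. y \<in> ?R `` {x}) \<in> ?R `` {x}" if "x \<in> carrier G" for x
    by (rule someI[of _ x]) (use equiv_twisted_conj[OF assms] that in \<open>auto simp: equiv_def refl_on_def\<close>)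
  have "Y \<subseteq> carrier G"
  proof
    fix y assume "y \<in> Y"
    then obtain x where "x \<in> carrier G" "y = (SOME y. y \<in> ?R `` {x})"
      by (auto simp: Y_def twisted_classes_def quotient_def)
    then have "(x, y) \<in> ?R" using rep by blast
    then show "y \<in> carrier G" by (simp add: twisted_conj_def)
  qed
  moreover have "\<exists>y\<in>Y. (y, x) \<in> ?R" if x: "x \<in> carrier G" for x
  proof -
    have "(SOME y. y \<in> ?R `` {x}) \<in> Y"
      unfolding Y_def twisted_classes_def by (intro imageI quotientI x)
    moreover have "(SOME y. y \<in> ?R `` {x}, x) \<in> ?R"
    proof (rule symD)
      show "sym ?R" using equiv_twisted_conj[OF assms] by (simp add: equiv_def)
      show "(x, SOME y. y \<in> ?R `` {x}) \<in> ?R" using rep[OF x] by blast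
    qed
    ultimately show ?thesis by (rule bexI[rotated])
  qed
  moreover have "finite Y" using fin by (simp add: Y_def)
  ultimately show "twisted_finite G \<phi> (carrier G)"
    unfolding twisted_finite_carrier_iff by (intro exI[of _ Y] conjI ballI)
next
  let ?R = "twisted_conj G \<phi>"
  assume "twisted_finite G \<phi> (carrier G)"
  then obtain Y where Y: "finite Y" "Y \<subseteq> carrier G" "\<And>x. x \<in> carrier G \<Longrightarrow> \<exists>y\<in>Y. (y, x) \<in> ?R"
    unfolding twisted_finite_carrier_iff by metis
  have "twisted_classes G \<phi> \<subseteq> (\<lambda>y. ?R `` {y}) ` Y"
  proof
    fix C assume "C \<in> twisted_classes G \<phi>"
    then obtain x where "x \<in> carrier G" "C = ?R `` {x}"
      by (auto simp: twisted_classes_def quotient_def)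
    then show "C \<in> (\<lambda>y. ?R `` {y}) ` Y"
      using Y(3)[of x] equiv_class_eq[OF equiv_twisted_conj[OF assms]] by blast
  qed
  then show "finite (twisted_classes G \<phi>)"
    using Y(1) by (simp add: finite_surj)
qed

text \<open>If \<open>a\<close> lies in the fibre, any other member \<open>g\<close> gives a fixed
  point \<open>inv a \<otimes> g\<close>. So a nonempty fibre sits inside a left coset of the fixed
  points.\<close>

lemma (in group) finite_fibre_of_finite_Fix:
  assumes \<phi>: "\<phi> \<in> hom G G" and N: "subgroup N G" and fin: "finite {x \<in> N. \<phi> x = x}"
  shows "finite {g \<in> N. g \<otimes> inv (\<phi> g) = y}"
proof (cases "{g \<in> N. g \<otimes> inv (\<phi> g) = y} = {}")
  case False
  interpret h: group_hom G G \<phi> by (simp add: \<phi> group_hom.intro group_hom_axioms_def)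
  interpret N: subgroup N G by fact
  from False obtain a where a: "a \<in> N" "a \<otimes> inv (\<phi> a) = y" by blast
  have "g \<in> (\<lambda>k. a \<otimes> k) ` {x \<in> N. \<phi> x = x}" if g: "g \<in> N" "g \<otimes> inv (\<phi> g) = y" for g
  proof
    show "g = a \<otimes> (inv a \<otimes> g)" using a g by (simp flip: m_assoc)
    have "g = (a \<otimes> inv (\<phi> a)) \<otimes> \<phi> g"
      using a g by (metis N.mem_carrier h.hom_closed inv_solve_right m_closed inv_closed)
    then have "inv a \<otimes> g = inv (\<phi> a) \<otimes> \<phi> g"
      using a(1) g(1) by (metis N.mem_carrier h.hom_closed inv_closed inv_solve_left m_assoc m_closed)
    then have "\<phi> (inv a \<otimes> g) = inv a \<otimes> g"
      using a(1) g(1) by (metis N.mem_carrier h.hom_inv h.hom_mult inv_closed)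
    then show "inv a \<otimes> g \<in> {x \<in> N. \<phi> x = x}"
      using a(1) g(1) by simp
  qed
  then have "{g \<in> N. g \<otimes> inv (\<phi> g) = y} \<subseteq> (\<lambda>k. a \<otimes> k) ` {x \<in> N. \<phi> x = x}" by blast
  then show ?thesis using fin finite_surj by blast
next
  case True
  then show ?thesis by (simp only: finite.emptyI)
qed

lemma (in group_hom) eq_mult_kernel:
  assumes "x \<in> carrier G" "y \<in> carrier G" "h x = h y"
  obtains n where "n \<in> kernel G H h" "x = n \<otimes> y"
proof (rule that)
  show "x \<otimes> inv y \<in> kernel G H h" using assms by (simp add: kernel_def)
  show "x = (x \<otimes> inv y) \<otimes> y" using assms by (simp add: G.m_assoc)
qed

section \<open>Central extensions and quotients\<close>

text \<open>Finiteness is passed alternately between fixed points and classes. In one direction it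
  goes from the fixed points of \<open>G\<close> to those of \<open>N\<close>, to the classes of
  \<open>N\<close>, to the fixed points of \<open>H\<close>, to the classes of \<open>H\<close>, and
  so to the classes of \<open>G\<close>. In the other it goes from the classes of \<open>G\<close>
  to those of \<open>H\<close>, to the fixed points of \<open>H\<close>, to the classes of
  \<open>N\<close>, to the fixed points of \<open>N\<close>, and so to those of \<open>G\<close>.
  The switches within \<open>N\<close> and within \<open>H\<close> are \<open>bN\<close> and
  \<open>bH\<close>; the remaining links rest on centrality.\<close>

lemma balanced_extension:
  fixes G (structure)
  assumes G: "group G" and H: "group H" and q: "q \<in> hom G H" "q ` carrier G = carrier H"
    and N: "N = kernel G H q"
    and central: "\<And>n g. \<lbrakk>n \<in> N; g \<in> carrier G\<rbrakk> \<Longrightarrow> n \<otimes>\<^bsub>G\<^esub> g = g \<otimes>\<^bsub>G\<^esub> n"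
    and \<phi>: "\<phi> \<in> hom G G" and \<phi>': "\<phi>' \<in> hom H H" "\<And>x. x \<in> carrier G \<Longrightarrow> \<phi>' (q x) = q (\<phi> x)"
    and bN: "balanced G \<phi> N" and bH: "balanced H \<phi>' (carrier H)"
  shows "balanced G \<phi> (carrier G)"
proof -
  interpret group G by (rule G)
  interpret H: group H by (rule H)
  have "group_hom G H q" by (rule group_hom.intro[OF G H group_hom_axioms.intro[OF q(1)]])
  then interpret q: group_hom G H q .
  have "group_hom G G \<phi>" by (rule group_hom.intro[OF G G group_hom_axioms.intro[OF \<phi>]])
  then interpret f: group_hom G G \<phi> .
  have "subgroup N G" unfolding N by (rule q.subgroup_kernel)
  then interpret N: subgroup N G .
  have N_iff: "x \<in> N \<longleftrightarrow> x \<in> carrier G \<and> q x = \<one>\<^bsub>H\<^esub>" for x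
    unfolding N kernel_def by blast
  have qN: "q n = \<one>\<^bsub>H\<^esub>" if "n \<in> N" for n
    using that N_iff by blast
  have lift: "\<exists>g\<in>carrier G. q g = x" if "x \<in> carrier H" for x
    using that q(2) by (metis imageE)
  have \<phi>'1: "\<phi>' \<one>\<^bsub>H\<^esub> = \<one>\<^bsub>H\<^esub>" by (rule hom_one[OF \<phi>'(1) H H])
  have \<phi>N: "\<phi> n \<in> N" if "n \<in> N" for n
    using \<phi>'(2)[OF N.mem_carrier[OF that]] qN[OF that] \<phi>'1 f.hom_closed[OF N.mem_carrier[OF that]] N_iff
    by metis
  \<comment> \<open>As \<open>N\<close> is central and invariant, twisting by an element
    \<open>m\<close> of \<open>N\<close> just multiplies by
    \<open>m \<otimes> inv (\<phi> m)\<close>.\<close>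
  have move: "m \<otimes> g \<otimes> y \<otimes> inv (\<phi> (m \<otimes> g)) = (m \<otimes> inv (\<phi> m)) \<otimes> (g \<otimes> y \<otimes> inv (\<phi> g))"
    if "m \<in> N" "g \<in> carrier G" "y \<in> carrier G" for m g y
  proof -
    have "m \<otimes> g \<otimes> y \<otimes> inv (\<phi> (m \<otimes> g)) = m \<otimes> ((g \<otimes> y \<otimes> inv (\<phi> g)) \<otimes> inv (\<phi> m))"
      using that by (simp add: inv_mult_group m_assoc)
    also have "(g \<otimes> y \<otimes> inv (\<phi> g)) \<otimes> inv (\<phi> m) = inv (\<phi> m) \<otimes> (g \<otimes> y \<otimes> inv (\<phi> g))"
      using that \<phi>N by (intro central[symmetric]) auto
    finally show ?thesis using that by (simp add: m_assoc)
  qed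
  show ?thesis unfolding balanced_def
  proof
    assume fin: "finite {x \<in> carrier G. \<phi> x = x}"
    then have finN: "finite {x \<in> N. \<phi> x = x}"
      by (rule rev_finite_subset) auto
    then obtain Y where Y: "finite Y" "Y \<subseteq> N"
      "\<And>x. x \<in> N \<Longrightarrow> \<exists>y\<in>Y. \<exists>g\<in>N. x = g \<otimes> y \<otimes> inv (\<phi> g)"
      using bN unfolding balanced_def twisted_finite_def by blast
    have Yc: "\<exists>y\<in>Y. \<exists>g\<in>N. x = (g \<otimes> inv (\<phi> g)) \<otimes> y" if x: "x \<in> N" for x
    proof -
      obtain y g where yg: "y \<in> Y" "g \<in> N" "x = g \<otimes> y \<otimes> inv (\<phi> g)" using Y(3)[OF x] by blast
      then have "x = g \<otimes> (inv (\<phi> g) \<otimes> y)"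
        using Y(2) \<phi>N central[of y "inv (\<phi> g)"] by (auto simp: m_assoc)
      then show ?thesis using yg Y(2) \<phi>N by (metis N.mem_carrier N.m_inv_closed m_assoc subsetD)
    qed
    \<comment> \<open>A lift \<open>g\<close> of a fixed point has
      \<open>g \<otimes> inv (\<phi> g)\<close> in \<open>N\<close>. Correcting \<open>g\<close> by
      an element of \<open>N\<close> moves this value into the finite set \<open>Y\<close>, and each
      fibre over \<open>Y\<close> is finite.\<close>
    have "{x \<in> carrier H. \<phi>' x = x} \<subseteq> (\<Union>y\<in>Y. q ` {g \<in> carrier G. g \<otimes> inv (\<phi> g) = y})"
    proof
      fix x assume x: "x \<in> {x \<in> carrier H. \<phi>' x = x}"
      then obtain g where g: "g \<in> carrier G" "q g = x" using lift[of x] by auto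
      have "g \<otimes> inv (\<phi> g) \<in> N"
        using x g \<phi>'(2)[of g] by (simp add: N_iff)
      then obtain y m where y: "y \<in> Y" "m \<in> N" "g \<otimes> inv (\<phi> g) = (m \<otimes> inv (\<phi> m)) \<otimes> y"
        using Yc by blast
      have "(inv m \<otimes> g) \<otimes> inv (\<phi> (inv m \<otimes> g)) = (inv m \<otimes> inv (\<phi> (inv m))) \<otimes> (g \<otimes> inv (\<phi> g))"
        using move[of "inv m" g \<one>] y g by simp
      also have "\<dots> = (inv m \<otimes> \<phi> m) \<otimes> ((m \<otimes> inv (\<phi> m)) \<otimes> y)"
        using y by simp
      also have "\<dots> = y"
      proof -
        have "y \<in> carrier G" "m \<in> carrier G" using Y y by auto
        then show ?thesis using central[of m "inv (\<phi> m)"] y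
          by (simp add: m_assoc) (simp flip: m_assoc)
      qed
      finally have "inv m \<otimes> g \<in> {g \<in> carrier G. g \<otimes> inv (\<phi> g) = y}"
        using g y by simp
      moreover have "q (inv m \<otimes> g) = x" using g y qN x by simp
      ultimately show "x \<in> (\<Union>y\<in>Y. q ` {g \<in> carrier G. g \<otimes> inv (\<phi> g) = y})"
        using y(1) by blast
    qed
    moreover have "finite (\<Union>y\<in>Y. q ` {g \<in> carrier G. g \<otimes> inv (\<phi> g) = y})"
      using Y(1) finite_fibre_of_finite_Fix[OF \<phi> subgroup_self fin] by blast
    ultimately have "finite {x \<in> carrier H. \<phi>' x = x}" by (rule finite_subset)
    then obtain Z where Z: "finite Z" "Z \<subseteq> carrier H"
      "\<And>x. x \<in> carrier H \<Longrightarrow> \<exists>z\<in>Z. \<exists>g\<in>carrier H. x = g \<otimes>\<^bsub>H\<^esub> z \<otimes>\<^bsub>H\<^esub> inv\<^bsub>H\<^esub> (\<phi>' g)"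
      using bH unfolding balanced_def twisted_finite_def by blast
    obtain Z' where Z': "finite Z'" "Z' \<subseteq> carrier G" "q ` Z' = Z"
      using finite_subset_image[OF Z(1), of q "carrier G"] Z(2) q(2) by metis
    have "\<exists>w\<in>(\<lambda>(y, z). y \<otimes> z) ` (Y \<times> Z'). \<exists>g\<in>carrier G. x = g \<otimes> w \<otimes> inv (\<phi> g)"
      if x: "x \<in> carrier G" for x
    proof -
      obtain z g' where z: "z \<in> Z" "g' \<in> carrier H" "q x = g' \<otimes>\<^bsub>H\<^esub> z \<otimes>\<^bsub>H\<^esub> inv\<^bsub>H\<^esub> (\<phi>' g')"
        using Z(3)[of "q x"] x by auto
      obtain g where g: "g \<in> carrier G" "q g = g'" using lift[OF z(2)] by blast
      obtain w where w: "w \<in> Z'" "q w = z" using z Z' by auto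
      then have wc: "w \<in> carrier G" using Z' by auto
      have "q x = q (g \<otimes> w \<otimes> inv (\<phi> g))" using z g w wc \<phi>'(2)[of g] by simp
      then obtain n where n: "n \<in> N" "x = n \<otimes> (g \<otimes> w \<otimes> inv (\<phi> g))"
        using q.eq_mult_kernel[of x "g \<otimes> w \<otimes> inv (\<phi> g)"] x g wc by (auto simp flip: N)
      obtain y m where y: "y \<in> Y" "m \<in> N" "n = (m \<otimes> inv (\<phi> m)) \<otimes> y"
        using Yc n by blast
      have yc: "y \<in> N" using y Y by auto
      have "m \<otimes> g \<otimes> (y \<otimes> w) \<otimes> inv (\<phi> (m \<otimes> g)) = (m \<otimes> inv (\<phi> m)) \<otimes> (g \<otimes> (y \<otimes> w) \<otimes> inv (\<phi> g))"
        using move[of m g "y \<otimes> w"] y g wc yc by auto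
      also have "g \<otimes> (y \<otimes> w) = y \<otimes> (g \<otimes> w)"
        using central[OF yc, of g] yc g wc by (simp add: m_assoc) (simp flip: m_assoc)
      finally have "x = m \<otimes> g \<otimes> (y \<otimes> w) \<otimes> inv (\<phi> (m \<otimes> g))"
        using n y yc g wc by (simp add: m_assoc)
      then show ?thesis using y w g by (intro bexI[of _ "y \<otimes> w"] bexI[of _ "m \<otimes> g"]) auto
    qed
    moreover have "(\<lambda>(y, z). y \<otimes> z) ` (Y \<times> Z') \<subseteq> carrier G"
      using subsetD[OF Y(2)] subsetD[OF Z'(2)] by auto
    ultimately show "twisted_finite G \<phi> (carrier G)"
      unfolding twisted_finite_def using Y(1) Z'(1) by (intro exI[of _ "(\<lambda>(y, z). y \<otimes> z) ` (Y \<times> Z')"]) auto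
  next
    assume "twisted_finite G \<phi> (carrier G)"
    then obtain Y where Y: "finite Y" "Y \<subseteq> carrier G"
      "\<And>x. x \<in> carrier G \<Longrightarrow> \<exists>y\<in>Y. \<exists>g\<in>carrier G. x = g \<otimes> y \<otimes> inv (\<phi> g)"
      unfolding twisted_finite_def by blast
    have "twisted_finite H \<phi>' (carrier H)" unfolding twisted_finite_def
    proof (intro exI[of _ "q ` Y"] conjI ballI)
      show "finite (q ` Y)" "q ` Y \<subseteq> carrier H" using Y by auto
      fix x assume "x \<in> carrier H"
      then obtain x' where x': "x' \<in> carrier G" "q x' = x" using lift[of x] by blast
      then obtain y g where yg: "y \<in> Y" "g \<in> carrier G" "x' = g \<otimes> y \<otimes> inv (\<phi> g)"
        using Y(3)[of x'] by blast
      moreover have "y \<in> carrier G" using yg Y by auto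
      ultimately have "x = q g \<otimes>\<^bsub>H\<^esub> q y \<otimes>\<^bsub>H\<^esub> inv\<^bsub>H\<^esub> (\<phi>' (q g))"
        using x' \<phi>'(2)[of g] by auto
      then show "\<exists>y\<in>q ` Y. \<exists>g\<in>carrier H. x = g \<otimes>\<^bsub>H\<^esub> y \<otimes>\<^bsub>H\<^esub> inv\<^bsub>H\<^esub> (\<phi>' g)"
        using yg by (intro bexI[of _ "q y"] bexI[of _ "q g"]) auto
    qed
    then have finH: "finite {x \<in> carrier H. \<phi>' x = x}" using bH unfolding balanced_def by blast
    have "{x \<in> carrier H. \<phi>' x = x} \<subseteq> q ` carrier G" unfolding q(2) by blast
    from finite_subset_image[OF finH this]
    obtain A where A: "finite A" "A \<subseteq> carrier G" "{x \<in> carrier H. \<phi>' x = x} = q ` A"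
      by blast
    have split: "\<exists>m\<in>N. \<exists>a\<in>A. g = m \<otimes> a" if g: "g \<in> carrier G" "q (\<phi> g) = q g" for g
    proof -
      have "q g \<in> q ` A" unfolding A(3)[symmetric] using g \<phi>'(2)[of g] by auto
      then obtain a where a: "a \<in> A" "q g = q a" by blast
      have "\<exists>n\<in>N. g = n \<otimes> a"
        using q.eq_mult_kernel[OF g(1) subsetD[OF A(2) a(1)] a(2)] unfolding N[symmetric] by blast
      then show ?thesis using a(1) by blast
    qed
    \<comment> \<open>\<open>c y\<close> is a member in \<open>N\<close> of the twisted class of
      \<open>y\<close>. If the class misses \<open>N\<close> the choice is arbitrary, which is why
      \<open>Z\<close> below is cut down to \<open>N\<close>.\<close>
    define c where "c y = (SOME n. n \<in> N \<and> (\<exists>g\<in>carrier G. n = g \<otimes> y \<otimes> inv (\<phi> g)))" for y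
    have c: "c y \<in> N" "\<exists>g\<in>carrier G. c y = g \<otimes> y \<otimes> inv (\<phi> g)"
      if "n \<in> N" "g \<in> carrier G" "n = g \<otimes> y \<otimes> inv (\<phi> g)" for n g y
      using someI[of "\<lambda>n. n \<in> N \<and> (\<exists>g\<in>carrier G. n = g \<otimes> y \<otimes> inv (\<phi> g))" n] that
      unfolding c_def by auto
    define Z where "Z = N \<inter> (\<lambda>(a, y). a \<otimes> c y \<otimes> inv (\<phi> a)) ` (A \<times> Y)"
    have "twisted_finite G \<phi> N" unfolding twisted_finite_def
    proof (intro exI[of _ Z] conjI ballI)
      show "finite Z" "Z \<subseteq> N" using A(1) Y(1) by (auto simp: Z_def)
      fix n assume n: "n \<in> N"
      then obtain y g where yg: "y \<in> Y" "g \<in> carrier G" "n = g \<otimes> y \<otimes> inv (\<phi> g)"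
        using Y(3)[of n] by auto
      then have yc: "y \<in> carrier G" using Y(2) by blast
      obtain k where k: "c y \<in> N" "k \<in> carrier G" "c y = k \<otimes> y \<otimes> inv (\<phi> k)"
        using c[OF n yg(2,3)] by blast
      define g' where "g' = g \<otimes> inv k"
      have g': "g' \<in> carrier G" "n = g' \<otimes> c y \<otimes> inv (\<phi> g')"
      proof -
        show "g' \<in> carrier G" using yg k by (simp add: g'_def)
        have "inv k \<otimes> (k \<otimes> (y \<otimes> (inv (\<phi> k) \<otimes> (\<phi> k \<otimes> inv (\<phi> g))))) = y \<otimes> inv (\<phi> g)"
          using k(2) yg(2) yc by (simp flip: m_assoc)
        then show "n = g' \<otimes> c y \<otimes> inv (\<phi> g')"
          unfolding g'_def k(3) yg(3) using k(2) yg(2) yc by (simp add: inv_mult_group m_assoc)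
      qed
      \<comment> \<open>Both \<open>n\<close> and \<open>c y\<close> lie in the kernel of
        \<open>q\<close>, so the image of their twisting relation says that \<open>q g'\<close> is
        fixed.\<close>
      have "q (\<phi> g') = q g'"
      proof -
        have 1: "q g' \<otimes>\<^bsub>H\<^esub> inv\<^bsub>H\<^esub> (q (\<phi> g')) = \<one>\<^bsub>H\<^esub>"
          using arg_cong[OF g'(2), of q] g'(1) qN[OF k(1)] qN[OF n] k(1) by simp
        have "q g' = (q g' \<otimes>\<^bsub>H\<^esub> inv\<^bsub>H\<^esub> (q (\<phi> g'))) \<otimes>\<^bsub>H\<^esub> q (\<phi> g')"
          using g'(1) by (simp add: H.m_assoc)
        then show ?thesis unfolding 1 using g'(1) by simp
      qed
      then obtain m a where ma: "m \<in> N" "a \<in> A" "g' = m \<otimes> a" using split g' by blast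
      have ac: "a \<in> carrier G" using ma(2) A(2) by blast
      have nm: "n = (m \<otimes> inv (\<phi> m)) \<otimes> (a \<otimes> c y \<otimes> inv (\<phi> a))"
        using g'(2) move[of m a "c y"] ma ac k(1) by auto
      let ?z = "a \<otimes> c y \<otimes> inv (\<phi> a)"
      have zc: "?z \<in> carrier G" using ac k by auto
      have "?z = inv (m \<otimes> inv (\<phi> m)) \<otimes> n"
      proof -
        have "x \<in> carrier G \<Longrightarrow> inv x \<otimes> (x \<otimes> ?z) = ?z" for x
          using zc by (simp flip: m_assoc)
        then show ?thesis unfolding nm using ma(1) \<phi>N by auto
      qed
      then have zN: "?z \<in> N" using n ma \<phi>N by auto
      have "n = m \<otimes> (inv (\<phi> m) \<otimes> ?z)" using nm ma zc by (simp add: m_assoc)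
      also have "inv (\<phi> m) \<otimes> ?z = ?z \<otimes> inv (\<phi> m)" using zN ma central[of ?z "inv (\<phi> m)"] by auto
      finally have "n = m \<otimes> ?z \<otimes> inv (\<phi> m)" using zc ma by (simp add: m_assoc)
      moreover have "?z \<in> Z" using zN ma yg by (auto simp: Z_def)
      ultimately show "\<exists>y\<in>Z. \<exists>g\<in>N. n = g \<otimes> y \<otimes> inv (\<phi> g)" using ma by blast
    qed
    then have finN: "finite {x \<in> N. \<phi> x = x}" using bN unfolding balanced_def by blast
    \<comment> \<open>For a fixed \<open>x = m \<otimes> a\<close> the factor of \<open>m\<close>
      must cancel that of \<open>a\<close>. This confines \<open>m\<close> to one finite fibre for
      each of the finitely many \<open>a\<close>.\<close>
    have "{x \<in> carrier G. \<phi> x = x} \<subseteq> (\<Union>a\<in>A. (\<lambda>m. m \<otimes> a) ` {m \<in> N. m \<otimes> inv (\<phi> m) = inv (a \<otimes> inv (\<phi> a))})"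
    proof
      fix x assume x: "x \<in> {x \<in> carrier G. \<phi> x = x}"
      then have "\<exists>m\<in>N. \<exists>a\<in>A. x = m \<otimes> a" by (intro split) simp_all
      then obtain m a where ma: "m \<in> N" "a \<in> A" "x = m \<otimes> a" by blast
      have ac: "a \<in> carrier G" using ma(2) A(2) by blast
      have "\<one> = x \<otimes> \<one> \<otimes> inv (\<phi> x)" using x by auto
      also have "\<dots> = (m \<otimes> inv (\<phi> m)) \<otimes> (a \<otimes> inv (\<phi> a))"
        unfolding ma(3) using move[of m a \<one>] ma ac by auto
      finally have "m \<otimes> inv (\<phi> m) = inv (a \<otimes> inv (\<phi> a))"
        using ma ac by (intro inv_equality[symmetric]) auto
      then show "x \<in> (\<Union>a\<in>A. (\<lambda>m. m \<otimes> a) ` {m \<in> N. m \<otimes> inv (\<phi> m) = inv (a \<otimes> inv (\<phi> a))})"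
        using ma by blast
    qed
    moreover have "finite (\<Union>a\<in>A. (\<lambda>m. m \<otimes> a) ` {m \<in> N. m \<otimes> inv (\<phi> m) = inv (a \<otimes> inv (\<phi> a))})"
      using A(1) finite_fibre_of_finite_Fix[OF \<phi> N.subgroup_axioms finN] by blast
    ultimately show "finite {x \<in> carrier G. \<phi> x = x}" by (rule finite_subset)
  qed
qed

text \<open>The cosets are replaced by chosen representatives, so the quotient has the same element
  type as \<open>G\<close>. An induction over groups of a fixed type can then be applied to
  it.\<close>

lemma (in group) central_quotient:
  assumes "subgroup N G" and central: "\<And>n g. \<lbrakk>n \<in> N; g \<in> carrier G\<rbrakk> \<Longrightarrow> n \<otimes> g = g \<otimes> n"
  obtains H :: "'a monoid" and q where "group H" "q \<in> hom G H" "q ` carrier G = carrier H" "kernel G H q = N"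
proof -
  interpret N: normal N G
  proof (rule normalI[OF assms(1)], intro ballI)
    fix x assume "x \<in> carrier G"
    then show "N #> x = x <# N"
      unfolding r_coset_def l_coset_def by (intro SUP_cong refl) (metis central)
  qed
  let ?H = "flatten (G Mod N) (\<lambda>U. SOME g. g \<in> U)"
  let ?q = "(\<lambda>U. SOME g. g \<in> U) \<circ> (\<lambda>x. N #> x)"
  have r: "(\<lambda>U. SOME g. g \<in> U) \<in> iso (G Mod N) ?H" by (rule N.flatten_set_group_mod_iso)
  have q: "?q \<in> hom G ?H"
    using N.r_coset_hom_Mod r by (simp add: hom_def iso_def Pi_def)
  have H: "group ?H" by (rule N.flatten_set_group_mod)
  show ?thesis
  proof (rule that[OF H q])
    show "?q ` carrier G = carrier ?H"
      by (auto simp: flatten_def carrier_FactGroup)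
    have "x \<in> N" if "x \<in> carrier G" "?q x = \<one>\<^bsub>?H\<^esub>" for x
    proof -
      have "N #> x = N"
      proof (rule inj_onD[OF N.flatten_set_group_mod_inj])
        show "(SOME g. g \<in> N #> x) = (SOME g. g \<in> N)" using that by (simp add: flatten_def)
        show "N #> x \<in> carrier (G Mod N)" "N \<in> carrier (G Mod N)"
          using that(1) coset_mult_one[OF N.subset] by (auto simp: carrier_FactGroup intro!: image_eqI[of N _ \<one>])
      qed
      then show ?thesis using that(1) rcos_self[OF that(1) assms(1)] by blast
    qed
    moreover have "?q x = \<one>\<^bsub>?H\<^esub>" if "x \<in> N" for x
      using that N.rcos_const by (simp add: flatten_def)
    ultimately show "kernel G ?H ?q = N" by (auto simp: kernel_def)
  qed
qed

lemma (in group_hom) hom_descends: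
  assumes surj: "h ` carrier G = carrier H" and \<phi>: "\<phi> \<in> hom G G"
    and ker: "\<And>x. x \<in> kernel G H h \<Longrightarrow> \<phi> x \<in> kernel G H h"
  obtains \<phi>' where "\<phi>' \<in> hom H H" "\<And>x. x \<in> carrier G \<Longrightarrow> \<phi>' (h x) = h (\<phi> x)"
proof -
  interpret f: group_hom G G \<phi> by (simp add: \<phi> group_hom.intro group_hom_axioms_def)
  have wd: "h (\<phi> x) = h (\<phi> y)" if xy: "x \<in> carrier G" "y \<in> carrier G" "h x = h y" for x y
  proof -
    obtain n where n: "n \<in> kernel G H h" "x = n \<otimes> y" using eq_mult_kernel[OF xy] .
    then show ?thesis using ker[OF n(1)] xy by (simp add: kernel_def)
  qed
  define \<phi>' where "\<phi>' y = h (\<phi> (SOME x. x \<in> carrier G \<and> h x = y))" for y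
  have \<phi>': "\<phi>' (h x) = h (\<phi> x)" if "x \<in> carrier G" for x
    unfolding \<phi>'_def using someI[of "\<lambda>z. z \<in> carrier G \<and> h z = h x" x] that by (intro wd) auto
  have "\<phi>' \<in> hom H H"
  proof (rule homI)
    fix x y assume "x \<in> carrier H" "y \<in> carrier H"
    then obtain a b where "a \<in> carrier G" "x = h a" "b \<in> carrier G" "y = h b"
      using surj by (metis imageE)
    then show "\<phi>' x \<in> carrier H" "\<phi>' (x \<otimes>\<^bsub>H\<^esub> y) = \<phi>' x \<otimes>\<^bsub>H\<^esub> \<phi>' y"
      using \<phi>'[of a] \<phi>'[of b] \<phi>'[of "a \<otimes> b"] by simp_all
  qed
  then show ?thesis using \<phi>' that by blast
qed

section \<open>The lower central series\<close>

lemma (in group) l_cancel_inv: "\<lbrakk>x \<in> carrier G; z \<in> carrier G\<rbrakk> \<Longrightarrow> inv x \<otimes> (x \<otimes> z) = z"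
  by (simp flip: m_assoc)

lemma (in group) r_cancel_inv: "\<lbrakk>x \<in> carrier G; z \<in> carrier G\<rbrakk> \<Longrightarrow> x \<otimes> (inv x \<otimes> z) = z"
  by (simp flip: m_assoc)

lemmas (in group) word_simps = m_assoc inv_mult_group l_cancel_inv r_cancel_inv

lemma (in group) lower_central_in_carrier: "lower_central G n \<subseteq> carrier G"
proof (induction n)
  case (Suc n)
  then show ?case
    unfolding lower_central.simps by (intro generate_incl) (auto dest!: subsetD[OF Suc.IH])
qed simp

lemma (in group) lower_central_subgroup: "subgroup (lower_central G n) G"
proof (cases n)
  case 0
  then show ?thesis by (simp add: subgroup_self)
next
  case (Suc m)
  show ?thesis unfolding Suc lower_central.simps
    by (intro generate_is_subgroup) (auto dest!: subsetD[OF lower_central_in_carrier])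
qed

lemma (in group) commutator_in_lower_central:
  "\<lbrakk>g \<in> carrier G; h \<in> lower_central G n\<rbrakk> \<Longrightarrow> g \<otimes> h \<otimes> inv g \<otimes> inv h \<in> lower_central G (Suc n)"
  unfolding lower_central.simps by (intro generate.incl) blast

lemma (in group) lower_central_Suc_subset: "lower_central G (Suc n) \<subseteq> lower_central G n"
proof (induction n)
  case 0
  then show ?case using lower_central_in_carrier[of "Suc 0"] by simp
next
  case (Suc n)
  have "generate G (\<Union>g \<in> carrier G. \<Union>h \<in> lower_central G (Suc n). {g \<otimes> h \<otimes> inv g \<otimes> inv h})
      \<subseteq> generate G (\<Union>g \<in> carrier G. \<Union>h \<in> lower_central G n. {g \<otimes> h \<otimes> inv g \<otimes> inv h})"
    by (intro mono_generate UN_mono order.refl Suc.IH)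
  then show ?case by (simp only: lower_central.simps(2))
qed

lemma (in group_hom) image_lower_central: "h ` lower_central G n \<subseteq> lower_central H n"
proof (induction n)
  case (Suc n)
  let ?S = "\<Union>g \<in> carrier G. \<Union>x \<in> lower_central G n. {g \<otimes> x \<otimes> inv g \<otimes> inv x}"
  have S: "?S \<subseteq> carrier G" by (auto dest!: subsetD[OF G.lower_central_in_carrier])
  have "h ` lower_central G (Suc n) = generate H (h ` ?S)"
    unfolding lower_central.simps by (rule generate_img[OF S, symmetric])
  also have "\<dots> \<subseteq> lower_central H (Suc n)"
  proof (rule H.generate_subgroup_incl[OF _ H.lower_central_subgroup], rule subsetI)
    fix y assume "y \<in> h ` ?S"
    then obtain g x where gx: "g \<in> carrier G" "x \<in> lower_central G n" "y = h (g \<otimes> x \<otimes> inv g \<otimes> inv x)"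
      by auto
    have "x \<in> carrier G" using gx(2) G.lower_central_in_carrier by blast
    then show "y \<in> lower_central H (Suc n)"
      using gx Suc.IH H.commutator_in_lower_central[of "h g" "h x" n] by auto
  qed
  finally show ?case .
qed auto

lemma (in group_hom) lower_central_surj:
  assumes "h ` carrier G = carrier H"
  shows "lower_central H n \<subseteq> h ` lower_central G n"
proof (induction n)
  case (Suc n)
  show ?case
  proof (subst (1) lower_central.simps, rule H.generate_subgroup_incl)
    show "subgroup (h ` lower_central G (Suc n)) H"
      by (rule subgroup_img_is_subgroup[OF G.lower_central_subgroup])
    show "(\<Union>g \<in> carrier H. \<Union>x \<in> lower_central H n. {g \<otimes>\<^bsub>H\<^esub> x \<otimes>\<^bsub>H\<^esub> inv\<^bsub>H\<^esub> g \<otimes>\<^bsub>H\<^esub> inv\<^bsub>H\<^esub> x})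
        \<subseteq> h ` lower_central G (Suc n)"
    proof (rule subsetI)
      fix y assume "y \<in> (\<Union>g \<in> carrier H. \<Union>x \<in> lower_central H n.
        {g \<otimes>\<^bsub>H\<^esub> x \<otimes>\<^bsub>H\<^esub> inv\<^bsub>H\<^esub> g \<otimes>\<^bsub>H\<^esub> inv\<^bsub>H\<^esub> x})"
      then obtain g x where gx: "g \<in> carrier H" "x \<in> lower_central H n"
        "y = g \<otimes>\<^bsub>H\<^esub> x \<otimes>\<^bsub>H\<^esub> inv\<^bsub>H\<^esub> g \<otimes>\<^bsub>H\<^esub> inv\<^bsub>H\<^esub> x" by blast
      obtain g' where g': "g' \<in> carrier G" "h g' = g" using gx(1) assms by (metis imageE)
      obtain x' where x': "x' \<in> lower_central G n" "h x' = x" using gx(2) Suc.IH by blast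
      have "x' \<in> carrier G" using x'(1) G.lower_central_in_carrier by blast
      then have "y = h (g' \<otimes> x' \<otimes> inv g' \<otimes> inv x')" using gx(3) g' x' by simp
      then show "y \<in> h ` lower_central G (Suc n)"
        using G.commutator_in_lower_central[OF g'(1) x'(1)] by blast
    qed
  qed
qed (simp add: assms)

text \<open>Modulo the term two steps further down, commutators of group elements with elements of
  one term are multiplicative in both arguments. Hence the commutators of \<open>S\<close> with
  generators of one layer generate the next layer.\<close>

lemma (in group) lower_central_finitely_generated:
  assumes S: "finite S" "generate G S = carrier G"
  shows "\<exists>T. finite T \<and> T \<subseteq> lower_central G n \<and> lower_central G n \<subseteq> generate G (T \<union> lower_central G (Suc n))"
proof (induction n)
  case 0
  have "S \<subseteq> carrier G" unfolding S(2)[symmetric] by (rule subsetI) (rule generate.incl)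
  moreover have "carrier G \<subseteq> generate G (S \<union> lower_central G (Suc 0))"
    unfolding S(2)[symmetric] by (rule mono_generate) (rule Un_upper1)
  ultimately show ?case
    using S(1) unfolding lower_central.simps(1) by (intro exI[of _ S] conjI)
next
  case (Suc n)
  note [simp del] = lower_central.simps(2)
  define com where "com g h = g \<otimes> h \<otimes> inv g \<otimes> inv h" for g h
  have Sc: "S \<subseteq> carrier G" unfolding S(2)[symmetric] by (rule subsetI) (rule generate.incl)
  obtain T where T: "finite T" "T \<subseteq> lower_central G n"
    "lower_central G n \<subseteq> generate G (T \<union> lower_central G (Suc n))" using Suc.IH by blast
  have lcc: "x \<in> lower_central G k \<Longrightarrow> x \<in> carrier G" for x k using lower_central_in_carrier by blast
  define T' where "T' = (\<lambda>(s, t). com s t) ` (S \<times> T)"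
  define M where "M = generate G (T' \<union> lower_central G (Suc (Suc n)))"
  have T'sub: "T' \<subseteq> lower_central G (Suc n)"
    using Sc T(2) by (auto simp: T'_def com_def intro!: commutator_in_lower_central)
  have gens: "T' \<union> lower_central G (Suc (Suc n)) \<subseteq> lower_central G (Suc n)"
    using T'sub lower_central_Suc_subset by blast
  have M_sub: "M \<subseteq> lower_central G (Suc n)"
    unfolding M_def by (rule generate_subgroup_incl[OF gens lower_central_subgroup])
  have M_subgroup: "subgroup M G"
    unfolding M_def using gens lcc by (intro generate_is_subgroup) blast
  interpret M: subgroup M G by (rule M_subgroup)
  have deep: "x \<in> lower_central G (Suc (Suc n)) \<Longrightarrow> x \<in> M" for x
    unfolding M_def by (intro generate.incl) blast
  \<comment> \<open>\<open>M\<close> lies in \<open>lower_central G (Suc n)\<close> and contains the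
    following term. A conjugate of an element of \<open>M\<close> differs from it by a commutator in
    that term, so \<open>M\<close> is normal.\<close>
  have conjM: "g \<otimes> m \<otimes> inv g \<in> M" if "g \<in> carrier G" "m \<in> M" for g m
  proof -
    have "com g m \<in> M"
      unfolding com_def using that M_sub by (intro deep commutator_in_lower_central) auto
    moreover have "g \<otimes> m \<otimes> inv g = com g m \<otimes> m"
      using that M.mem_carrier by (simp add: com_def word_simps)
    ultimately show ?thesis using that(2) by simp
  qed
  have conjM': "inv g \<otimes> m \<otimes> g \<in> M" if "g \<in> carrier G" "m \<in> M" for g m
    using conjM[of "inv g" m] that by simp
  \<comment> \<open>The two arguments of \<open>com\<close> are freed one at a time: first
    \<open>g\<close>, from \<open>S\<close> to the whole group with \<open>t\<close> fixed, and then
    the second argument, from \<open>T\<close> and the next term to all of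
    \<open>lower_central G n\<close>. Each time the admissible elements form a subgroup.\<close>
  have TM: "com g t \<in> M" if g: "g \<in> carrier G" and t: "t \<in> T" for g t
  proof -
    have tc: "t \<in> carrier G" using t T(2) lcc by blast
    have "subgroup {g \<in> carrier G. com g t \<in> M} G"
    proof (rule subgroupI)
      show "{g \<in> carrier G. com g t \<in> M} \<noteq> {}"
        using tc M.one_closed by (auto intro!: exI[of _ \<one>] simp: com_def)
      fix a b assume a: "a \<in> {g \<in> carrier G. com g t \<in> M}" and b: "b \<in> {g \<in> carrier G. com g t \<in> M}"
      have "com (inv a) t = inv a \<otimes> inv (com a t) \<otimes> a"
        using a tc by (simp add: com_def word_simps)
      then show "inv a \<in> {g \<in> carrier G. com g t \<in> M}"
        using a conjM'[of a "inv (com a t)"] by simp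
      have "com (a \<otimes> b) t = (a \<otimes> com b t \<otimes> inv a) \<otimes> com a t"
        using a b tc by (simp add: com_def word_simps)
      then show "a \<otimes> b \<in> {g \<in> carrier G. com g t \<in> M}"
        using a b conjM[of a "com b t"] by simp
    qed auto
    moreover have "S \<subseteq> {g \<in> carrier G. com g t \<in> M}"
    proof
      fix s assume s: "s \<in> S"
      have "com s t \<in> M" unfolding M_def
        by (intro generate.incl UnI1) (use s t in \<open>auto simp: T'_def\<close>)
      then show "s \<in> {g \<in> carrier G. com g t \<in> M}" using s Sc by blast
    qed
    ultimately have "generate G S \<subseteq> {g \<in> carrier G. com g t \<in> M}"
      by (intro generate_subgroup_incl)
    then show ?thesis using g S(2) by blast
  qed
  let ?B = "{h \<in> carrier G. \<forall>g\<in>carrier G. com g h \<in> M}"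
  have "subgroup ?B G"
  proof (rule subgroupI)
    show "?B \<noteq> {}"
      using M.one_closed by (auto intro!: exI[of _ \<one>] simp: com_def)
    fix a b assume a: "a \<in> ?B" and b: "b \<in> ?B"
    have "com g (inv a) = inv a \<otimes> inv (com g a) \<otimes> a" if "g \<in> carrier G" for g
      using a that by (simp add: com_def word_simps)
    then show "inv a \<in> ?B"
      using a conjM'[of a "inv (com _ a)"] by simp
    have "com g (a \<otimes> b) = com g a \<otimes> (a \<otimes> com g b \<otimes> inv a)" if "g \<in> carrier G" for g
      using a b that by (simp add: com_def word_simps)
    then show "a \<otimes> b \<in> ?B"
      using a b conjM[of a "com _ b"] by simp
  qed auto
  moreover have "T \<union> lower_central G (Suc n) \<subseteq> ?B"
  proof
    fix x assume x: "x \<in> T \<union> lower_central G (Suc n)"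
    then have "x \<in> carrier G" using T(2) lcc by blast
    moreover have "com g x \<in> M" if "g \<in> carrier G" for g
      using x TM[OF that] deep[OF commutator_in_lower_central[OF that]] unfolding com_def by blast
    ultimately show "x \<in> ?B" by blast
  qed
  ultimately have "generate G (T \<union> lower_central G (Suc n)) \<subseteq> ?B"
    by (intro generate_subgroup_incl)
  then have "lower_central G n \<subseteq> ?B" using T(3) by blast
  then have "lower_central G (Suc n) \<subseteq> M"
    unfolding lower_central.simps(2)[of G n]
    by (intro generate_subgroup_incl[OF _ M_subgroup]) (auto simp: com_def)
  then show ?case
    using T'sub S(1) T(1) unfolding M_def by (intro exI[of _ T']) (simp add: T'_def)
qed

section \<open>Growth of finitely generated abelian groups\<close>

text \<open>Words have length exactly \<open>n\<close>, which suits the inductions; when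
  \<open>A\<close> contains the identity, shorter words can be padded and these sets are
  balls.\<close>

primrec (in group) words :: "'a set \<Rightarrow> nat \<Rightarrow> 'a set" where
  "words A 0 = {\<one>}"
| "words A (Suc n) = {a \<otimes> w | a w. a \<in> A \<and> w \<in> words A n}"

lemma (in group) words_carrier: "A \<subseteq> carrier G \<Longrightarrow> words A n \<subseteq> carrier G"
  by (induction n) auto

lemma (in group) words_add:
  assumes "A \<subseteq> carrier G" "v \<in> words A m" "w \<in> words A n"
  shows "v \<otimes> w \<in> words A (m + n)"
  using assms(2)
proof (induction m arbitrary: v)
  case 0
  then show ?case using assms words_carrier[OF assms(1), of n] by auto
next
  case (Suc m)
  then obtain a u where "a \<in> A" "u \<in> words A m" "v = a \<otimes> u" by auto
  moreover have "a \<otimes> u \<otimes> w = a \<otimes> (u \<otimes> w)"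
    using calculation assms words_carrier[OF assms(1)] by (meson m_assoc subsetD)
  ultimately show ?case using Suc.IH by auto
qed

lemma (in group) words_mono:
  assumes "A \<subseteq> carrier G" "\<one> \<in> A" "m \<le> n"
  shows "words A m \<subseteq> words A n"
proof -
  have "words A k \<subseteq> words A (Suc k)" for k
  proof
    fix w assume w: "w \<in> words A k"
    then have "w = \<one> \<otimes> w" using words_carrier[OF assms(1), of k] by auto
    then show "w \<in> words A (Suc k)" using w assms(2) by auto
  qed
  then show ?thesis using assms(3) by (rule lift_Suc_mono_le)
qed

text \<open>Images of cubes of integer exponent vectors. They are comparable with word balls up to a
  linear change of size, and their doubling constant can be written down.\<close>

primrec (in comm_group) box :: "'a list \<Rightarrow> nat \<Rightarrow> 'a set" where
  "box [] M = {\<one>}"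
| "box (s # ss) M = (\<lambda>(j::int, b). s [^] j \<otimes> b) ` ({- int M..int M} \<times> box ss M)"

lemma (in comm_group) box_carrier: "set ss \<subseteq> carrier G \<Longrightarrow> box ss M \<subseteq> carrier G"
  by (induction ss) (auto dest: subsetD)

lemma (in comm_group) finite_box: "finite (box ss M)"
  by (induction ss) auto

lemma (in comm_group) one_in_box: "set ss \<subseteq> carrier G \<Longrightarrow> \<one> \<in> box ss M"
  by (induction ss) (auto intro!: image_eqI[of _ _ "(0, \<one>)"])

lemma (in comm_group) box_mono: "M \<le> M' \<Longrightarrow> box ss M \<subseteq> box ss M'"
  by (induction ss) (force intro!: image_mono)+

lemma (in comm_group) box_mult:
  assumes "set ss \<subseteq> carrier G" "x \<in> box ss M" "y \<in> box ss M'"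
  shows "x \<otimes> y \<in> box ss (M + M')"
  using assms
proof (induction ss arbitrary: x y)
  case (Cons s ss)
  then obtain i b j c where x: "x = s [^] (i::int) \<otimes> b" "\<bar>i\<bar> \<le> int M" "b \<in> box ss M"
    and y: "y = s [^] (j::int) \<otimes> c" "\<bar>j\<bar> \<le> int M'" "c \<in> box ss M'" by auto
  have c: "s \<in> carrier G" "b \<in> carrier G" "c \<in> carrier G"
    using Cons.prems(1) x(3) y(3) box_carrier[of ss] by auto
  have "x \<otimes> y = s [^] (i + j) \<otimes> (b \<otimes> c)"
    using c by (simp add: x y int_pow_mult m_ac)
  moreover have "b \<otimes> c \<in> box ss (M + M')" using Cons.IH Cons.prems(1) x(3) y(3) by auto
  ultimately show ?case using x(2) y(2) by (auto intro!: image_eqI[of _ _ "(i + j, b \<otimes> c)"])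
qed auto

lemma (in comm_group) box_inv:
  assumes "set ss \<subseteq> carrier G" "x \<in> box ss M"
  shows "inv x \<in> box ss M"
  using assms
proof (induction ss arbitrary: x)
  case (Cons s ss)
  then obtain i b where x: "x = s [^] (i::int) \<otimes> b" "\<bar>i\<bar> \<le> int M" "b \<in> box ss M" by auto
  have c: "s \<in> carrier G" "b \<in> carrier G"
    using Cons.prems(1) x(3) box_carrier[of ss] by auto
  have "inv x = s [^] (- i) \<otimes> inv b"
    using c by (simp add: x inv_mult int_pow_neg)
  moreover have "inv b \<in> box ss M" using Cons.IH Cons.prems(1) x(3) by auto
  ultimately show ?case using x(2) by (auto intro!: image_eqI[of _ _ "(- i, inv b)"])
qed auto

text \<open>An exponent of size at most \<open>2 * M\<close> is within \<open>M\<close> of one of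
  \<open>- M\<close>, \<open>0\<close>, \<open>M\<close>. So three choices for each generator give
  enough translates.\<close>

lemma (in comm_group) box_double:
  assumes "set ss \<subseteq> carrier G"
  shows "\<exists>F. finite F \<and> card F \<le> 3 ^ length ss \<and> F \<subseteq> carrier G \<and>
    box ss (2 * M) \<subseteq> (\<lambda>(f, b). f \<otimes> b) ` (F \<times> box ss M)"
  using assms
proof (induction ss)
  case Nil
  then show ?case by (intro exI[of _ "{\<one>}"]) auto
next
  case (Cons s ss)
  then obtain F where F: "finite F" "card F \<le> 3 ^ length ss" "F \<subseteq> carrier G"
    "box ss (2 * M) \<subseteq> (\<lambda>(f, b). f \<otimes> b) ` (F \<times> box ss M)" by auto
  have s: "s \<in> carrier G" using Cons.prems by simp
  define I where "I = {- int M, 0, int M}"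
  define F' where "F' = (\<lambda>(i::int, f). s [^] i \<otimes> f) ` (I \<times> F)"
  have "card F' \<le> card (I \<times> F)" unfolding F'_def by (rule card_image_le) (simp add: I_def F)
  also have "\<dots> \<le> 3 * card F" unfolding card_cartesian_product
    by (intro mult_right_mono) (auto simp: I_def card_insert_if)
  finally have "card F' \<le> 3 ^ length (s # ss)" using F(2) by simp
  moreover have "box (s # ss) (2 * M) \<subseteq> (\<lambda>(f, b). f \<otimes> b) ` (F' \<times> box (s # ss) M)"
  proof
    fix x assume "x \<in> box (s # ss) (2 * M)"
    then obtain j c where x: "x = s [^] (j::int) \<otimes> c" "\<bar>j\<bar> \<le> 2 * int M" "c \<in> box ss (2 * M)"
      by (auto simp: abs_le_iff)
    obtain f b where c: "c = f \<otimes> b" "f \<in> F" "b \<in> box ss M" using x(3) F(4) by auto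
    obtain i where i: "i \<in> I" "\<bar>j - i\<bar> \<le> int M"
    proof (cases "j > int M")
      case True
      then show ?thesis using x(2) that[of "int M"] by (auto simp: I_def)
    next
      case False
      show ?thesis
      proof (cases "j < - int M")
        case True
        then show ?thesis using x(2) that[of "- int M"] by (auto simp: I_def)
      next
        case False
        then show ?thesis using \<open>\<not> j > int M\<close> that[of 0] by (auto simp: I_def)
      qed
    qed
    have cc: "f \<in> carrier G" "b \<in> carrier G"
      using c F(3) Cons.prems box_carrier[of ss] by auto
    have "s [^] j = s [^] i \<otimes> s [^] (j - i)"
      using s by (simp flip: int_pow_mult)
    then have "x = (s [^] i \<otimes> f) \<otimes> (s [^] (j - i) \<otimes> b)"
      using s cc by (simp add: x c m_ac)
    moreover have "s [^] i \<otimes> f \<in> F'" using i c by (auto simp: F'_def)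
    moreover have "s [^] (j - i) \<otimes> b \<in> box (s # ss) M"
      using i(2) c(3) by (auto intro!: image_eqI[of _ _ "(j - i, b)"])
    ultimately show "x \<in> (\<lambda>(f, b). f \<otimes> b) ` (F' \<times> box (s # ss) M)"
      by (intro image_eqI[where x = "(s [^] i \<otimes> f, s [^] (j - i) \<otimes> b)"]) (simp_all del: box.simps)
  qed
  moreover have "finite F'" "F' \<subseteq> carrier G" using F s by (auto simp: F'_def I_def)
  ultimately show ?case by (intro exI[of _ F'] conjI)
qed

lemma (in comm_group) card_box_double:
  assumes "set ss \<subseteq> carrier G"
  shows "card (box ss (2 ^ k * M)) \<le> (3 ^ length ss) ^ k * card (box ss M)"
proof (induction k)
  case (Suc k)
  obtain F where F: "finite F" "card F \<le> 3 ^ length ss"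
    "box ss (2 * (2 ^ k * M)) \<subseteq> (\<lambda>(f, b). f \<otimes> b) ` (F \<times> box ss (2 ^ k * M))"
    using box_double[OF assms, of "2 ^ k * M"] by blast
  have "card (box ss (2 * (2 ^ k * M))) \<le> card ((\<lambda>(f, b). f \<otimes> b) ` (F \<times> box ss (2 ^ k * M)))"
    by (intro card_mono F) (simp add: F finite_box)
  also have "\<dots> \<le> card (F \<times> box ss (2 ^ k * M))"
    by (intro card_image_le) (simp add: F finite_box)
  also have "\<dots> \<le> 3 ^ length ss * ((3 ^ length ss) ^ k * card (box ss M))"
    unfolding card_cartesian_product by (intro mult_mono F Suc.IH) auto
  finally show ?case by (simp add: mult.assoc)
qed simp

lemma (in comm_group) int_pow_in_words:
  assumes "A \<subseteq> carrier G" "\<one> \<in> A" "s \<in> A" "inv s \<in> A" "\<bar>j\<bar> \<le> int M"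
  shows "s [^] j \<in> words A M"
proof -
  have pw: "a [^] (n::nat) \<in> words A n" if "a \<in> A" for a n
  proof (induction n)
    case (Suc n)
    have "a [^] Suc n = a \<otimes> a [^] n" using nat_pow_Suc2[of a n] that assms(1) by blast
    then show ?case using Suc that by auto
  qed simp
  have sc: "s \<in> carrier G" using assms by blast
  have "s [^] j \<in> words A (nat \<bar>j\<bar>)"
  proof (cases "j \<ge> 0")
    case True
    then have e: "s [^] nat \<bar>j\<bar> = s [^] j" by (simp add: pow_nat)
    show ?thesis using pw[OF assms(3), of "nat \<bar>j\<bar>"] unfolding e .
  next
    case False
    then have j: "j = - int (nat \<bar>j\<bar>)" by simp
    have e: "inv s [^] nat \<bar>j\<bar> = s [^] j"
      by (subst (2) j) (simp only: int_pow_neg_int[OF sc] nat_pow_inv[OF sc])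
    show ?thesis using pw[OF assms(4), of "nat \<bar>j\<bar>"] unfolding e .
  qed
  moreover have "nat \<bar>j\<bar> \<le> M" using assms(5) by linarith
  ultimately show ?thesis using words_mono[OF assms(1,2)] by blast
qed

lemma (in comm_group) box_subset_words:
  assumes "A \<subseteq> carrier G" "\<one> \<in> A" "set ss \<subseteq> A" "\<And>s. s \<in> set ss \<Longrightarrow> inv s \<in> A"
  shows "box ss M \<subseteq> words A (length ss * M)"
  using assms(3,4)
proof (induction ss)
  case (Cons s ss)
  have "s [^] j \<in> words A M" if "\<bar>j\<bar> \<le> int M" for j
    using int_pow_in_words[OF assms(1,2) _ _ that] Cons.prems by simp
  then show ?case
    using Cons words_add[OF assms(1), of _ M _ "length ss * M"] by (force simp: abs_le_iff)
qed simp

lemma (in comm_group) Union_box: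
  assumes "set ss \<subseteq> carrier G" "generate G (set ss) = carrier G" "x \<in> carrier G"
  shows "\<exists>M. x \<in> box ss M"
proof -
  have gen: "s \<in> box ss 1" if "s \<in> set ss" for s
    using assms(1) that
  proof (induction ss)
    case (Cons a ss)
    show ?case
    proof (cases "s = a")
      case True
      then show ?thesis using Cons.prems one_in_box[of ss 1] by (auto intro!: image_eqI[of _ _ "(1, \<one>)"])
    next
      case False
      then have "s \<in> box ss 1" "s \<in> carrier G" using Cons by auto
      then show ?thesis by (auto intro!: image_eqI[of _ _ "(0, s)"])
    qed
  qed simp
  have "subgroup {x \<in> carrier G. \<exists>M. x \<in> box ss M} G"
  proof (rule subgroupI)
    show "{x \<in> carrier G. \<exists>M. x \<in> box ss M} \<noteq> {}" using one_in_box[OF assms(1)] by blast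
  qed (use box_inv[OF assms(1)] box_mult[OF assms(1)] in blast)+
  then have "generate G (set ss) \<subseteq> {x \<in> carrier G. \<exists>M. x \<in> box ss M}"
    by (intro generate_subgroup_incl) (use gen assms(1) in blast)
  then show ?thesis using assms by blast
qed

lemma (in comm_group) finite_subset_box:
  assumes "set ss \<subseteq> carrier G" "generate G (set ss) = carrier G" "finite Y" "Y \<subseteq> carrier G"
  shows "\<exists>M. Y \<subseteq> box ss M"
  using assms(3,4)
proof (induction Y)
  case (insert y Y)
  then obtain M where "Y \<subseteq> box ss M" by auto
  moreover obtain M' where "y \<in> box ss M'" using Union_box[OF assms(1,2), of y] insert.prems by auto
  ultimately have "insert y Y \<subseteq> box ss (max M M')"
    using box_mono[of M "max M M'" ss] box_mono[of M' "max M M'" ss] by auto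
  then show ?case by blast
qed simp

lemma card_le_fibre_bound:
  assumes "finite A" "\<And>y. y \<in> f ` A \<Longrightarrow> card {x \<in> A. f x = y} \<le> k"
  shows "card A \<le> k * card (f ` A)"
proof -
  have "card A = (\<Sum>y\<in>f ` A. card {x \<in> A. f x = y})"
    using sum.image_gen[OF assms(1), of "\<lambda>_. 1::nat" f] by simp
  also have "\<dots> \<le> card (f ` A) * k"
    using sum_bounded_above[of "f ` A" "\<lambda>y. card {x \<in> A. f x = y}" k] assms(2) by simp
  finally show ?thesis by (simp add: mult.commute)
qed

text \<open>
  The boxes grow polynomially, so \<open>g \<mapsto> g \<phi>(g)\<^sup>-\<^sup>1\<close> can neither shrink them by a large factor
  while its image has bounded index, nor have image of large index without collapsing them.
\<close>

lemma (in comm_group) balanced_finitely_generated: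
  assumes S: "finite S" "generate G S = carrier G" and \<phi>: "\<phi> \<in> hom G G"
  shows "balanced G \<phi> (carrier G)"
proof -
  interpret f: group_hom G G \<phi>
    by (rule group_hom.intro[OF is_group is_group group_hom_axioms.intro[OF \<phi>]])
  obtain ss where ss: "set ss = S" using finite_list[OF S(1)] by blast
  have Sc: "S \<subseteq> carrier G" unfolding S(2)[symmetric] by (rule subsetI) (rule generate.incl)
  have ssc: "set ss \<subseteq> carrier G" and ssg: "generate G (set ss) = carrier G" using ss Sc S(2) by simp_all
  note bc = subsetD[OF box_carrier[OF ssc]]
  define l where "l = length ss"
  define A where "A = insert \<one> (S \<union> (\<lambda>s. inv s) ` S)"
  have A: "finite A" "A \<subseteq> carrier G" "\<one> \<in> A" "set ss \<subseteq> A" "\<And>s. s \<in> set ss \<Longrightarrow> inv s \<in> A"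
    using S(1) Sc by (auto simp: A_def ss)
  have box_words: "box ss M \<subseteq> words A (l * M)" for M
    unfolding l_def by (rule box_subset_words[OF A(2-5)])
  define \<psi> where "\<psi> g = g \<otimes> inv (\<phi> g)" for g
  have \<psi>_c [simp]: "g \<in> carrier G \<Longrightarrow> \<psi> g \<in> carrier G" for g by (simp add: \<psi>_def)
  have m4: "(a \<otimes> b) \<otimes> (c \<otimes> d) = (a \<otimes> c) \<otimes> (b \<otimes> d)"
    if "a \<in> carrier G" "b \<in> carrier G" "c \<in> carrier G" "d \<in> carrier G" for a b c d
    using that by (simp add: m_ac)
  have \<psi>_mult: "\<lbrakk>g \<in> carrier G; h \<in> carrier G\<rbrakk> \<Longrightarrow> \<psi> (g \<otimes> h) = \<psi> g \<otimes> \<psi> h" for g h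
    by (simp add: \<psi>_def inv_mult m_ac)
  have \<psi>_inv: "g \<in> carrier G \<Longrightarrow> \<psi> (inv g) = inv (\<psi> g)" for g
    by (simp add: \<psi>_def inv_mult m_ac)
  have \<psi>_one: "\<psi> \<one> = \<one>" by (simp add: \<psi>_def)
  define K where "K = {x \<in> carrier G. \<phi> x = x}"
  have \<psi>_eq_one: "\<psi> x = \<one> \<longleftrightarrow> \<phi> x = x" if "x \<in> carrier G" for x
  proof
    assume "\<psi> x = \<one>"
    then have "x \<otimes> inv (\<phi> x) \<otimes> \<phi> x = \<one> \<otimes> \<phi> x" by (simp add: \<psi>_def)
    then show "\<phi> x = x" using that by (simp add: m_assoc)
  qed (use that in \<open>simp add: \<psi>_def\<close>)
  have twist: "g \<otimes> y \<otimes> inv (\<phi> g) = y \<otimes> \<psi> g" if "g \<in> carrier G" "y \<in> carrier G" for g y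
    using that by (simp add: \<psi>_def m_ac)
  \<comment> \<open>The constant \<open>C\<close> depends on \<open>c\<close> alone. The offset
    \<open>M0\<close> of a finite set to be bounded is absorbed by taking \<open>M\<close> large,
    and \<open>c + 1\<close> by a power of two.\<close>
  have doubling: "\<exists>C. \<forall>M0 M. M0 \<le> M \<longrightarrow> card (box ss (M0 + c * M)) \<le> C * card (box ss M)" for c
  proof (intro exI allI impI)
    fix M0 M :: nat assume "M0 \<le> M"
    then have "M0 + c * M \<le> Suc c * M" by simp
    also have "\<dots> \<le> 2 ^ Suc c * M" using less_exp[of "Suc c"] by (intro mult_right_mono) simp_all
    finally have "card (box ss (M0 + c * M)) \<le> card (box ss (2 ^ Suc c * M))"
      by (intro card_mono finite_box box_mono)
    also have "\<dots> \<le> (3 ^ l) ^ Suc c * card (box ss M)"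
      unfolding l_def by (rule card_box_double[OF ssc])
    finally show "card (box ss (M0 + c * M)) \<le> (3 ^ l) ^ Suc c * card (box ss M)" .
  qed
  show ?thesis unfolding balanced_def K_def[symmetric]
  proof
    assume finK: "finite K"
    have "finite (\<psi> ` A)" "\<psi> ` A \<subseteq> carrier G" using A(1,2) \<psi>_c by (auto dest!: subsetD)
    then obtain c where c: "\<psi> ` A \<subseteq> box ss c"
      using finite_subset_box[OF ssc ssg] by blast
    have words: "\<psi> w \<in> box ss (c * n)" if "w \<in> words A n" for w n
      using that
    proof (induction n arbitrary: w)
      case 0
      then show ?case using one_in_box[OF ssc] \<psi>_one by simp
    next
      case (Suc n)
      then obtain a v where av: "a \<in> A" "v \<in> words A n" "w = a \<otimes> v" by auto
      then have "\<psi> w = \<psi> a \<otimes> \<psi> v"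
        using A(2) words_carrier[OF A(2), of n] by (auto intro!: \<psi>_mult)
      then show ?case
        using box_mult[OF ssc, of "\<psi> a" c "\<psi> v" "c * n"] av c Suc.IH by auto
    qed
    obtain C where C: "\<And>M0 M. M0 \<le> M \<Longrightarrow> card (box ss (M0 + (c * l) * M)) \<le> C * card (box ss M)"
      using doubling[of "c * l"] by blast
    have fibre: "card {x \<in> box ss M. \<psi> x = d} \<le> card K" if d: "d \<in> \<psi> ` box ss M" for M d
    proof -
      obtain x0 where x0: "x0 \<in> box ss M" "\<psi> x0 = d" using d by blast
      show ?thesis
      proof (rule card_inj_on_le[where f = "\<lambda>x. inv x0 \<otimes> x"])
        show "inj_on (\<lambda>x. inv x0 \<otimes> x) {x \<in> box ss M. \<psi> x = d}"
          using x0 bc by (auto simp: inj_on_def)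
        have "inv x0 \<otimes> x \<in> K" if "x \<in> box ss M" "\<psi> x = d" for x
          using that x0 bc \<psi>_eq_one[of "inv x0 \<otimes> x"] \<psi>_c[of x0] unfolding K_def
          by (auto simp: \<psi>_mult \<psi>_inv)
        then show "(\<lambda>x. inv x0 \<otimes> x) ` {x \<in> box ss M. \<psi> x = d} \<subseteq> K" by blast
      qed (rule finK)
    qed
    define sep where "sep Y \<longleftrightarrow> finite Y \<and> Y \<subseteq> carrier G \<and>
      (\<forall>y\<in>Y. \<forall>y'\<in>Y. y \<noteq> y' \<longrightarrow> y \<otimes> inv y' \<notin> \<psi> ` carrier G)" for Y
    \<comment> \<open>The translates of \<open>?D\<close> by a separated set are disjoint and fit
      into a box of comparable size, while \<open>?D\<close> is smaller than the box by at most the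
      factor \<open>card K\<close>. This bounds the index of the image of \<psi>.\<close>
    have bound: "card Y \<le> C * card K" if Y: "sep Y" for Y
    proof -
      have "finite Y" "Y \<subseteq> carrier G" using Y by (simp_all add: sep_def)
      then obtain M where M: "Y \<subseteq> box ss M"
        using finite_subset_box[OF ssc ssg] by blast
      let ?D = "\<psi> ` box ss M"
      have D: "?D \<subseteq> box ss (c * l * M)"
        using words box_words[of M] by (auto simp: mult.assoc)
      have "card Y * card ?D = card (Y \<times> ?D)" by (simp add: card_cartesian_product)
      also have "\<dots> \<le> card (box ss (M + c * l * M))"
      proof (rule card_inj_on_le[where f = "\<lambda>(y, d). y \<otimes> d"])
        show "inj_on (\<lambda>(y, d). y \<otimes> d) (Y \<times> ?D)"
        proof (rule inj_onI, clarify)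
          fix y g y' g' assume *: "y \<in> Y" "g \<in> box ss M" "y' \<in> Y" "g' \<in> box ss M"
            "y \<otimes> \<psi> g = y' \<otimes> \<psi> g'"
          then have cc: "y \<in> carrier G" "g \<in> carrier G" "y' \<in> carrier G" "g' \<in> carrier G"
            using Y bc by (auto simp: sep_def)
          have "y \<otimes> inv y' = (y \<otimes> \<psi> g) \<otimes> (inv y' \<otimes> inv (\<psi> g))"
            using cc by (simp add: m_ac)
          also have "\<dots> = (y' \<otimes> inv y') \<otimes> (\<psi> g' \<otimes> inv (\<psi> g))"
            unfolding *(5) using cc by (intro m4) simp_all
          also have "\<dots> = \<psi> (g' \<otimes> inv g)" using cc by (simp add: \<psi>_mult \<psi>_inv)
          finally have "y \<otimes> inv y' \<in> \<psi> ` carrier G" using cc by auto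
          then have "y = y'" using Y * by (auto simp: sep_def)
          then show "y = y' \<and> \<psi> g = \<psi> g'" using *(5) cc by simp
        qed
        show "(\<lambda>(y, d). y \<otimes> d) ` (Y \<times> ?D) \<subseteq> box ss (M + c * l * M)"
        proof clarify
          fix y g assume "y \<in> Y" "g \<in> box ss M"
          then show "y \<otimes> \<psi> g \<in> box ss (M + c * l * M)"
            by (rule box_mult[OF ssc subsetD[OF M] subsetD[OF D imageI]])
        qed
      qed (rule finite_box)
      also have "\<dots> \<le> C * card (box ss M)" by (rule C) simp
      also have "\<dots> \<le> C * (card K * card ?D)"
        by (intro mult_left_mono card_le_fibre_bound finite_box fibre) auto
      finally have "card Y * card ?D \<le> (C * card K) * card ?D" by (simp add: mult.assoc)
      moreover have "card ?D > 0"
        using finite_box[of ss M] one_in_box[OF ssc, of M] by (auto simp: card_gt_0_iff)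
      ultimately show ?thesis by simp
    qed
    \<comment> \<open>A separated set of largest size is a full set of representatives, since an
      element not covered by it could be added.\<close>
    define n where "n = (GREATEST n. \<exists>Y. sep Y \<and> card Y = n)"
    have sep0: "\<exists>Y. sep Y \<and> card Y = 0" by (rule exI[of _ "{}"]) (simp add: sep_def)
    have le: "m \<le> C * card K" if "\<exists>Y. sep Y \<and> card Y = m" for m using that bound by blast
    obtain Y where Y: "sep Y" "card Y = n"
      using GreatestI_nat[of "\<lambda>n. \<exists>Y. sep Y \<and> card Y = n", OF sep0 le] unfolding n_def by blast
    have max: "card Z \<le> n" if "sep Z" for Z
      unfolding n_def
      by (rule Greatest_le_nat[of "\<lambda>n. \<exists>Y. sep Y \<and> card Y = n", OF _ le]) (use that in blast)
    have "\<exists>y\<in>Y. \<exists>g\<in>carrier G. x = g \<otimes> y \<otimes> inv (\<phi> g)" if x: "x \<in> carrier G" for x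
    proof -
      have Yc: "y \<in> carrier G" if "y \<in> Y" for y using that Y by (auto simp: sep_def)
      have "\<exists>y\<in>Y. x \<otimes> inv y \<in> \<psi> ` carrier G"
      proof (rule ccontr)
        assume neg: "\<not> (\<exists>y\<in>Y. x \<otimes> inv y \<in> \<psi> ` carrier G)"
        have "x \<otimes> inv x \<in> \<psi> ` carrier G" using x \<psi>_one by (auto intro!: image_eqI[of _ _ \<one>])
        then have "x \<notin> Y" using neg by blast
        have "y \<otimes> inv x \<notin> \<psi> ` carrier G" if y: "y \<in> Y" for y
        proof
          assume "y \<otimes> inv x \<in> \<psi> ` carrier G"
          then obtain g where "g \<in> carrier G" "y \<otimes> inv x = \<psi> g" by blast
          then have "\<psi> (inv g) = inv (y \<otimes> inv x)" by (simp add: \<psi>_inv)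
          also have "\<dots> = x \<otimes> inv y" using Yc[OF y] x by (simp add: inv_mult m_comm)
          finally have "x \<otimes> inv y \<in> \<psi> ` carrier G" using \<open>g \<in> carrier G\<close>
            by (metis image_eqI inv_closed)
          then show False using neg y by blast
        qed
        then have "sep (insert x Y)" using Y(1) neg x by (simp add: sep_def)
        then show False using max[of "insert x Y"] \<open>x \<notin> Y\<close> Y by (simp add: sep_def)
      qed
      then obtain y g where yg: "y \<in> Y" "g \<in> carrier G" "x \<otimes> inv y = \<psi> g" by blast
      have "x = y \<otimes> (x \<otimes> inv y)" using x Yc[OF yg(1)] by (simp add: m_ac)
      then have "x = g \<otimes> y \<otimes> inv (\<phi> g)" unfolding twist[OF yg(2) Yc[OF yg(1)]] yg(3) .
      then show ?thesis using yg(1,2) by (intro bexI)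
    qed
    then show "twisted_finite G \<phi> (carrier G)"
      unfolding twisted_finite_def using Y(1) by (intro exI[of _ Y]) (simp add: sep_def)
  next
    assume "twisted_finite G \<phi> (carrier G)"
    then obtain Y where Y: "finite Y" "Y \<subseteq> carrier G" and
      cover: "\<forall>x\<in>carrier G. \<exists>y\<in>Y. \<exists>g\<in>carrier G. x = g \<otimes> y \<otimes> inv (\<phi> g)"
      unfolding twisted_finite_def by (elim exE conjE)
    have cover': "\<exists>y\<in>Y. \<exists>g\<in>carrier G. x = y \<otimes> \<psi> g" if x: "x \<in> carrier G" for x
    proof -
      obtain y g where yg: "y \<in> Y" "g \<in> carrier G" "x = g \<otimes> y \<otimes> inv (\<phi> g)"
        using bspec[OF cover x] by (elim bexE)
      show ?thesis
        using yg(1,2) yg(3)[unfolded twist[OF yg(2) subsetD[OF Y(2) yg(1)]]] by (intro bexI)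
    qed
    \<comment> \<open>\<gamma> chooses an element by which \<open>x\<close> is twisted from a
      representative in \<open>Y\<close>. Only its values at \<open>\<one>\<close> and at the
      finitely many products of a letter with a representative will matter, so one box of size
      \<open>c\<close> holds them all.\<close>
    have "\<exists>\<gamma>. \<forall>x\<in>carrier G. \<gamma> x \<in> carrier G \<and> (\<exists>y\<in>Y. x = y \<otimes> \<psi> (\<gamma> x))"
      using cover' by (intro bchoice) blast
    then obtain \<gamma> where \<gamma>: "\<And>x. x \<in> carrier G \<Longrightarrow> \<gamma> x \<in> carrier G"
      "\<And>x. x \<in> carrier G \<Longrightarrow> \<exists>y\<in>Y. x = y \<otimes> \<psi> (\<gamma> x)" by blast
    have "finite (\<gamma> ` insert \<one> ((\<lambda>(a, y). a \<otimes> y) ` (A \<times> Y)))" using A(1) Y(1) by simp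
    moreover have "\<gamma> ` insert \<one> ((\<lambda>(a, y). a \<otimes> y) ` (A \<times> Y)) \<subseteq> carrier G"
      using \<gamma>(1) subsetD[OF A(2)] subsetD[OF Y(2)] by auto
    ultimately obtain c where c: "\<gamma> ` insert \<one> ((\<lambda>(a, y). a \<otimes> y) ` (A \<times> Y)) \<subseteq> box ss c"
      using finite_subset_box[OF ssc ssg] by blast
    \<comment> \<open>Absorbing a letter replaces the representative and costs one further factor
      from the box of size \<open>c\<close>. So a word of length \<open>n\<close> is a
      representative times the \<psi>-value of an element whose box size is linear in
      \<open>n\<close>.\<close>
    have words: "\<exists>y\<in>Y. \<exists>g\<in>box ss (c + c * n). w = y \<otimes> \<psi> g" if "w \<in> words A n" for w n
      using that
    proof (induction n arbitrary: w)
      case 0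
      then show ?case using \<gamma>(2)[of \<one>] c by auto
    next
      case (Suc n)
      then obtain a v where av: "a \<in> A" "v \<in> words A n" "w = a \<otimes> v" by auto
      then obtain y g where yg: "y \<in> Y" "g \<in> box ss (c + c * n)" "v = y \<otimes> \<psi> g"
        using Suc.IH by blast
      have cc: "a \<in> carrier G" "y \<in> carrier G" "g \<in> carrier G" using av yg A(2) Y(2) bc by auto
      obtain y' where y': "y' \<in> Y" "a \<otimes> y = y' \<otimes> \<psi> (\<gamma> (a \<otimes> y))" using \<gamma>(2)[of "a \<otimes> y"] cc by auto
      have y'c: "y' \<in> carrier G" using y' Y by auto
      have "w = (a \<otimes> y) \<otimes> \<psi> g" using cc by (simp add: av yg m_assoc)
      also have "\<dots> = y' \<otimes> \<psi> (\<gamma> (a \<otimes> y) \<otimes> g)"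
        using cc y'c \<gamma>(1)[of "a \<otimes> y"] by (subst y'(2)) (simp add: \<psi>_mult m_assoc)
      finally have "w = y' \<otimes> \<psi> (\<gamma> (a \<otimes> y) \<otimes> g)" .
      moreover have "\<gamma> (a \<otimes> y) \<in> box ss c" using c av(1) yg(1) by blast
      then have "\<gamma> (a \<otimes> y) \<otimes> g \<in> box ss (c + (c + c * n))" using yg(2) by (rule box_mult[OF ssc])
      ultimately show ?case using y'(1) by (auto simp: algebra_simps)
    qed
    obtain C where C: "\<And>M0 M. M0 \<le> M \<Longrightarrow> card (box ss (M0 + (c * l) * M)) \<le> C * card (box ss M)"
      using doubling[of "c * l"] by blast
    \<comment> \<open>By \<open>words\<close> the set \<open>?D\<close> has at least
      \<open>card (box ss M) / card Y\<close> elements. A section \<open>r\<close> of \<psi> over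
      \<open>?D\<close>, translated by the fixed points in \<open>Z\<close>, gives distinct elements
      of a box comparable to \<open>box ss M\<close>, so \<open>Z\<close> cannot be large.\<close>
    have bound: "card Z \<le> C * card Y" if Z: "finite Z" "Z \<subseteq> K" for Z
    proof -
      have "Z \<subseteq> carrier G" using Z(2) by (auto simp: K_def)
      then obtain M0 where M0: "Z \<subseteq> box ss M0"
        using finite_subset_box[OF ssc ssg Z(1)] by blast
      \<comment> \<open>With this choice \<open>M0\<close> plus the offset \<open>c\<close> from
        \<open>words\<close> is \<open>M\<close> itself, and \<open>C\<close> applies with
        \<open>M\<close> in the role of \<open>M0\<close>.\<close>
      define M where "M = M0 + c"
      let ?E = "box ss (c + c * l * M)"
      let ?D = "\<psi> ` ?E"
      have "box ss M \<subseteq> (\<lambda>(y, d). y \<otimes> d) ` (Y \<times> ?D)"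
      proof
        fix x assume "x \<in> box ss M"
        then obtain y g where "y \<in> Y" "g \<in> ?E" "x = y \<otimes> \<psi> g"
          using words[of x "l * M"] box_words[of M] by (auto simp: mult.assoc)
        then show "x \<in> (\<lambda>(y, d). y \<otimes> d) ` (Y \<times> ?D)"
          by (intro image_eqI[of _ _ "(y, \<psi> g)"]) auto
      qed
      then have "card (box ss M) \<le> card Y * card ?D"
        using surj_card_le[of "Y \<times> ?D" "box ss M" "\<lambda>(y, d). y \<otimes> d"] Y(1) finite_box
        by (simp add: card_cartesian_product)
      define r where "r = inv_into ?E \<psi>"
      have r: "r d \<in> ?E" "\<psi> (r d) = d" if "d \<in> ?D" for d
        using that unfolding r_def by (auto intro: inv_into_into f_inv_into_f)
      have "card Z * card ?D = card (Z \<times> ?D)" by (simp add: card_cartesian_product)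
      also have "\<dots> \<le> card (box ss (M0 + (c + c * l * M)))"
      proof (rule card_inj_on_le[where f = "\<lambda>(z, d). z \<otimes> r d"])
        show "inj_on (\<lambda>(z, d). z \<otimes> r d) (Z \<times> ?D)"
        proof (rule inj_onI, safe)
          fix z d z' d' assume z: "z \<in> Z" "z' \<in> Z" and d: "d \<in> ?E" "d' \<in> ?E"
            and eq: "z \<otimes> r (\<psi> d) = z' \<otimes> r (\<psi> d')"
          have cc: "z \<in> carrier G" "z' \<in> carrier G" "r (\<psi> d) \<in> carrier G" "r (\<psi> d') \<in> carrier G"
            using z \<open>Z \<subseteq> carrier G\<close> bc[OF r(1)[OF imageI[OF d(1)]]] bc[OF r(1)[OF imageI[OF d(2)]]] by blast+
          have "z \<in> K" "z' \<in> K" using z Z(2) by blast+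
          then have zz: "\<psi> z = \<one>" "\<psi> z' = \<one>" using \<psi>_eq_one by (simp_all add: K_def)
          have "\<psi> (z \<otimes> r (\<psi> d)) = \<psi> d" "\<psi> (z' \<otimes> r (\<psi> d')) = \<psi> d'"
            using cc r(2)[OF imageI[OF d(1)]] r(2)[OF imageI[OF d(2)]] bc d
            by (simp_all add: \<psi>_mult zz)
          then show dd: "\<psi> d = \<psi> d'" using eq by simp
          show "z = z'" using eq cc unfolding dd by simp
        qed
        show "(\<lambda>(z, d). z \<otimes> r d) ` (Z \<times> ?D) \<subseteq> box ss (M0 + (c + c * l * M))"
        proof clarify
          fix z d assume "z \<in> Z" "d \<in> ?E"
          then show "z \<otimes> r (\<psi> d) \<in> box ss (M0 + (c + c * l * M))"
            by (rule box_mult[OF ssc subsetD[OF M0] r(1)[OF imageI]])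
        qed
      qed (rule finite_box)
      also have "\<dots> = card (box ss (M + c * l * M))" by (simp add: M_def add.assoc)
      also have "\<dots> \<le> C * card (box ss M)" by (rule C) simp
      also have "\<dots> \<le> C * (card Y * card ?D)"
        using \<open>card (box ss M) \<le> card Y * card ?D\<close> by (rule mult_left_mono) simp
      finally have "card Z * card ?D \<le> (C * card Y) * card ?D" by (simp add: mult.assoc)
      moreover have "card ?D > 0"
        using finite_box[of ss] one_in_box[OF ssc] by (auto simp: card_gt_0_iff)
      ultimately show ?thesis by simp
    qed
    show "finite K"
    proof (rule ccontr)
      assume "infinite K"
      then obtain Z where "finite Z" "card Z = Suc (C * card Y)" "Z \<subseteq> K"
        using infinite_arbitrarily_large by blast
      then show False using bound[of Z] by simp
    qed
  qed
qed

section \<open>Finitely generated nilpotent groups\<close>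

lemma (in group) balanced_subgroup_iff:
  assumes N: "subgroup N G" and \<phi>: "\<And>x. x \<in> N \<Longrightarrow> \<phi> x \<in> N"
  shows "balanced G \<phi> N \<longleftrightarrow> balanced (G\<lparr>carrier := N\<rparr>) \<phi> N"
  unfolding balanced_def twisted_finite_def
  by (simp add: m_inv_consistent[OF N] \<phi> cong: bex_cong)

lemma (in group) balanced_finitely_generated_abelian:
  assumes N: "subgroup N G" and comm: "\<And>x y. \<lbrakk>x \<in> N; y \<in> N\<rbrakk> \<Longrightarrow> x \<otimes> y = y \<otimes> x"
    and S: "finite S" "S \<subseteq> N" "N \<subseteq> generate G S"
    and \<phi>: "\<phi> \<in> hom G G" "\<And>x. x \<in> N \<Longrightarrow> \<phi> x \<in> N"
  shows "balanced G \<phi> N"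
proof -
  let ?K = "G\<lparr>carrier := N\<rparr>"
  have "group ?K" by (rule subgroup_imp_group[OF N])
  then interpret K: comm_group ?K by (rule group.group_comm_groupI) (simp add: comm)
  have "generate ?K S = carrier ?K"
    using generate_consistent[OF S(2) N] S(3) generate_subgroup_incl[OF S(2) N] by simp
  moreover have "\<phi> \<in> hom ?K ?K"
    using \<phi> subgroup.subset[OF N] by (auto simp: hom_def Pi_def subset_iff)
  ultimately have "balanced ?K \<phi> (carrier ?K)" by (rule K.balanced_finitely_generated[OF S(1)])
  then show ?thesis using balanced_subgroup_iff[OF N \<phi>(2)] by simp
qed

text \<open>When term \<open>Suc n\<close> is trivial, term \<open>n\<close> is central, and it is
  finitely generated because the layer generators of \<open>lower_central_finitely_generated\<close>
  then generate it outright. The abelian case applies to it, and dividing it out shortens the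
  series.\<close>

theorem balanced_finitely_generated_nilpotent:
  fixes G :: "'a monoid"
  assumes "group G" "lower_central G n = {\<one>\<^bsub>G\<^esub>}" "finite S" "generate G S = carrier G" "\<phi> \<in> hom G G"
  shows "balanced G \<phi> (carrier G)"
  using assms
proof (induction n arbitrary: G S \<phi>)
  case (0 G)
  then have "carrier G = {\<one>\<^bsub>G\<^esub>}" by simp
  moreover have "twisted_finite G \<phi> (carrier G)"
    unfolding twisted_finite_carrier_iff
    using equiv_twisted_conj[OF 0(1,5)] calculation
    by (intro exI[of _ "carrier G"]) (auto simp: equiv_def refl_on_def)
  ultimately show ?case unfolding balanced_def by simp
next
  case (Suc n G)
  interpret group G by (rule Suc.prems(1))
  interpret f: group_hom G G \<phi>
    by (rule group_hom.intro[OF is_group is_group group_hom_axioms.intro[OF Suc.prems(5)]])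
  define N where "N = lower_central G n"
  have N: "subgroup N G" unfolding N_def by (rule lower_central_subgroup)
  have Nc: "x \<in> carrier G" if "x \<in> N" for x using that subgroup.mem_carrier[OF N] by blast
  have central: "x \<otimes>\<^bsub>G\<^esub> g = g \<otimes>\<^bsub>G\<^esub> x" if x: "x \<in> N" and g: "g \<in> carrier G" for x g
  proof -
    have "g \<otimes>\<^bsub>G\<^esub> x \<otimes>\<^bsub>G\<^esub> inv\<^bsub>G\<^esub> g \<otimes>\<^bsub>G\<^esub> inv\<^bsub>G\<^esub> x = \<one>\<^bsub>G\<^esub>"
      using commutator_in_lower_central[OF g] x Suc.prems(2) unfolding N_def by blast
    then have "(g \<otimes>\<^bsub>G\<^esub> x \<otimes>\<^bsub>G\<^esub> inv\<^bsub>G\<^esub> g \<otimes>\<^bsub>G\<^esub> inv\<^bsub>G\<^esub> x) \<otimes>\<^bsub>G\<^esub> x \<otimes>\<^bsub>G\<^esub> g = x \<otimes>\<^bsub>G\<^esub> g"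
      using Nc[OF x] g by simp
    then show ?thesis using Nc[OF x] g by (simp add: word_simps)
  qed
  obtain T where T: "finite T" "T \<subseteq> N" "N \<subseteq> generate G (T \<union> {\<one>\<^bsub>G\<^esub>})"
    using lower_central_finitely_generated[OF Suc.prems(3,4), of n] unfolding Suc.prems(2) N_def by blast
  have \<phi>N: "\<phi> x \<in> N" if "x \<in> N" for x
    using f.image_lower_central[of n] that unfolding N_def by blast
  have bN: "balanced G \<phi> N"
  proof (rule balanced_finitely_generated_abelian[OF N _ _ _ T(3) Suc.prems(5) \<phi>N])
    show "finite (T \<union> {\<one>\<^bsub>G\<^esub>})" "T \<union> {\<one>\<^bsub>G\<^esub>} \<subseteq> N" using T(1,2) subgroup.one_closed[OF N] by auto
  qed (use central Nc in auto)
  obtain H :: "'a monoid" and q where H: "group H" and q: "q \<in> hom G H" "q ` carrier G = carrier H"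
    and ker: "kernel G H q = N"
    by (rule central_quotient[OF N central]) 
  interpret q: group_hom G H q
    by (rule group_hom.intro[OF is_group H group_hom_axioms.intro[OF q(1)]])
  obtain \<phi>' where \<phi>': "\<phi>' \<in> hom H H" "\<And>x. x \<in> carrier G \<Longrightarrow> \<phi>' (q x) = q (\<phi> x)"
    using q.hom_descends[OF q(2) Suc.prems(5)] \<phi>N unfolding ker by blast
  have "q x = \<one>\<^bsub>H\<^esub>" if "x \<in> N" for x using that unfolding ker[symmetric] kernel_def by blast
  then have "lower_central H n \<subseteq> {\<one>\<^bsub>H\<^esub>}"
    using q.lower_central_surj[OF q(2), of n] unfolding N_def[symmetric] by auto
  then have "lower_central H n = {\<one>\<^bsub>H\<^esub>}"
    using subgroup.one_closed[OF group.lower_central_subgroup[OF H, of n]] by blast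
  moreover have "generate H (q ` S) = carrier H"
  proof -
    have "S \<subseteq> carrier G" unfolding Suc.prems(4)[symmetric] by (rule subsetI) (rule generate.incl)
    then show ?thesis using q.generate_img[of S] Suc.prems(4) q(2) by simp
  qed
  ultimately have "balanced H \<phi>' (carrier H)"
    using Suc.IH[OF H _ _ _ \<phi>'(1)] Suc.prems(3) by blast
  then show ?case
    by (intro balanced_extension[OF is_group H q ker[symmetric] central Suc.prems(5) \<phi>' bN])
qed

section \<open>Linear algebra and limits\<close>

text \<open>The projection has two uses: it turns a map given only on a subspace into a linear map
  on the whole type, and it splits off a subspace without increasing norms, so that smallness
  conditions survive. Linearity follows from uniqueness of the nearest point.\<close>

lemma orthogonal_projection_exists:
  fixes W :: "'e::euclidean_space set"
  assumes W: "subspace W"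
  obtains P where "linear P" "\<And>x. P x \<in> W" "\<And>x w. w \<in> W \<Longrightarrow> (x - P x) \<bullet> w = 0"
    "\<And>x. norm (P x) \<le> norm x" "\<And>x. norm (x - P x) \<le> norm x" "\<And>x. x \<in> W \<Longrightarrow> P x = x"
proof -
  have "\<exists>y. y \<in> W \<and> (\<forall>w\<in>W. (x - y) \<bullet> w = 0)" for x
  proof -
    obtain y z where yz: "y \<in> span W" "\<And>w. w \<in> span W \<Longrightarrow> orthogonal z w" "x = y + z"
      using orthogonal_subspace_decomp_exists[of W x] by metis
    moreover have "span W = W" using span_eq_iff[of W] W by simp
    ultimately show ?thesis by (intro exI[of _ y]) (auto simp: orthogonal_def)
  qed
  then obtain P where P: "\<And>x. P x \<in> W" "\<And>x w. w \<in> W \<Longrightarrow> (x - P x) \<bullet> w = 0" by metis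
  have uniq: "y = P x" if "y \<in> W" "\<And>w. w \<in> W \<Longrightarrow> (x - y) \<bullet> w = 0" for x y
  proof -
    have m: "y - P x \<in> W" using that(1) P(1) W by (simp add: subspace_diff)
    have "(y - P x) \<bullet> (y - P x) = (x - P x) \<bullet> (y - P x) - (x - y) \<bullet> (y - P x)"
      by (simp add: inner_diff_left)
    then have "(y - P x) \<bullet> (y - P x) = 0" using P(2)[OF m] that(2)[OF m] by simp
    then show ?thesis by simp
  qed
  have lin: "linear P"
  proof (rule linearI)
    fix x y :: 'e and c :: real
    show "P (x + y) = P x + P y"
    proof (rule uniq[symmetric])
      fix w assume "w \<in> W"
      then have "(x - P x) \<bullet> w + (y - P y) \<bullet> w = 0" using P(2) by simp
      then show "(x + y - (P x + P y)) \<bullet> w = 0" by (simp add: inner_diff_left inner_add_left)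
    qed (simp add: P(1) W subspace_add)
    show "P (c *\<^sub>R x) = c *\<^sub>R P x"
    proof (rule uniq[symmetric])
      fix w assume "w \<in> W"
      then have "c * ((x - P x) \<bullet> w) = 0" using P(2) by simp
      then show "(c *\<^sub>R x - c *\<^sub>R P x) \<bullet> w = 0" by (simp add: inner_diff_left right_diff_distrib)
    qed (simp add: P(1) W subspace_scale)
  qed
  have pyth: "(norm x)\<^sup>2 = (norm (P x))\<^sup>2 + (norm (x - P x))\<^sup>2" for x
    using norm_add_Pythagorean[of "P x" "x - P x"] P(2)[OF P(1)[of x], of x]
    by (simp add: orthogonal_def inner_commute)
  have "norm (P x) \<le> norm x" "norm (x - P x) \<le> norm x" for x
    using pyth[of x] by (simp_all add: norm_le_square power2_norm_eq_inner power_mono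
        real_le_rsqrt abs_le_square_iff flip: power2_le_iff_abs_le)
  moreover have "P x = x" if "x \<in> W" for x using uniq[of x x] that by simp
  ultimately show thesis using that lin P by blast
qed

lemma eventually_half_power_less:
  fixes c :: real
  assumes "0 < \<delta>"
  shows "\<forall>\<^sub>F m in sequentially. (1/2)^m * c < \<delta>"
proof -
  have "(\<lambda>m. (1/2)^m * c) \<longlonglongrightarrow> 0 * c"
    by (intro tendsto_mult_right LIMSEQ_realpow_zero) auto
  then show ?thesis using assms by (intro order_tendstoD(2)[of _ 0]) auto
qed

lemma separated_bounded_imp_finite:
  fixes A :: "'e::euclidean_space set"
  assumes "bounded A" "0 < \<eta>" and sep: "\<And>x y. \<lbrakk>x \<in> A; y \<in> A; dist x y < \<eta>\<rbrakk> \<Longrightarrow> x = y"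
  shows "finite A"
proof (rule ccontr)
  assume "infinite A"
  then obtain x where "x islimpt A" using bounded_infinite_imp_islimpt[OF order.refl assms(1)] by blast
  then have inf: "infinite (A \<inter> ball x (\<eta> / 2))" using assms(2) by (simp add: islimpt_eq_infinite_ball)
  then obtain y where y: "y \<in> A \<inter> ball x (\<eta> / 2)" using infinite_imp_nonempty by blast
  have "A \<inter> ball x (\<eta> / 2) \<subseteq> {y}"
  proof
    fix z assume z: "z \<in> A \<inter> ball x (\<eta> / 2)"
    have "dist z y \<le> dist x z + dist x y" by (metis dist_commute dist_triangle)
    also have "\<dots> < \<eta>" using y z by simp
    finally show "z \<in> {y}" using sep[of z y] y z by simp
  qed
  then show False using inf finite_subset by blast
qed

lemma le_zero_if_small_multiples:
  fixes a c :: real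
  assumes "\<And>\<epsilon>. \<lbrakk>0 < \<epsilon>; \<epsilon> \<le> 1\<rbrakk> \<Longrightarrow> a \<le> \<epsilon> * c"
  shows "a \<le> 0"
proof (rule ccontr)
  assume a: "\<not> a \<le> 0"
  then have c: "c > 0" using assms[of 1] by simp
  define \<epsilon> where "\<epsilon> = min 1 (a / (2 * c))"
  have "\<epsilon> * c \<le> a / (2 * c) * c" using c by (intro mult_right_mono) (auto simp: \<epsilon>_def)
  then have "\<epsilon> * c \<le> a / 2" using c by simp
  then show False using assms[of \<epsilon>] a c by (auto simp: \<epsilon>_def)
qed

text \<open>Additivity gives homogeneity for rational scalars. For a real \<open>c\<close> the bound
  is applied to \<open>(c - q) *\<^sub>R x\<close> with \<open>q\<close> rational and close to
  \<open>c\<close>.\<close>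

lemma linear_if_additive_bounded:
  fixes F :: "'e::real_normed_vector \<Rightarrow> 'f::real_normed_vector"
  assumes add: "\<And>x y. F (x + y) = F x + F y" and bound: "\<And>x. norm (F x) \<le> B * norm x"
  shows "linear F"
proof -
  have zero: "F 0 = 0" using add[of 0 0] by simp
  have neg: "F (- x) = - F x" for x using add[of "- x" x] zero by (simp add: eq_neg_iff_add_eq_0)
  have nat: "F (real n *\<^sub>R x) = real n *\<^sub>R F x" for n x
    by (induction n) (simp_all add: zero add scaleR_add_left)
  have int: "F (of_int i *\<^sub>R x) = of_int i *\<^sub>R F x" for i x
  proof (cases i)
    case (nonneg n)
    then show ?thesis using nat[of n x] by simp
  next
    case (neg n)
    then show ?thesis using nat[of "Suc n" x] \<open>\<And>x. F (- x) = - F x\<close>[of "real (Suc n) *\<^sub>R x"]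
      by (simp del: of_nat_Suc)
  qed
  have rat: "F (q *\<^sub>R x) = q *\<^sub>R F x" if qr: "q \<in> \<rat>" for q x
  proof -
    obtain i j where q: "0 < j" "q = of_int i / of_int j" using Rats_cases'[OF qr] by metis
    have "of_int j *\<^sub>R F (q *\<^sub>R x) = F (of_int j *\<^sub>R (q *\<^sub>R x))" by (simp only: int)
    also have "\<dots> = of_int i *\<^sub>R F x" using q int[of i x] by simp
    also have "\<dots> = of_int j *\<^sub>R (q *\<^sub>R F x)" using q by simp
    finally show ?thesis
      by (rule scaleR_left_imp_eq[rotated]) (use q(1) in simp)
  qed
  show ?thesis
  proof (rule linearI[OF add])
    fix c :: real and x
    have "norm (F (c *\<^sub>R x) - c *\<^sub>R F x) \<le> \<epsilon> * (2 * (B * norm x))" if ep: "0 < \<epsilon>" for \<epsilon>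
    proof -
      obtain q where q: "q \<in> \<rat>" "c < q" "q < c + \<epsilon>" using Rats_dense_in_real[of c "c + \<epsilon>"] ep by auto
      have "F (c *\<^sub>R x) = F ((c - q) *\<^sub>R x) + q *\<^sub>R F x"
        using add[of "(c - q) *\<^sub>R x" "q *\<^sub>R x"] rat[OF q(1)] by (simp flip: scaleR_add_left)
      then have "F (c *\<^sub>R x) - c *\<^sub>R F x = F ((c - q) *\<^sub>R x) - (c - q) *\<^sub>R F x"
        by (simp add: algebra_simps)
      then have "norm (F (c *\<^sub>R x) - c *\<^sub>R F x) \<le> norm (F ((c - q) *\<^sub>R x)) + norm ((c - q) *\<^sub>R F x)"
        using norm_triangle_ineq4[of "F ((c - q) *\<^sub>R x)" "(c - q) *\<^sub>R F x"] by simp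
      also have "\<dots> \<le> B * (\<bar>c - q\<bar> * norm x) + \<bar>c - q\<bar> * (B * norm x)"
      proof (rule add_mono)
        show "norm (F ((c - q) *\<^sub>R x)) \<le> B * (\<bar>c - q\<bar> * norm x)" using bound[of "(c - q) *\<^sub>R x"] by simp
        show "norm ((c - q) *\<^sub>R F x) \<le> \<bar>c - q\<bar> * (B * norm x)"
          using mult_left_mono[OF bound[of x], of "\<bar>c - q\<bar>"] by simp
      qed
      also have "\<dots> = \<bar>c - q\<bar> * (2 * (B * norm x))" by (simp add: algebra_simps)
      also have "\<dots> \<le> \<epsilon> * (2 * (B * norm x))"
        using q bound[of x] order_trans[OF norm_ge_zero bound[of x]] by (intro mult_right_mono) auto
      finally show ?thesis .
    qed
    then have "norm (F (c *\<^sub>R x) - c *\<^sub>R F x) \<le> 0" by (rule le_zero_if_small_multiples)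
    then show "F (c *\<^sub>R x) = c *\<^sub>R F x" by simp
  qed
qed

section \<open>Exponential coordinates that respect halving\<close>

text \<open>Here \<open>ex\<close> is known to respect halving only, which is what iterated square
  roots provide. The map \<mu> is the product in these coordinates, and \<open>mu_diff\<close> says
  that it is strictly differentiable at the origin with derivative addition. The domain is a
  subspace \<open>V\<close> of a fixed type, so that a quotient can use a smaller subspace of the
  same type.\<close>

locale dyadic_exp = group G for G (structure) +
  fixes V :: "'e::euclidean_space set" and ex :: "'e \<Rightarrow> 'a" and \<mu> :: "'e \<Rightarrow> 'e \<Rightarrow> 'e" and r0 :: real
  assumes V: "subspace V" and r0: "0 < r0"
    and ex_closed: "x \<in> V \<Longrightarrow> ex x \<in> carrier G"
    and ex_double: "x \<in> V \<Longrightarrow> ex x = ex ((1/2) *\<^sub>R x) \<otimes> ex ((1/2) *\<^sub>R x)"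
    and ex_inj: "\<lbrakk>x \<in> V; y \<in> V; norm x < r0; norm y < r0; ex x = ex y\<rbrakk> \<Longrightarrow> x = y"
    and mu_zero: "x \<in> V \<Longrightarrow> norm x < r0 \<Longrightarrow> \<mu> x 0 = x"
    and mu_mult: "\<exists>\<delta>>0. \<forall>x\<in>V. \<forall>y\<in>V. norm x < \<delta> \<longrightarrow> norm y < \<delta> \<longrightarrow> \<mu> x y \<in> V \<and> ex x \<otimes> ex y = ex (\<mu> x y)"
    and mu_diff: "0 < \<epsilon> \<Longrightarrow> \<exists>\<delta>>0. \<forall>x\<in>V. \<forall>y\<in>V. \<forall>x'\<in>V. \<forall>y'\<in>V.
      norm x < \<delta> \<longrightarrow> norm y < \<delta> \<longrightarrow> norm x' < \<delta> \<longrightarrow> norm y' < \<delta> \<longrightarrow>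
      norm (\<mu> x y - \<mu> x' y' - (x - x') - (y - y')) \<le> \<epsilon> * (norm (x - x') + norm (y - y'))"
begin

lemma V_scale [simp]: "x \<in> V \<Longrightarrow> c *\<^sub>R x \<in> V" by (rule subspace_scale[OF V])
lemma V_add: "x \<in> V \<Longrightarrow> y \<in> V \<Longrightarrow> x + y \<in> V" by (rule subspace_add[OF V])
lemma V_neg: "x \<in> V \<Longrightarrow> - x \<in> V" by (rule subspace_neg[OF V])
lemma V_zero: "0 \<in> V" by (rule subspace_0[OF V])

lemma ex_zero: "ex 0 = \<one>"
proof -
  have "ex 0 \<otimes> ex 0 = ex 0" using ex_double[OF V_zero] by simp
  then show ?thesis using ex_closed[OF V_zero] by (metis l_cancel_one')
qed

lemma ex_pow_half: "x \<in> V \<Longrightarrow> ex x = ex ((1/2)^m *\<^sub>R x) [^] (2^m :: nat)"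
proof (induction m)
  case (Suc m)
  let ?y = "(1/2)^Suc m *\<^sub>R x"
  have y: "ex ?y \<in> carrier G" using Suc.prems by (intro ex_closed) simp
  have "ex ((1/2)^m *\<^sub>R x) = ex ?y [^] (2::nat)"
    using ex_double[of "(1/2)^m *\<^sub>R x"] Suc.prems y by (simp add: numeral_2_eq_2)
  then show ?case using Suc y by (simp add: nat_pow_pow)
qed (simp add: ex_closed)

text \<open>A radius below which the product formula holds and \<mu> is, in its second argument, a
  translation up to Lipschitz error \<epsilon>. Staying below \<open>r0\<close> makes
  \<open>mu_zero\<close> available.\<close>

definition good :: "real \<Rightarrow> real \<Rightarrow> bool" where
  "good \<epsilon> \<delta> \<longleftrightarrow> 0 < \<delta> \<and> \<delta> \<le> r0 \<and> (\<forall>x\<in>V. \<forall>y\<in>V. \<forall>y'\<in>V. norm x < \<delta> \<longrightarrow> norm y < \<delta> \<longrightarrow> norm y' < \<delta> \<longrightarrow>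
     \<mu> x y \<in> V \<and> ex x \<otimes> ex y = ex (\<mu> x y) \<and>
     norm (\<mu> x y - \<mu> x y' - (y - y')) \<le> \<epsilon> * norm (y - y'))"

lemma good_exists:
  assumes "0 < \<epsilon>"
  shows "\<exists>\<delta>. good \<epsilon> \<delta>"
proof -
  obtain d1 where d1: "d1 > 0" "\<And>x y. \<lbrakk>x \<in> V; y \<in> V; norm x < d1; norm y < d1\<rbrakk> \<Longrightarrow>
      \<mu> x y \<in> V \<and> ex x \<otimes> ex y = ex (\<mu> x y)"
    using mu_mult by auto
  obtain d2 where d2: "d2 > 0" "\<And>x y x' y'. \<lbrakk>x \<in> V; y \<in> V; x' \<in> V; y' \<in> V;
      norm x < d2; norm y < d2; norm x' < d2; norm y' < d2\<rbrakk> \<Longrightarrow>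
      norm (\<mu> x y - \<mu> x' y' - (x - x') - (y - y')) \<le> \<epsilon> * (norm (x - x') + norm (y - y'))"
    using mu_diff[OF assms] by auto
  have "norm (\<mu> x y - \<mu> x y' - (y - y')) \<le> \<epsilon> * norm (y - y')"
    if "x \<in> V" "y \<in> V" "y' \<in> V" "norm x < d2" "norm y < d2" "norm y' < d2" for x y y'
    using d2(2)[of x y x y'] that by simp
  then have "good \<epsilon> (min (min d1 d2) r0)"
    using d1 d2(1) r0 by (simp add: good_def)
  then show ?thesis by blast
qed

lemma
  assumes "good \<epsilon> \<delta>"
  shows good_pos: "0 < \<delta>" and good_le: "\<delta> \<le> r0"
    and good_closed: "\<lbrakk>x \<in> V; y \<in> V; norm x < \<delta>; norm y < \<delta>\<rbrakk> \<Longrightarrow> \<mu> x y \<in> V"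
    and good_mult: "\<lbrakk>x \<in> V; y \<in> V; norm x < \<delta>; norm y < \<delta>\<rbrakk> \<Longrightarrow> ex x \<otimes> ex y = ex (\<mu> x y)"
    and good_diff: "\<lbrakk>x \<in> V; y \<in> V; y' \<in> V; norm x < \<delta>; norm y < \<delta>; norm y' < \<delta>\<rbrakk> \<Longrightarrow>
       norm (\<mu> x y - \<mu> x y' - (y - y')) \<le> \<epsilon> * norm (y - y')"
    and good_approx: "\<lbrakk>x \<in> V; y \<in> V; norm x < \<delta>; norm y < \<delta>\<rbrakk> \<Longrightarrow> norm (\<mu> x y - x - y) \<le> \<epsilon> * norm y"
proof -
  show d: "0 < \<delta>" "\<delta> \<le> r0" using assms by (simp_all add: good_def)
  show "\<lbrakk>x \<in> V; y \<in> V; norm x < \<delta>; norm y < \<delta>\<rbrakk> \<Longrightarrow> \<mu> x y \<in> V"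
    "\<lbrakk>x \<in> V; y \<in> V; norm x < \<delta>; norm y < \<delta>\<rbrakk> \<Longrightarrow> ex x \<otimes> ex y = ex (\<mu> x y)"
    using assms unfolding good_def by blast+
  show *: "norm (\<mu> x y - \<mu> x y' - (y - y')) \<le> \<epsilon> * norm (y - y')"
    if "x \<in> V" "y \<in> V" "y' \<in> V" "norm x < \<delta>" "norm y < \<delta>" "norm y' < \<delta>" for x y y'
    using assms that unfolding good_def by blast
  show "\<lbrakk>x \<in> V; y \<in> V; norm x < \<delta>; norm y < \<delta>\<rbrakk> \<Longrightarrow> norm (\<mu> x y - x - y) \<le> \<epsilon> * norm y"
    using *[of x y 0] V_zero d by (simp add: mu_zero)
qed

lemma mu_norm_le:
  fixes x y :: 'e
  assumes "norm (\<mu> x y - x - y) \<le> \<epsilon> * norm y" "\<epsilon> \<le> 1"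
  shows "norm (\<mu> x y) \<le> norm x + 2 * norm y"
proof -
  have "\<mu> x y = (\<mu> x y - x - y) + x + y" by simp
  then have "norm (\<mu> x y) \<le> norm (\<mu> x y - x - y) + norm x + norm y"
    by (metis norm_triangle_ineq norm_triangle_le add_mono order_refl)
  also have "\<dots> \<le> 1 * norm y + norm x + norm y"
    using assms by (intro add_mono order.refl) (meson mult_right_mono norm_ge_zero order_trans)
  finally show ?thesis by simp
qed

text \<open>Let \<open>z n\<close> be the coordinate of the product at scale \<open>h n\<close>.
  Commutation makes these products successive square roots, so local injectivity forces
  \<open>z n = 2 *\<^sub>R z (Suc n)\<close> exactly. On the other hand \<open>z n\<close> equals
  \<open>h n *\<^sub>R (p + q)\<close> up to a relative error that tends to zero. A relative error
  invariant under doubling and tending to zero vanishes, and raising to a power of two returns to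
  full scale.\<close>

lemma ex_add_if_dyadic_commuting:
  assumes p: "p \<in> V" and q: "q \<in> V"
    and comm: "\<And>n. ex ((1/2)^n *\<^sub>R p) \<otimes> ex ((1/2)^n *\<^sub>R q) = ex ((1/2)^n *\<^sub>R q) \<otimes> ex ((1/2)^n *\<^sub>R p)"
  shows "ex (p + q) = ex p \<otimes> ex q"
proof -
  define h :: "nat \<Rightarrow> real" where "h n = (1/2)^n" for n
  have h: "h n > 0" "h n = 2 * h (Suc n)" for n by (simp_all add: h_def)
  define z where "z n = \<mu> (h n *\<^sub>R p) (h n *\<^sub>R q)" for n
  define P where "P n = ex (h n *\<^sub>R p) \<otimes> ex (h n *\<^sub>R q)" for n
  have approx: "\<forall>\<^sub>F n in sequentially. z n \<in> V \<and> ex (z n) = P n \<and> norm (z n - h n *\<^sub>R (p + q)) \<le> \<epsilon> * (h n * norm q)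
    \<and> norm (z n) < r0 / 2"
    if ep: "0 < \<epsilon>" "\<epsilon> \<le> 1" for \<epsilon>
  proof -
    obtain \<delta> where \<delta>: "good \<epsilon> \<delta>" using good_exists[OF ep(1)] by blast
    have "\<forall>\<^sub>F n in sequentially. h n * norm p < \<delta> \<and> h n * norm q < \<delta> \<and> h n * (norm p + 2 * norm q) < r0 / 2"
      unfolding h_def using good_pos[OF \<delta>] r0 by (intro eventually_conj eventually_half_power_less) auto
    then show ?thesis
    proof (rule eventually_mono)
      fix n assume n: "h n * norm p < \<delta> \<and> h n * norm q < \<delta> \<and> h n * (norm p + 2 * norm q) < r0 / 2"
      let ?x = "h n *\<^sub>R p" and ?y = "h n *\<^sub>R q"
      have s: "?x \<in> V" "?y \<in> V" "norm ?x < \<delta>" "norm ?y < \<delta>" using p q n h(1)[of n] by auto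
      have a: "norm (\<mu> ?x ?y - ?x - ?y) \<le> \<epsilon> * norm ?y" by (rule good_approx[OF \<delta> s])
      have "norm (z n) \<le> norm ?x + 2 * norm ?y" unfolding z_def by (rule mu_norm_le[OF a ep(2)])
      also have "\<dots> < r0 / 2" using n h(1)[of n] by (simp add: algebra_simps)
      finally have b: "norm (z n) < r0 / 2" .
      have c: "norm (z n - h n *\<^sub>R (p + q)) \<le> \<epsilon> * (h n * norm q)"
        using a h(1)[of n] by (simp add: z_def algebra_simps)
      show "z n \<in> V \<and> ex (z n) = P n \<and> norm (z n - h n *\<^sub>R (p + q)) \<le> \<epsilon> * (h n * norm q) \<and> norm (z n) < r0 / 2"
        using good_closed[OF \<delta> s] good_mult[OF \<delta> s] b c by (simp add: z_def P_def)
    qed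
  qed
  obtain n0 where n0: "\<And>n. n \<ge> n0 \<Longrightarrow> z n \<in> V \<and> ex (z n) = P n \<and> norm (z n) < r0 / 2"
    using approx[of 1] by (auto simp: eventually_sequentially)
  have Pc: "ex (h n *\<^sub>R p) \<in> carrier G" "ex (h n *\<^sub>R q) \<in> carrier G" for n using p q by (auto intro: ex_closed)
  have P_double: "P n = P (Suc n) \<otimes> P (Suc n)" for n
  proof -
    have "P n = (ex (h (Suc n) *\<^sub>R p) \<otimes> ex (h (Suc n) *\<^sub>R p)) \<otimes> (ex (h (Suc n) *\<^sub>R q) \<otimes> ex (h (Suc n) *\<^sub>R q))"
      unfolding P_def using ex_double[of "h n *\<^sub>R p"] ex_double[of "h n *\<^sub>R q"] p q by (simp add: h(2)[of n])
    also have "\<dots> = ex (h (Suc n) *\<^sub>R p) \<otimes> (ex (h (Suc n) *\<^sub>R p) \<otimes> ex (h (Suc n) *\<^sub>R q)) \<otimes> ex (h (Suc n) *\<^sub>R q)"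
      using Pc[of "Suc n"] by (simp add: m_assoc)
    also have "\<dots> = ex (h (Suc n) *\<^sub>R p) \<otimes> (ex (h (Suc n) *\<^sub>R q) \<otimes> ex (h (Suc n) *\<^sub>R p)) \<otimes> ex (h (Suc n) *\<^sub>R q)"
      unfolding h_def by (subst comm) (rule refl)
    also have "\<dots> = P (Suc n) \<otimes> P (Suc n)"
      unfolding P_def using Pc[of "Suc n"] by (simp add: m_assoc)
    finally show ?thesis .
  qed
  have z_double: "z n = 2 *\<^sub>R z (Suc n)" if "n \<ge> n0" for n
  proof (rule ex_inj)
    have "ex (2 *\<^sub>R z (Suc n)) = P (Suc n) \<otimes> P (Suc n)"
      using ex_double[of "2 *\<^sub>R z (Suc n)"] n0[of "Suc n"] that by simp
    then show "ex (z n) = ex (2 *\<^sub>R z (Suc n))" using n0[OF that] P_double[of n] by simp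
  qed (use n0[OF that] n0[of "Suc n"] that r0 in auto)
  have z_pow: "z n0 = 2 ^ k *\<^sub>R z (n0 + k)" for k
  proof (induction k)
    case (Suc k)
    then show ?case using z_double[of "n0 + k"] by simp
  qed simp
  have "norm (z n0 - h n0 *\<^sub>R (p + q)) \<le> \<epsilon>" if "0 < \<epsilon>" for \<epsilon>
  proof -
    define \<epsilon>' where "\<epsilon>' = min 1 (\<epsilon> / (norm q + 1))"
    have \<epsilon>': "0 < \<epsilon>'" "\<epsilon>' \<le> 1" using that by (auto simp: \<epsilon>'_def add_nonneg_pos)
    have "\<epsilon>' * norm q \<le> \<epsilon> / (norm q + 1) * norm q" by (intro mult_right_mono) (auto simp: \<epsilon>'_def)
    also have "\<dots> = \<epsilon> * (norm q / (norm q + 1))" by simp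
    also have "\<dots> \<le> \<epsilon> * 1"
    proof (rule mult_left_mono)
      show "norm q / (norm q + 1) \<le> 1" using norm_ge_zero[of q] by (subst divide_le_eq_1) linarith
    qed (use that in simp)
    also have "\<dots> = \<epsilon>" by simp
    finally have le: "\<epsilon>' * norm q \<le> \<epsilon>" .
    obtain n1 where n1: "\<And>n. n \<ge> n1 \<Longrightarrow> norm (z n - h n *\<^sub>R (p + q)) \<le> \<epsilon>' * (h n * norm q)"
      using approx[OF \<epsilon>'] by (auto simp: eventually_sequentially)
    have hk: "2 ^ n1 * h (n0 + n1) = h n0" by (simp add: h_def power_add power_divide)
    \<comment> \<open>The number of doublings and the threshold for the estimate can both be
      \<open>n1\<close>. Doubling back multiplies the error and the scale alike, so only the
      relative error counts.\<close>
    have "z n0 - h n0 *\<^sub>R (p + q) = 2 ^ n1 *\<^sub>R (z (n0 + n1) - h (n0 + n1) *\<^sub>R (p + q))"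
      unfolding z_pow[of n1] hk[symmetric] by (simp add: algebra_simps)
    then have "norm (z n0 - h n0 *\<^sub>R (p + q)) = 2 ^ n1 * norm (z (n0 + n1) - h (n0 + n1) *\<^sub>R (p + q))"
      by simp
    also have "\<dots> \<le> 2 ^ n1 * (\<epsilon>' * (h (n0 + n1) * norm q))"
      using n1[of "n0 + n1"] by (intro mult_left_mono) auto
    also have "\<dots> = h n0 * (\<epsilon>' * norm q)" unfolding hk[symmetric] by simp
    also have "\<dots> \<le> 1 * \<epsilon>"
      using le \<epsilon>'(1) that by (intro mult_mono) (auto simp: h_def power_le_one)
    finally show ?thesis by simp
  qed
  then have "z n0 = h n0 *\<^sub>R (p + q)" using field_le_epsilon[of "norm (z n0 - h n0 *\<^sub>R (p + q))" 0] by simp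
  then have "ex (p + q) = P n0 [^] (2 ^ n0 :: nat)"
    using ex_pow_half[OF V_add[OF p q], of n0] n0[of n0] by (simp add: h_def)
  also have "\<dots> = ex (h n0 *\<^sub>R p) [^] (2 ^ n0 :: nat) \<otimes> ex (h n0 *\<^sub>R q) [^] (2 ^ n0 :: nat)"
    unfolding P_def by (rule pow_mult_distrib[OF _ Pc]) (unfold h_def, rule comm)
  also have "\<dots> = ex p \<otimes> ex q"
    using ex_pow_half[OF p, of n0] ex_pow_half[OF q, of n0] by (simp add: h_def)
  finally show ?thesis .
qed

end

section \<open>Homomorphisms in exponential coordinates\<close>

text \<open>What is kept of the topology: conjugation is continuous at the identity in the
  coordinates of \<open>ex\<close>. What is kept of compact generation: a finite set and the
  one-parameter subgroups generate.\<close>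

locale exp_group = dyadic_exp G V ex \<mu> r0
  for G (structure) and V :: "'e::euclidean_space set" and ex :: "'e \<Rightarrow> 'a" and \<mu> :: "'e \<Rightarrow> 'e \<Rightarrow> 'e" and r0 :: real +
  assumes ex_add: "x \<in> V \<Longrightarrow> ex ((s + t) *\<^sub>R x) = ex (s *\<^sub>R x) \<otimes> ex (t *\<^sub>R x)"
    and conj_small: "\<lbrakk>g \<in> carrier G; 0 < \<epsilon>\<rbrakk> \<Longrightarrow>
      \<exists>\<delta>>0. \<forall>x\<in>V. norm x < \<delta> \<longrightarrow> (\<exists>y\<in>V. norm y < \<epsilon> \<and> g \<otimes> ex x \<otimes> inv g = ex y)"
    and finitely_generated: "\<exists>S. finite S \<and> generate G (S \<union> ex ` V) = carrier G"
begin

definition small_cts :: "('a \<Rightarrow> 'a) \<Rightarrow> bool" where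
  "small_cts \<phi> \<longleftrightarrow> (\<forall>\<epsilon>>0. \<exists>\<delta>>0. \<forall>x\<in>V. norm x < \<delta> \<longrightarrow> (\<exists>y\<in>V. norm y < \<epsilon> \<and> \<phi> (ex x) = ex y))"

lemma ex_neg: "x \<in> V \<Longrightarrow> ex (- x) = inv (ex x)"
proof -
  assume x: "x \<in> V"
  have "ex (- x) \<otimes> ex x = \<one>" using ex_add[OF x, of "-1" 1] ex_zero by simp
  then show ?thesis using x by (metis V_neg ex_closed inv_equality)
qed

lemma ex_pow: "x \<in> V \<Longrightarrow> ex (real n *\<^sub>R x) = ex x [^] n"
proof (induction n)
  case (Suc n)
  then show ?case using ex_add[of x "real n" 1] by (simp add: algebra_simps)
qed (simp add: ex_zero)

lemma ex_line_inj:
  assumes "x \<in> V" "y \<in> V" "\<And>t. ex (t *\<^sub>R x) = ex (t *\<^sub>R y)"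
  shows "x = y"
proof -
  have "\<forall>\<^sub>F m in sequentially. (1/2)^m * norm x < r0 \<and> (1/2)^m * norm y < r0"
    by (intro eventually_conj eventually_half_power_less r0)
  then obtain m where "(1/2)^m * norm x < r0" "(1/2)^m * norm y < r0"
    by (auto simp: eventually_sequentially)
  then have "(1/2)^m *\<^sub>R x = (1/2)^m *\<^sub>R y"
    using assms by (intro ex_inj) auto
  then show ?thesis by simp
qed

lemma ex_add_commuting:
  assumes "p \<in> V" "q \<in> V" "\<And>s t. ex (s *\<^sub>R p) \<otimes> ex (t *\<^sub>R q) = ex (t *\<^sub>R q) \<otimes> ex (s *\<^sub>R p)"
  shows "ex (p + q) = ex p \<otimes> ex q"
  using assms by (rule ex_add_if_dyadic_commuting)

text \<open>Rescaling into a fixed annulus turns a constant bound for a map that commutes with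
  halving into a linear bound.\<close>

lemma half_power_window:
  assumes "0 < a" "a < (d::real)"
  shows "\<exists>n. d / 2 \<le> 2 ^ n * a \<and> 2 ^ n * a < d"
proof -
  obtain m where m: "d < 2 ^ m * a"
    using real_arch_pow[of 2 "d / a"] assms(1) by (auto simp: field_simps)
  define k where "k = (LEAST m. d \<le> 2 ^ m * a)"
  have k: "d \<le> 2 ^ k * a" unfolding k_def by (rule LeastI[of _ m]) (use m in simp)
  have "k \<noteq> 0" using k assms(2) by (intro notI) simp
  then obtain n where n: "k = Suc n" using not0_implies_Suc by blast
  have "\<not> d \<le> 2 ^ n * a" using not_less_Least[of n "\<lambda>m. d \<le> 2 ^ m * a"] n unfolding k_def by simp
  then show ?thesis using k n by (intro exI[of _ n]) simp
qed

text \<open>The map \<open>f\<close> is \<phi> read in exponential coordinates. Uniqueness of small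
  coordinates makes it commute with halving, hence linearly bounded. For additivity the vectors are
  scaled down until \<mu> is addition up to a relative error \<epsilon>. As \<open>f\<close>
  commutes with the scaling, the relative error is unchanged when scaling back, and \<epsilon> is
  arbitrary.\<close>

lemma hom_local_linear:
  assumes \<phi>: "\<phi> \<in> hom G G" and cts: "small_cts \<phi>"
  shows "\<exists>f d B. 0 < d \<and> 0 < B \<and> (\<forall>x\<in>V. norm x < d \<longrightarrow> f x \<in> V \<and> \<phi> (ex x) = ex (f x) \<and>
      norm (f x) \<le> B * norm x \<and> (\<forall>m. f ((1/2)^m *\<^sub>R x) = (1/2)^m *\<^sub>R f x)) \<and>
      (\<forall>x\<in>V. \<forall>y\<in>V. norm x < d / 2 \<longrightarrow> norm y < d / 2 \<longrightarrow> f (x + y) = f x + f y)"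
proof -
  interpret f: group_hom G G \<phi>
    by (rule group_hom.intro[OF is_group is_group group_hom_axioms.intro[OF \<phi>]])
  obtain d where d: "d > 0" "\<And>x. \<lbrakk>x \<in> V; norm x < d\<rbrakk> \<Longrightarrow> \<exists>y\<in>V. norm y < r0 / 2 \<and> \<phi> (ex x) = ex y"
    using cts r0 unfolding small_cts_def by (metis half_gt_zero)
  have "\<exists>f. \<forall>x\<in>{x \<in> V. norm x < d}. f x \<in> V \<and> norm (f x) < r0 / 2 \<and> \<phi> (ex x) = ex (f x)"
    by (rule bchoice) (use d(2) in blast)
  then obtain f where f: "\<And>x. \<lbrakk>x \<in> V; norm x < d\<rbrakk> \<Longrightarrow> f x \<in> V"
    "\<And>x. \<lbrakk>x \<in> V; norm x < d\<rbrakk> \<Longrightarrow> norm (f x) < r0 / 2"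
    "\<And>x. \<lbrakk>x \<in> V; norm x < d\<rbrakk> \<Longrightarrow> \<phi> (ex x) = ex (f x)" by blast
  have uniq: "f x = y" if "x \<in> V" "norm x < d" "y \<in> V" "norm y < r0" "\<phi> (ex x) = ex y" for x y
    using f[OF that(1,2)] that r0 by (intro ex_inj) auto
  have half: "f ((1/2)^m *\<^sub>R x) = (1/2)^m *\<^sub>R f x" if x: "x \<in> V" "norm x < d" for x m
  proof (induction m)
    case (Suc m)
    let ?x = "(1/2)^m *\<^sub>R x" and ?y = "(1/2)^Suc m *\<^sub>R x"
    have le: "(1/2)^k * norm x \<le> norm x" for k
      by (rule mult_left_le_one_le) (auto simp: power_le_one)
    have xy: "?x \<in> V" "?y \<in> V" "norm ?x < d" "norm ?y < d"
      using x le[of m] le[of "Suc m"] by (auto simp del: power_Suc)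
    have "\<phi> (ex ?x) = \<phi> (ex ?y) \<otimes> \<phi> (ex ?y)"
      using ex_double[OF xy(1)] ex_closed[OF xy(2)] by simp
    also have "\<dots> = ex (2 *\<^sub>R f ?y)"
      using ex_add[OF f(1)[OF xy(2,4)], of 1 1] f(3)[OF xy(2,4)] by simp
    finally have "f ?x = 2 *\<^sub>R f ?y"
      using f(1,2)[OF xy(2,4)] by (intro uniq xy) auto
    then have "f ?y = (1/2) *\<^sub>R f ?x" by simp
    then show ?case using Suc.IH by simp
  qed simp
  define B where "B = r0 / d"
  have B: "B > 0" using r0 d(1) by (simp add: B_def)
  have bound: "norm (f x) \<le> B * norm x" if x: "x \<in> V" "norm x < d" for x
  proof (cases "x = 0")
    case True
    have "f 0 = (1/2) *\<^sub>R f 0" using half[of 0 1] V_zero d(1) by simp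
    then have "norm (f 0) = (1/2) * norm (f 0)" by (metis norm_scaleR abs_of_pos half_gt_zero zero_less_one)
    then have "f 0 = 0" by simp
    then show ?thesis using True by simp
  next
    case False
    then obtain n where n: "d / 2 \<le> 2 ^ n * norm x" "2 ^ n * norm x < d"
      using half_power_window[of "norm x" d] x(2) by auto
    let ?x = "2 ^ n *\<^sub>R x"
    have xx: "?x \<in> V" "norm ?x < d" using x n by auto
    have "f x = (1/2)^n *\<^sub>R f ?x" using half[OF xx, of n] by (simp add: power_divide)
    then have "norm (f x) = (1/2)^n * norm (f ?x)" by simp
    also have "\<dots> \<le> (1/2)^n * (r0 / 2)" using f(2)[OF xx] by (intro mult_left_mono) auto
    also have "\<dots> = (1/2)^n * (B * (d / 2))" using d(1) by (simp add: B_def)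
    also have "\<dots> \<le> (1/2)^n * (B * (2 ^ n * norm x))"
      using n(1) B by (intro mult_left_mono) auto
    also have "\<dots> = B * norm x" by (simp add: power_divide)
    finally show ?thesis .
  qed
  have additive: "f (x + y) = f x + f y"
    if x: "x \<in> V" "norm x < d / 2" and y: "y \<in> V" "norm y < d / 2" for x y
  proof -
    \<comment> \<open>The factor 5 counts one error from the product of \<open>p\<close> and
      \<open>q\<close>, and four from the correction \<open>k\<close>: its image is at most twice
      \<open>\<epsilon> * (B * norm q)\<close> and enters twice.\<close>
    have "norm (f (x + y) - f x - f y) \<le> \<epsilon> * (5 * B * norm y)" if ep: "0 < \<epsilon>" "\<epsilon> \<le> 1" for \<epsilon>
    proof -
      obtain \<delta> where \<delta>: "good \<epsilon> \<delta>" using good_exists[OF ep(1)] by blast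
      have "\<forall>\<^sub>F m in sequentially. (1/2)^m * (2 * (norm x + norm y)) < \<delta> \<and>
          (1/2)^m * (2 * (norm x + norm y)) < d \<and>
          (1/2)^m * (B * (8 * (norm x + norm y))) < \<delta>"
        using good_pos[OF \<delta>] d(1) by (intro eventually_conj eventually_half_power_less)
      then obtain m where m0: "(1/2)^m * (2 * (norm x + norm y)) < \<delta>"
          "(1/2)^m * (2 * (norm x + norm y)) < d" "(1/2)^m * (B * (8 * (norm x + norm y))) < \<delta>"
        by (auto simp: eventually_sequentially)
      define h :: real where "h = (1/2)^m"
      have h: "h > 0" "h \<le> 1" by (simp_all add: h_def power_le_one)
      define p where "p = h *\<^sub>R x"
      define q where "q = h *\<^sub>R y"
      have pq: "p \<in> V" "q \<in> V" "p + q \<in> V" using x y by (auto simp: p_def q_def V_add)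
      \<comment> \<open>Twice the sum of the norms bounds both \<open>z\<close> and
        \<open>p + q\<close>. With the factor 8 the image of every vector of that size stays below
        \<open>\<delta> / 4\<close>, so products of such images can be taken and still have norm
        below \<open>r0\<close>.\<close>
      have m: "2 * (norm p + norm q) < \<delta>" "2 * (norm p + norm q) < d" "B * (8 * (norm p + norm q)) < \<delta>"
        using m0 h(1) by (simp_all add: p_def q_def algebra_simps flip: h_def)
      have nn: "norm p \<ge> 0" "norm q \<ge> 0" by simp_all
      have small: "norm p < \<delta>" "norm q < \<delta>" "norm p < d" "norm q < d" using m(1,2) nn by - argo+
      have npq: "norm (p + q) \<le> norm p + norm q" by (rule norm_triangle_ineq)
      have fsmall: "norm (f v) < \<delta> / 4" if "v \<in> V" "norm v < d" "norm v \<le> 2 * (norm p + norm q)" for v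
      proof -
        have "norm (f v) \<le> B * norm v" by (rule bound[OF that(1,2)])
        also have "\<dots> \<le> B * (2 * (norm p + norm q))" using that(3) B by (intro mult_left_mono) auto
        finally show ?thesis using m(3) by argo
      qed
      define z where "z = \<mu> p q"
      have zV: "z \<in> V" unfolding z_def by (rule good_closed[OF \<delta> pq(1,2) small(1,2)])
      have exz: "ex p \<otimes> ex q = ex z" unfolding z_def by (rule good_mult[OF \<delta> pq(1,2) small(1,2)])
      have za: "norm (z - (p + q)) \<le> \<epsilon> * norm q"
        using good_approx[OF \<delta> pq(1,2) small(1,2)] by (simp add: z_def diff_diff_eq)
      have zn0: "norm z \<le> norm p + 2 * norm q"
        unfolding z_def by (rule mu_norm_le[OF good_approx[OF \<delta> pq(1,2) small(1,2)] ep(2)])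
      have zn: "norm z < \<delta>" "norm z < d" "norm z \<le> 2 * (norm p + norm q)" using zn0 m(1,2) nn by - argo+
      have wn: "norm (p + q) < \<delta>" "norm (p + q) < d" "norm (p + q) \<le> 2 * (norm p + norm q)"
        using m(1,2) nn npq by - argo+
      have fp: "f p \<in> V" "norm (f p) < \<delta> / 4" "\<phi> (ex p) = ex (f p)"
        using f[OF pq(1) small(3)] fsmall[OF pq(1) small(3)] nn by auto
      have fq: "f q \<in> V" "norm (f q) < \<delta> / 4" "\<phi> (ex q) = ex (f q)"
        using f[OF pq(2) small(4)] fsmall[OF pq(2) small(4)] nn by auto
      have fw: "f (p + q) \<in> V" "norm (f (p + q)) < \<delta> / 4" "\<phi> (ex (p + q)) = ex (f (p + q))"
        using f[OF pq(3) wn(2)] fsmall[OF pq(3) wn(2,3)] by auto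
      have prod: "norm (f v - f u - f k) \<le> \<epsilon> * norm (f k)"
        if u: "u \<in> V" "norm u < d" "norm (f u) < \<delta> / 4" and k: "k \<in> V" "norm k < d" "norm (f k) < \<delta> / 4"
          and v: "v \<in> V" "norm v < d" "ex u \<otimes> ex k = ex v" for u k v
      proof -
        note fu = f[OF u(1,2)] and fk = f[OF k(1,2)]
        have s: "norm (f u) < \<delta>" "norm (f k) < \<delta>" using u(3) k(3) good_pos[OF \<delta>] by (simp_all add: field_simps)
        note a = good_approx[OF \<delta> fu(1) fk(1) s]
        have "norm (\<mu> (f u) (f k)) \<le> norm (f u) + 2 * norm (f k)" by (rule mu_norm_le[OF a ep(2)])
        then have n: "norm (\<mu> (f u) (f k)) < r0"
          using u(3) k(3) good_le[OF \<delta>] good_pos[OF \<delta>] by argo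
        have "\<phi> (ex v) = \<phi> (ex u) \<otimes> \<phi> (ex k)"
          unfolding v(3)[symmetric] using ex_closed u(1) k(1) by simp
        also have "\<dots> = ex (\<mu> (f u) (f k))"
          unfolding fu(3) fk(3) by (rule good_mult[OF \<delta> fu(1) fk(1) s])
        finally have "f v = \<mu> (f u) (f k)"
          by (rule uniq[OF v(1,2) good_closed[OF \<delta> fu(1) fk(1) s] n])
        then show ?thesis using a by simp
      qed
      have e1: "norm (f z - f p - f q) \<le> \<epsilon> * (B * norm q)"
        using prod[OF pq(1) small(3) fp(2) pq(2) small(4) fq(2) zV zn(2) exz]
          mult_left_mono[OF bound[OF pq(2) small(4)], of \<epsilon>] ep(1) by linarith
      define w where "w = p + q"
      have wV: "w \<in> V" and wd: "norm w < \<delta>" using pq(3) wn(1) by (simp_all add: w_def)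
      have wV': "- w \<in> V" and wd': "norm (- w) < \<delta>" using V_neg[OF wV] wd by simp_all
      note w = wV wd wV' wd'
      \<comment> \<open>The coordinate \<open>z\<close> of the product is only close to
        \<open>w = p + q\<close>, and \<open>f\<close> has no modulus of continuity yet. The
        discrepancy is therefore expressed in the group, \<open>ex z = ex w \<otimes> ex k\<close>,
        where \<phi> is multiplicative and the linear bound controls \<open>f k\<close>.\<close>
      define k where "k = \<mu> (- w) z"
      have kV: "k \<in> V" unfolding k_def by (rule good_closed[OF \<delta> w(3) zV w(4) zn(1)])
      have exk: "ex (- w) \<otimes> ex z = ex k" unfolding k_def by (rule good_mult[OF \<delta> w(3) zV w(4) zn(1)])
      have mw: "\<mu> (- w) w = 0"
      proof (rule ex_inj)
        have a: "norm (\<mu> (- w) w - (- w) - w) \<le> \<epsilon> * norm w" by (rule good_approx[OF \<delta> w(3,1,4,2)])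
        also have "\<dots> \<le> norm w" using ep by (simp add: mult_left_le_one_le)
        also have "\<dots> < r0" using w(2) good_le[OF \<delta>] by simp
        finally show "norm (\<mu> (- w) w) < r0" by simp
        show "\<mu> (- w) w \<in> V" by (rule good_closed[OF \<delta> w(3,1,4,2)])
        have "ex (- w) \<otimes> ex w = \<one>" using w(1) ex_closed[OF w(1)] by (simp add: ex_neg)
        then show "ex (\<mu> (- w) w) = ex 0" using good_mult[OF \<delta> w(3,1,4,2)] by (simp add: ex_zero)
      qed (use V_zero r0 in auto)
      have "norm (k - (z - w)) \<le> \<epsilon> * norm (z - w)"
        using good_diff[OF \<delta> w(3) zV w(1) w(4) zn(1) w(2)] by (simp add: k_def mw)
      also have "\<dots> \<le> norm (z - w)" using ep by (simp add: mult_left_le_one_le)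
      finally have "norm k \<le> 2 * norm (z - w)"
        using norm_triangle_ineq[of "k - (z - w)" "z - w"] by simp
      then have kn: "norm k \<le> 2 * (\<epsilon> * norm q)" using za by (simp add: w_def)
      have "\<epsilon> * norm q \<le> norm q" using ep by (simp add: mult_left_le_one_le)
      then have kn2: "norm k \<le> 2 * norm q" using kn by argo
      then have kd: "norm k < d" using m(2) nn by argo
      have fk4: "norm (f k) < \<delta> / 4" using fsmall[OF kV kd] kn2 nn by simp
      have fkb: "norm (f k) \<le> B * (2 * (\<epsilon> * norm q))"
        using bound[OF kV kd] mult_left_mono[OF kn, of B] B by linarith
      have exzw: "ex w \<otimes> ex k = ex z"
        unfolding exk[symmetric] ex_neg[OF w(1)]
        by (rule r_cancel_inv[OF ex_closed[OF w(1)] ex_closed[OF zV]])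
      have "norm (f z - f w - f k) \<le> \<epsilon> * norm (f k)"
        using prod[OF w(1) _ _ kV kd fk4 zV zn(2) exzw] wn(2) fw(2) by (simp add: w_def)
      also have "\<dots> \<le> norm (f k)" using ep by (simp add: mult_left_le_one_le)
      finally have e2: "norm (f z - f w - f k) \<le> norm (f k)" .
      have "f w - f p - f q = (f z - f p - f q) - (f z - f w - f k) - f k" by simp
      then have "norm (f w - f p - f q) \<le> norm (f z - f p - f q) + norm (f z - f w - f k) + norm (f k)"
        by (metis add_mono norm_triangle_ineq4 norm_triangle_le_diff order_refl)
      also have "\<dots> \<le> \<epsilon> * (5 * B * norm q)" using e1 e2 fkb by (simp add: algebra_simps)
      finally have "norm (f w - f p - f q) \<le> \<epsilon> * (5 * B * norm q)" .
      moreover have "f p = h *\<^sub>R f x" "f q = h *\<^sub>R f y" "f w = h *\<^sub>R f (x + y)"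
      proof -
        have xyn: "norm (x + y) < d" using x(2) y(2) norm_triangle_ineq[of x y] by linarith
        show "f p = h *\<^sub>R f x" "f q = h *\<^sub>R f y"
          unfolding p_def q_def h_def using x y d(1) by (auto intro!: half)
        show "f w = h *\<^sub>R f (x + y)"
          unfolding w_def p_def q_def h_def scaleR_add_right[symmetric]
          by (rule half[OF V_add[OF x(1) y(1)] xyn])
      qed
      moreover have "h *\<^sub>R f (x + y) - h *\<^sub>R f x - h *\<^sub>R f y = h *\<^sub>R (f (x + y) - f x - f y)"
        by (simp add: algebra_simps)
      ultimately have "h * norm (f (x + y) - f x - f y) \<le> \<epsilon> * (5 * B * (h * norm y))"
        using h(1) by (simp add: q_def)
      then have "h * norm (f (x + y) - f x - f y) \<le> h * (\<epsilon> * (5 * B * norm y))"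
        by (simp add: algebra_simps)
      then show ?thesis using h(1) by (rule mult_left_le_imp_le)
    qed
    then have "norm (f (x + y) - f x - f y) \<le> 0"
      by (rule le_zero_if_small_multiples)
    then have "f (x + y) - f x - f y = 0" by simp
    then show ?thesis by (simp add: diff_eq_eq add.commute)
  qed
  show ?thesis
    by (intro exI[of _ f] exI[of _ d] exI[of _ B] conjI ballI impI allI d(1) B f bound half additive)
qed

text \<open>The local map is extended by scaling down by a power of two and back up; the power does
  not matter because \<open>f\<close> commutes with halving, and powers of \<open>ex\<close> carry
  the relation with \<phi> along.\<close>

lemma hom_linear:
  assumes \<phi>: "\<phi> \<in> hom G G" and cts: "small_cts \<phi>"
  shows "\<exists>f. linear f \<and> (\<forall>x\<in>V. f x \<in> V \<and> \<phi> (ex x) = ex (f x))"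
proof -
  interpret f: group_hom G G \<phi>
    by (rule group_hom.intro[OF is_group is_group group_hom_axioms.intro[OF \<phi>]])
  from hom_local_linear[OF assms] obtain f d B where dB: "0 < d" "0 < B"
    and f': "\<forall>x\<in>V. norm x < d \<longrightarrow> f x \<in> V \<and> \<phi> (ex x) = ex (f x) \<and>
      norm (f x) \<le> B * norm x \<and> (\<forall>m. f ((1/2)^m *\<^sub>R x) = (1/2)^m *\<^sub>R f x)"
    and a': "\<forall>x\<in>V. \<forall>y\<in>V. norm x < d / 2 \<longrightarrow> norm y < d / 2 \<longrightarrow> f (x + y) = f x + f y"
    by (elim exE conjE)
  have f: "f x \<in> V" "\<phi> (ex x) = ex (f x)" "norm (f x) \<le> B * norm x" "f ((1/2)^m *\<^sub>R x) = (1/2)^m *\<^sub>R f x"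
    if "x \<in> V" "norm x < d" for x m
    using bspec[OF f' that(1)] that(2) by simp_all
  have add: "f (x + y) = f x + f y" if "x \<in> V" "y \<in> V" "norm x < d / 2" "norm y < d / 2" for x y
    using bspec[OF bspec[OF a' that(1)] that(2)] that(3,4) by simp
  define n where "n x = (LEAST n. (1/2)^n * norm x < d)" for x :: 'e
  define F where "F x = 2 ^ n x *\<^sub>R f ((1/2)^n x *\<^sub>R x)" for x
  have n: "(1/2)^n x * norm x < d" for x
  proof -
    obtain m where "(1/2)^m * norm x < d"
      using eventually_half_power_less[OF dB(1), of "norm x"] by (auto simp: eventually_sequentially)
    then show ?thesis unfolding n_def by (rule LeastI)
  qed
  have F: "F x = 2 ^ m *\<^sub>R f ((1/2)^m *\<^sub>R x)" if x: "x \<in> V" and m: "(1/2)^m * norm x < d" for x m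
  proof -
    have "n x \<le> m" unfolding n_def by (rule Least_le) (rule m)
    then obtain k where k: "m = n x + k" using le_Suc_ex by blast
    have "f ((1/2)^k *\<^sub>R ((1/2)^n x *\<^sub>R x)) = (1/2)^k *\<^sub>R f ((1/2)^n x *\<^sub>R x)"
      using x n[of x] by (intro f) auto
    then show ?thesis unfolding F_def k by (simp add: power_add power_divide mult.commute)
  qed
  have ev: "\<exists>m. (1/2)^m * a < d / 2 \<and> (1/2)^m * b < d / 2" for a b :: real
  proof -
    have "\<forall>\<^sub>F m in sequentially. (1/2)^m * a < d / 2 \<and> (1/2)^m * b < d / 2"
      using dB(1) by (intro eventually_conj eventually_half_power_less) auto
    then show ?thesis by (auto simp: eventually_sequentially)
  qed
  have FV: "F x \<in> V" if "x \<in> V" for x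
    unfolding F_def using f(1)[of "(1/2)^n x *\<^sub>R x"] n[of x] that by simp
  have Fex: "\<phi> (ex x) = ex (F x)" if x: "x \<in> V" for x
  proof -
    let ?y = "(1/2)^n x *\<^sub>R x"
    have y: "?y \<in> V" "norm ?y < d" using x n[of x] by auto
    have "\<phi> (ex x) = \<phi> (ex ?y) [^] (2 ^ n x :: nat)"
      using ex_pow_half[OF x, of "n x"] f.hom_nat_pow[OF ex_closed[OF y(1)]] by simp
    also have "\<dots> = ex (F x)"
      unfolding F_def f(2)[OF y] using ex_pow[OF f(1)[OF y], of "2 ^ n x"] by simp
    finally show ?thesis .
  qed
  have Fadd: "F (x + y) = F x + F y" if x: "x \<in> V" and y: "y \<in> V" for x y
  proof -
    obtain m where m: "(1/2)^m * norm x < d / 2" "(1/2)^m * norm y < d / 2" using ev by blast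
    have "(1/2)^m * norm (x + y) \<le> (1/2)^m * (norm x + norm y)"
      by (intro mult_left_mono norm_triangle_ineq) simp
    then have m': "(1/2)^m * norm x < d" "(1/2)^m * norm y < d" "(1/2)^m * norm (x + y) < d"
      using m dB(1) by (simp_all add: distrib_left)
    show ?thesis
      unfolding F[OF x m'(1)] F[OF y m'(2)] F[OF V_add[OF x y] m'(3)] scaleR_add_right
      using add[of "(1/2)^m *\<^sub>R x" "(1/2)^m *\<^sub>R y"] x y m by (simp add: scaleR_add_right)
  qed
  have Fbound: "norm (F x) \<le> B * norm x" if x: "x \<in> V" for x
  proof -
    have "norm (F x) = 2 ^ n x * norm (f ((1/2)^n x *\<^sub>R x))" unfolding F_def by simp
    also have "\<dots> \<le> 2 ^ n x * (B * norm ((1/2)^n x *\<^sub>R x))"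
      using x n[of x] by (intro mult_left_mono f(3)) auto
    also have "\<dots> = B * norm x" by (simp add: power_divide)
    finally show ?thesis .
  qed
  \<comment> \<open>\<open>F\<close> is additive on \<open>V\<close> only; composing with the
    projection gives a map on the whole type to which the linearity criterion applies.\<close>
  obtain P where P: "linear P" "\<And>x. P x \<in> V" "\<And>x. norm (P x) \<le> norm x" "\<And>x. x \<in> V \<Longrightarrow> P x = x"
    using orthogonal_projection_exists[OF V] by metis
  have "linear (\<lambda>x. F (P x))"
  proof (rule linear_if_additive_bounded)
    show "F (P (x + y)) = F (P x) + F (P y)" for x y
      using Fadd[OF P(2) P(2)] by (simp add: linear_add[OF P(1)])
    show "norm (F (P x)) \<le> B * norm x" for x
      using Fbound[OF P(2), of x] mult_left_mono[OF P(3)[of x], of B] dB(2) by linarith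
  qed
  then show ?thesis using FV Fex P(2,4) by (intro exI[of _ "\<lambda>x. F (P x)"]) auto
qed

end

section \<open>The adjoint action and its fixed vectors\<close>

context exp_group
begin

text \<open>On \<open>V\<close> the choice is unique, since a vector is determined by its
  one-parameter subgroup (\<open>ex_line_inj\<close>). The values outside \<open>V\<close> are
  arbitrary.\<close>

definition Ad :: "'a \<Rightarrow> 'e \<Rightarrow> 'e" where
  "Ad g = (SOME f. linear f \<and> (\<forall>x\<in>V. f x \<in> V \<and> g \<otimes> ex x \<otimes> inv g = ex (f x)))"

lemma
  assumes g: "g \<in> carrier G"
  shows Ad_linear: "linear (Ad g)"
    and Ad_closed: "x \<in> V \<Longrightarrow> Ad g x \<in> V"
    and Ad_ex: "x \<in> V \<Longrightarrow> g \<otimes> ex x \<otimes> inv g = ex (Ad g x)"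
proof -
  have "(\<lambda>x. g \<otimes> x \<otimes> inv g) \<in> hom G G"
    by (rule homI) (use g in \<open>simp_all add: word_simps\<close>)
  moreover have "small_cts (\<lambda>x. g \<otimes> x \<otimes> inv g)"
    unfolding small_cts_def using conj_small[OF g] by simp
  ultimately have "\<exists>f. linear f \<and> (\<forall>x\<in>V. f x \<in> V \<and> g \<otimes> ex x \<otimes> inv g = ex (f x))"
    by (rule hom_linear)
  then have *: "linear (Ad g) \<and> (\<forall>x\<in>V. Ad g x \<in> V \<and> g \<otimes> ex x \<otimes> inv g = ex (Ad g x))"
    unfolding Ad_def by (rule someI_ex)
  show "linear (Ad g)" using * by (rule conjunct1)
  show "x \<in> V \<Longrightarrow> Ad g x \<in> V" "x \<in> V \<Longrightarrow> g \<otimes> ex x \<otimes> inv g = ex (Ad g x)"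
    using bspec[OF conjunct2[OF *]] by simp_all
qed

text \<open>In Lie theory this is the Lie algebra of the centre.\<close>

definition W :: "'e set" where "W = {x \<in> V. \<forall>g\<in>carrier G. Ad g x = x}"

lemma W_in_V: "w \<in> W \<Longrightarrow> w \<in> V" by (simp add: W_def)

lemma subspace_fixed:
  assumes "F \<subseteq> carrier G"
  shows "subspace {x \<in> V. \<forall>g\<in>F. Ad g x = x}"
proof (rule subspaceI)
  have lin: "linear (Ad g)" if "g \<in> F" for g using that assms Ad_linear by blast
  show "0 \<in> {x \<in> V. \<forall>g\<in>F. Ad g x = x}" using V_zero lin linear_0 by blast
  show "x + y \<in> {x \<in> V. \<forall>g\<in>F. Ad g x = x}"
    if "x \<in> {x \<in> V. \<forall>g\<in>F. Ad g x = x}" "y \<in> {x \<in> V. \<forall>g\<in>F. Ad g x = x}" for x y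
    using that linear_add[OF lin] by (simp add: V_add)
  show "c *\<^sub>R x \<in> {x \<in> V. \<forall>g\<in>F. Ad g x = x}"
    if "x \<in> {x \<in> V. \<forall>g\<in>F. Ad g x = x}" for x c
    using that linear_scale[OF lin] by simp
qed

lemma subspace_W: "subspace W"
  unfolding W_def by (rule subspace_fixed) simp

text \<open>A description without \<open>Ad\<close>, to be transported along homomorphisms.
  Quantifying over \<open>t\<close> makes up for the fact that \<open>ex\<close> is injective only
  near zero.\<close>

lemma W_iff: "x \<in> W \<longleftrightarrow> x \<in> V \<and> (\<forall>g\<in>carrier G. \<forall>t. g \<otimes> ex (t *\<^sub>R x) \<otimes> inv g = ex (t *\<^sub>R x))"
proof (cases "x \<in> V")
  case x: True
  have "Ad g x = x \<longleftrightarrow> (\<forall>t. g \<otimes> ex (t *\<^sub>R x) \<otimes> inv g = ex (t *\<^sub>R x))" if g: "g \<in> carrier G" for g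
  proof -
    have eq: "g \<otimes> ex (t *\<^sub>R x) \<otimes> inv g = ex (t *\<^sub>R Ad g x)" for t
      using Ad_ex[OF g, of "t *\<^sub>R x"] x linear_scale[OF Ad_linear[OF g]] by simp
    show ?thesis
      unfolding eq using ex_line_inj[OF Ad_closed[OF g x] x] by auto
  qed
  then show ?thesis using x by (simp add: W_def)
qed (simp add: W_def)

lemma ex_W_central:
  assumes w: "w \<in> W" and g: "g \<in> carrier G"
  shows "ex w \<otimes> g = g \<otimes> ex w"
proof -
  have "g \<otimes> ex (1 *\<^sub>R w) \<otimes> inv g = ex (1 *\<^sub>R w)" using w g unfolding W_iff by blast
  then have "g \<otimes> ex w \<otimes> inv g \<otimes> g = ex w \<otimes> g" by simp
  then show ?thesis using g ex_closed[OF W_in_V[OF w]] by (simp add: m_assoc)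
qed

lemma ex_add_W:
  assumes x: "x \<in> V" and w: "w \<in> W"
  shows "ex (x + w) = ex x \<otimes> ex w"
proof (rule ex_add_commuting[OF x W_in_V[OF w]])
  fix s t
  show "ex (s *\<^sub>R x) \<otimes> ex (t *\<^sub>R w) = ex (t *\<^sub>R w) \<otimes> ex (s *\<^sub>R x)"
    by (rule ex_W_central[symmetric]) (use x w subspace_scale[OF subspace_W] ex_closed in auto)
qed

lemma subgroup_ex_W: "subgroup (ex ` W) G"
proof (rule subgroupI)
  show "ex ` W \<subseteq> carrier G" using W_in_V ex_closed by blast
  show "ex ` W \<noteq> {}" using subspace_0[OF subspace_W] by blast
  fix a b assume "a \<in> ex ` W" "b \<in> ex ` W"
  then obtain u v where u: "u \<in> W" "a = ex u" and v: "v \<in> W" "b = ex v" by blast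
  have "inv a = ex (- u)" using ex_neg[OF W_in_V[OF u(1)]] u(2) by simp
  then show "inv a \<in> ex ` W" using subspace_neg[OF subspace_W u(1)] by blast
  have "a \<otimes> b = ex (u + v)" using ex_add_W[OF W_in_V[OF u(1)] v(1)] u(2) v(2) by simp
  then show "a \<otimes> b \<in> ex ` W" using subspace_add[OF subspace_W u(1) v(1)] by blast
qed

text \<open>
  \<open>tangent S x\<close> says that \<open>x\<close> is a limit of directions in \<open>S\<close>. Commuting with \<open>g\<close> turns a tangent vector \<open>x\<close>
  of one term of the lower central series into the tangent vector \<open>Ad g x - x\<close> of the next,
  so the last nonzero vector obtained in this way is fixed by all \<open>Ad g\<close>.
\<close>

definition tangent :: "'a set \<Rightarrow> 'e \<Rightarrow> bool" where
  "tangent S x \<longleftrightarrow> x \<in> V \<and> (\<exists>z. (\<forall>n. z n \<in> V) \<and> (\<forall>\<^sub>F n in sequentially. ex (z n) \<in> S) \<and>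
     (\<lambda>n. 2 ^ n *\<^sub>R z n) \<longlonglongrightarrow> x)"

lemma half_scaled_tendsto_zero:
  fixes z :: "nat \<Rightarrow> 'e"
  assumes "(\<lambda>n. 2 ^ n *\<^sub>R z n) \<longlonglongrightarrow> x"
  shows "z \<longlonglongrightarrow> 0"
proof -
  have "(\<lambda>n. (1/2::real) ^ n *\<^sub>R (2 ^ n *\<^sub>R z n)) \<longlonglongrightarrow> 0 *\<^sub>R x"
    by (intro tendsto_scaleR LIMSEQ_realpow_zero assms) auto
  then show ?thesis by (simp add: power_divide)
qed

lemma tangent_commutator:
  assumes g: "g \<in> carrier G" and tan: "tangent (lower_central G k) x"
  shows "tangent (lower_central G (Suc k)) (Ad g x - x)"
proof -
  from tan obtain z where x: "x \<in> V" and z: "\<forall>n. z n \<in> V"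
    "\<forall>\<^sub>F n in sequentially. ex (z n) \<in> lower_central G k" "(\<lambda>n. 2 ^ n *\<^sub>R z n) \<longlonglongrightarrow> x"
    unfolding tangent_def by (elim conjE exE)
  interpret A: bounded_linear "Ad g"
    using Ad_linear[OF g] by (simp add: linear_conv_bounded_linear)
  have zV: "z n \<in> V" "Ad g (z n) \<in> V" "- z n \<in> V" for n
    using z(1) Ad_closed[OF g] V_neg by auto
  have z0: "z \<longlonglongrightarrow> 0" by (rule half_scaled_tendsto_zero[OF z(3)])
  have Az0: "(\<lambda>n. Ad g (z n)) \<longlonglongrightarrow> 0" using A.tendsto[OF z0] A.zero by simp
  \<comment> \<open>The value 0 is a default for the finitely many early terms at which \<mu> might
    leave \<open>V\<close>; \<open>tangent\<close> asks for membership in \<open>V\<close> at every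
    index.\<close>
  define z' where "z' n = (if \<mu> (Ad g (z n)) (- z n) \<in> V then \<mu> (Ad g (z n)) (- z n) else 0)" for n
  have small: "\<forall>\<^sub>F n in sequentially. norm (Ad g (z n)) < \<delta> \<and> norm (- z n) < \<delta>" if "0 < \<delta>" for \<delta>
    using tendstoD[OF z0 that] tendstoD[OF Az0 that] by eventually_elim simp
  have z'_props: "\<forall>\<^sub>F n in sequentially. ex (z' n) = g \<otimes> ex (z n) \<otimes> inv g \<otimes> inv (ex (z n)) \<and>
      norm (z' n - (Ad g (z n) - z n)) \<le> \<epsilon> * norm (z n)" if ep: "0 < \<epsilon>" for \<epsilon>
  proof -
    obtain \<delta> where \<delta>: "good \<epsilon> \<delta>" using good_exists[OF ep] by blast
    from small[OF good_pos[OF \<delta>]] show ?thesis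
    proof (rule eventually_mono)
      fix n assume n: "norm (Ad g (z n)) < \<delta> \<and> norm (- z n) < \<delta>"
      note s = zV(2,3)[of n] conjunct1[OF n] conjunct2[OF n]
      have e: "z' n = \<mu> (Ad g (z n)) (- z n)" using good_closed[OF \<delta> s] by (simp add: z'_def)
      have "ex (z' n) = ex (Ad g (z n)) \<otimes> ex (- z n)" unfolding e by (rule good_mult[OF \<delta> s, symmetric])
      also have "\<dots> = g \<otimes> ex (z n) \<otimes> inv g \<otimes> inv (ex (z n))"
        using Ad_ex[OF g zV(1)] ex_neg[OF zV(1)] by simp
      finally have "ex (z' n) = g \<otimes> ex (z n) \<otimes> inv g \<otimes> inv (ex (z n))" .
      moreover have "norm (z' n - (Ad g (z n) - z n)) \<le> \<epsilon> * norm (z n)"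
        using good_approx[OF \<delta> s] by (simp add: e algebra_simps)
      ultimately show "ex (z' n) = g \<otimes> ex (z n) \<otimes> inv g \<otimes> inv (ex (z n)) \<and>
        norm (z' n - (Ad g (z n) - z n)) \<le> \<epsilon> * norm (z n)" by (rule conjI)
    qed
  qed
  have "(\<lambda>n. 2 ^ n *\<^sub>R (z' n - (Ad g (z n) - z n))) \<longlonglongrightarrow> 0"
  proof (rule tendstoI)
    fix e :: real assume e: "0 < e"
    \<comment> \<open>The rescaled sequence converges and is eventually bounded by \<open>K\<close>,
      so a relative error of \<open>e / (2 * K)\<close> stays below \<open>e\<close> after
      rescaling.\<close>
    define K where "K = norm x + 1"
    have K: "K > 0" by (simp add: K_def add_nonneg_pos)
    have "\<forall>\<^sub>F n in sequentially. norm (2 ^ n *\<^sub>R z n) < K"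
      using order_tendstoD(2)[OF tendsto_norm[OF z(3)], of K] by (simp add: K_def)
    moreover have "0 < e / (2 * K)" using e K by simp
    note z'_props[OF this]
    ultimately show "\<forall>\<^sub>F n in sequentially. dist (2 ^ n *\<^sub>R (z' n - (Ad g (z n) - z n))) 0 < e"
    proof eventually_elim
      case (elim n)
      have "dist (2 ^ n *\<^sub>R (z' n - (Ad g (z n) - z n))) 0 = 2 ^ n * norm (z' n - (Ad g (z n) - z n))" by simp
      also have "\<dots> \<le> 2 ^ n * (e / (2 * K) * norm (z n))"
        using conjunct2[OF elim(2)] by (intro mult_left_mono) auto
      also have "\<dots> = e / (2 * K) * norm (2 ^ n *\<^sub>R z n)" by simp
      also have "\<dots> \<le> e / (2 * K) * K" using elim(1) e K by (intro mult_left_mono) auto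
      also have "\<dots> < e" using e K by simp
      finally show ?case .
    qed
  qed
  moreover have "(\<lambda>n. Ad g (2 ^ n *\<^sub>R z n) - 2 ^ n *\<^sub>R z n) \<longlonglongrightarrow> Ad g x - x"
    by (intro tendsto_diff A.tendsto z(3))
  ultimately have "(\<lambda>n. 2 ^ n *\<^sub>R (z' n - (Ad g (z n) - z n)) + (Ad g (2 ^ n *\<^sub>R z n) - 2 ^ n *\<^sub>R z n))
      \<longlonglongrightarrow> 0 + (Ad g x - x)" by (rule tendsto_add)
  then have lim: "(\<lambda>n. 2 ^ n *\<^sub>R z' n) \<longlonglongrightarrow> Ad g x - x"
    by (simp add: A.scaleR scaleR_diff_right)
  have "\<forall>\<^sub>F n in sequentially. ex (z' n) \<in> lower_central G (Suc k)"
    using z'_props[of 1, OF zero_less_one] z(2)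
  proof eventually_elim
    case (elim n)
    show ?case
      unfolding conjunct1[OF elim(1)] by (rule commutator_in_lower_central[OF g elim(2)])
  qed
  moreover have "\<forall>n. z' n \<in> V" using V_zero by (simp add: z'_def)
  moreover have "Ad g x - x \<in> V" by (rule subspace_diff[OF V Ad_closed[OF g x] x])
  ultimately show ?thesis unfolding tangent_def using lim by blast
qed

lemma tangent_one:
  assumes "tangent {\<one>} x"
  shows "x = 0"
proof -
  from assms obtain z where z: "\<forall>n. z n \<in> V"
    "\<forall>\<^sub>F n in sequentially. ex (z n) \<in> {\<one>}" "(\<lambda>n. 2 ^ n *\<^sub>R z n) \<longlonglongrightarrow> x"
    unfolding tangent_def by (elim conjE exE)
  have "\<forall>\<^sub>F n in sequentially. 2 ^ n *\<^sub>R z n = 0"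
    using z(2) tendstoD[OF half_scaled_tendsto_zero[OF z(3)] r0]
  proof eventually_elim
    case (elim n)
    have "z n = 0"
      by (rule ex_inj) (use elim z(1) V_zero r0 ex_zero in auto)
    then show ?case by simp
  qed
  then have "(\<lambda>n. 2 ^ n *\<^sub>R z n) \<longlonglongrightarrow> 0" by (rule tendsto_eventually)
  then show ?thesis using z(3) LIMSEQ_unique by blast
qed

lemma W_nontrivial:
  assumes c: "lower_central G c = {\<one>}" and v: "v \<in> V" "v \<noteq> 0"
  shows "\<exists>w\<in>W. w \<noteq> 0"
proof -
  define Q where "Q k \<longleftrightarrow> (\<exists>x. x \<noteq> 0 \<and> tangent (lower_central G k) x)" for k
  have "tangent (lower_central G 0) v"
    unfolding tangent_def
    by (intro conjI exI[of _ "\<lambda>n. (1/2)^n *\<^sub>R v"] allI always_eventually)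
       (use v in \<open>simp_all add: ex_closed power_divide\<close>)
  then have Q0: "Q 0" using v unfolding Q_def by blast
  have "\<not> Q c" unfolding Q_def c using tangent_one by blast
  have "\<exists>k. Q k \<and> \<not> Q (Suc k)"
  proof (rule ccontr)
    assume neg: "\<not> (\<exists>k. Q k \<and> \<not> Q (Suc k))"
    have "Q k" for k by (induction k) (use Q0 neg in blast)+
    then show False using \<open>\<not> Q c\<close> by blast
  qed
  then obtain k x where x: "x \<noteq> 0" "tangent (lower_central G k) x" and k: "\<not> Q (Suc k)"
    unfolding Q_def by blast
  have "Ad g x = x" if g: "g \<in> carrier G" for g
    using tangent_commutator[OF g x(2)] k unfolding Q_def by (metis right_minus_eq)
  moreover have "x \<in> V" using x(2) by (simp add: tangent_def)
  ultimately show ?thesis using x(1) by (auto simp: W_def)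
qed

text \<open>If \<open>ex x\<close> is central then \<open>ex (Ad g x) = ex x\<close>, and
  injectivity gives \<open>Ad g x = x\<close> provided that \<open>Ad g x\<close> is small.
  Smallness uniform in \<open>g\<close> is available for finitely many \<open>g\<close> only. A
  finite \<open>F\<close> whose common fixed space has least dimension already cuts out
  \<open>W\<close>, since one more element can no longer shrink that space.\<close>

lemma ex_W_local: "\<exists>r>0. \<forall>x\<in>V. norm x < r \<longrightarrow> ex x \<in> ex ` W \<longrightarrow> x \<in> W"
proof -
  define WF where "WF F = {x \<in> V. \<forall>g\<in>F. Ad g x = x}" for F
  obtain F where F: "finite F" "F \<subseteq> carrier G"
    "\<And>F'. \<lbrakk>finite F'; F' \<subseteq> carrier G\<rbrakk> \<Longrightarrow> dim (WF F) \<le> dim (WF F')"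
    using ex_has_least_nat[of "\<lambda>F. finite F \<and> F \<subseteq> carrier G" "{}" "\<lambda>F. dim (WF F)"] by auto
  have WF: "WF F \<subseteq> W"
  proof
    fix x assume x: "x \<in> WF F"
    have "Ad g x = x" if g: "g \<in> carrier G" for g
    proof -
      have "WF (insert g F) = WF F"
      proof (rule subspace_dim_equal)
        have "insert g F \<subseteq> carrier G" using F(2) g by blast
        then show "subspace (WF (insert g F))" "subspace (WF F)"
          unfolding WF_def using F(2) by (intro subspace_fixed; blast)+
        show "dim (WF F) \<le> dim (WF (insert g F))"
          using F(1) \<open>insert g F \<subseteq> carrier G\<close> by (intro F(3)) simp_all
        show "WF (insert g F) \<subseteq> WF F" by (auto simp: WF_def)
      qed
      then show ?thesis using x by (auto simp: WF_def)
    qed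
    then show "x \<in> W" using x by (simp add: W_def WF_def)
  qed
  have "\<exists>r>0. \<forall>g\<in>F. \<forall>x\<in>V. norm x < r \<longrightarrow> norm (Ad g x) < r0" using F(1,2)
  proof (induction F)
    case empty
    show ?case by (intro exI[of _ 1]) simp
  next
    case (insert g F)
    then obtain r where r: "r > 0" "\<forall>g\<in>F. \<forall>x\<in>V. norm x < r \<longrightarrow> norm (Ad g x) < r0" by auto
    have "g \<in> carrier G" using insert.prems by blast
    then obtain B where B: "B > 0" "\<And>x. norm (Ad g x) \<le> B * norm x"
      using linear_bounded_pos[OF Ad_linear] by metis
    have "norm (Ad g x) < r0" if "norm x < r0 / B" for x
    proof -
      have "B * norm x < r0" using that B(1) by (simp add: field_simps)
      then show ?thesis using B(2)[of x] by linarith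
    qed
    then show ?case using r B(1) r0 by (intro exI[of _ "min r (r0 / B)"]) auto
  qed
  then obtain r where r: "r > 0" "\<And>g x. \<lbrakk>g \<in> F; x \<in> V; norm x < r\<rbrakk> \<Longrightarrow> norm (Ad g x) < r0" by blast
  show ?thesis
  proof (intro exI[of _ "min r r0"] conjI ballI impI)
    fix x assume x: "x \<in> V" "norm x < min r r0" "ex x \<in> ex ` W"
    have "Ad g x = x" if g: "g \<in> F" for g
    proof (rule ex_inj)
      have gc: "g \<in> carrier G" using g F(2) by blast
      show "Ad g x \<in> V" by (rule Ad_closed[OF gc x(1)])
      show "norm (Ad g x) < r0" using r(2)[OF g x(1)] x(2) by simp
      obtain w where w: "w \<in> W" "ex x = ex w" using x(3) by blast
      have "ex (Ad g x) = g \<otimes> ex x \<otimes> inv g" using Ad_ex[OF gc x(1)] by simp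
      also have "\<dots> = ex x \<otimes> g \<otimes> inv g" unfolding w(2) ex_W_central[OF w(1) gc] ..
      also have "\<dots> = ex x" using gc ex_closed[OF x(1)] by (simp add: m_assoc)
      finally show "ex (Ad g x) = ex x" .
    qed (use x in auto)
    then have "x \<in> WF F" using x(1) by (simp add: WF_def)
    then show "x \<in> W" using WF by blast
  qed (use r r0 in auto)
qed

section \<open>Balance on the image of the fixed vectors\<close>

text \<open>Choose a basis of the span inside the additive group \<open>L\<close> and round the
  coordinates down. The remainder has coordinates between 0 and 1.\<close>

lemma bounded_reduction:
  assumes L: "\<And>a b. \<lbrakk>a \<in> L; b \<in> L\<rbrakk> \<Longrightarrow> a + b \<in> L" "\<And>a. a \<in> L \<Longrightarrow> - a \<in> L" "0 \<in> L"
  shows "\<exists>R. \<forall>x\<in>span L. \<exists>l\<in>L. norm (x - l :: 'e) \<le> R"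
proof -
  obtain B where B: "B \<subseteq> L" "independent B" "L \<subseteq> span B"
    using basis_exists[of L] by metis
  have finB: "finite B" using B(2) by (rule independent_imp_finite)
  have "span L = span B" using B(1,3) by (metis span_eq span_superset subset_trans)
  have nat: "of_nat n *\<^sub>R b \<in> L" if "b \<in> L" for n b
    by (induction n) (use that L in \<open>simp_all add: algebra_simps\<close>)
  have int: "of_int i *\<^sub>R b \<in> L" if b: "b \<in> L" for i b
  proof (cases i)
    case (nonneg n)
    then show ?thesis using nat[OF b, of n] by simp
  next
    case (neg n)
    then show ?thesis using L(2)[OF nat[OF b, of "Suc n"]] by (simp del: of_nat_Suc)
  qed
  have sum_L: "(\<Sum>b\<in>C. f b) \<in> L" if "finite C" "\<And>b. b \<in> C \<Longrightarrow> f b \<in> L" for C and f :: "'e \<Rightarrow> 'e"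
    using that by (induction C) (auto simp: L)
  show ?thesis
  proof (intro exI[of _ "\<Sum>b\<in>B. norm b"] ballI)
    fix x assume "x \<in> span L"
    then obtain u where u: "x = (\<Sum>b\<in>B. u b *\<^sub>R b)"
      unfolding \<open>span L = span B\<close> span_finite[OF finB] by auto
    define l where "l = (\<Sum>b\<in>B. of_int \<lfloor>u b\<rfloor> *\<^sub>R b)"
    have "l \<in> L" unfolding l_def by (intro sum_L finB int) (use B in auto)
    have "x - l = (\<Sum>b\<in>B. frac (u b) *\<^sub>R b)"
      by (simp add: u l_def frac_def scaleR_diff_left flip: sum_subtractf)
    then have "norm (x - l) \<le> (\<Sum>b\<in>B. norm (frac (u b) *\<^sub>R b))" by (simp only: norm_sum)
    also have "\<dots> \<le> (\<Sum>b\<in>B. norm b)"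
      by (intro sum_mono) (simp add: mult_left_le_one_le less_imp_le[OF frac_lt_1])
    finally have "norm (x - l) \<le> (\<Sum>b\<in>B. norm b)" .
    then show "\<exists>l\<in>L. norm (x - l) \<le> (\<Sum>b\<in>B. norm b)" using \<open>l \<in> L\<close> by blast
  qed
qed

text \<open>The image of \<open>W\<close> is \<open>W\<close> modulo the discrete group
  \<open>L\<close>, with \<phi> acting as \<open>f\<close>; put \<psi> for \<open>id - f\<close>. If
  \<psi> is injective on \<open>W\<close> it is onto, so there is one class, and the fixed points
  are the finite group of \<open>u\<close> with \<open>\<psi> u \<in> L\<close>, taken modulo
  \<open>L\<close>. If not, the kernel gives infinitely many fixed points, while finitely many
  translates of a proper subspace, further translated by the countable \<open>L\<close>, cannot fill
  \<open>W\<close>.\<close>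

lemma balanced_ex_W:
  assumes \<phi>: "\<phi> \<in> hom G G" and f: "linear f" and fW: "\<And>x. x \<in> W \<Longrightarrow> f x \<in> W"
    and \<phi>f: "\<And>x. x \<in> W \<Longrightarrow> \<phi> (ex x) = ex (f x)"
  shows "balanced G \<phi> (ex ` W)"
proof -
  define L where "L = {w \<in> W. ex w = \<one>}"
  define \<psi> where "\<psi> x = x - f x" for x
  have lin\<psi>: "linear \<psi>" unfolding \<psi>_def by (intro linear_compose_sub f linear_id[unfolded id_def])
  have \<psi>W: "\<psi> x \<in> W" if "x \<in> W" for x
    unfolding \<psi>_def by (rule subspace_diff[OF subspace_W that fW[OF that]])
  have ex_add_WW: "ex (u + v) = ex u \<otimes> ex v" if "u \<in> W" "v \<in> W" for u v
    by (rule ex_add_W[OF W_in_V[OF that(1)] that(2)])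
  have ex_diff: "ex (u - v) = ex u \<otimes> inv (ex v)" if "u \<in> W" "v \<in> W" for u v
    using ex_add_WW[OF that(1) subspace_neg[OF subspace_W that(2)]] ex_neg[OF W_in_V[OF that(2)]] by simp
  have c: "ex u \<in> carrier G" if "u \<in> W" for u by (rule ex_closed[OF W_in_V[OF that]])
  have ex_eq: "ex u = ex v \<longleftrightarrow> u - v \<in> L" if "u \<in> W" "v \<in> W" for u v
  proof
    assume "ex u = ex v"
    then show "u - v \<in> L" using that ex_diff[OF that] c subspace_diff[OF subspace_W that] by (simp add: L_def)
  next
    assume "u - v \<in> L"
    then have "ex (u - v) = \<one>" by (simp add: L_def)
    then show "ex u = ex v"
      using ex_add_WW[OF subspace_diff[OF subspace_W that] that(2)] c[OF that(2)] by simp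
  qed
  have L_add: "a + b \<in> L" if "a \<in> L" "b \<in> L" for a b
    using that ex_add_WW subspace_add[OF subspace_W] by (simp add: L_def)
  have L_neg: "- a \<in> L" if "a \<in> L" for a
    using that ex_neg[OF W_in_V] subspace_neg[OF subspace_W] by (simp add: L_def)
  have L_zero: "0 \<in> L" using subspace_0[OF subspace_W] ex_zero by (simp add: L_def)
  have L_diff: "a - b \<in> L" if "a \<in> L" "b \<in> L" for a b using L_add[OF that(1) L_neg[OF that(2)]] by simp
  have L_small: "a = 0" if "a \<in> L" "norm a < r0" for a
    by (rule ex_inj) (use that V_zero W_in_V r0 ex_zero in \<open>auto simp: L_def\<close>)
  have L_f: "f a \<in> L" if "a \<in> L" for a
  proof -
    have a: "a \<in> W" "ex a = \<one>" using that by (simp_all add: L_def)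
    have "ex (f a) = \<phi> \<one>" using \<phi>f[OF a(1)] a(2) by simp
    then show ?thesis using fW[OF a(1)] hom_one[OF \<phi> is_group is_group] by (simp add: L_def)
  qed
  have L_\<psi>: "\<psi> a \<in> L" if "a \<in> L" for a unfolding \<psi>_def by (rule L_diff[OF that L_f[OF that]])
  have twist: "ex g \<otimes> ex y \<otimes> inv (\<phi> (ex g)) = ex (y + \<psi> g)" if "g \<in> W" "y \<in> W" for g y
  proof -
    have "ex g \<otimes> ex y \<otimes> inv (\<phi> (ex g)) = ex (g + y - f g)"
      using that fW[OF that(1)] \<phi>f[OF that(1)] ex_add_WW[OF that]
        ex_diff[OF subspace_add[OF subspace_W that] fW[OF that(1)]] by simp
    then show ?thesis by (simp add: \<psi>_def algebra_simps)
  qed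
  have fixed: "\<phi> (ex u) = ex u \<longleftrightarrow> \<psi> u \<in> L" if "u \<in> W" for u
    using \<phi>f[OF that] ex_eq[OF that fW[OF that]] by (auto simp: \<psi>_def)
  have dimW: "\<psi> ` T = T" if "subspace T" "\<psi> ` T \<subseteq> T" "inj_on \<psi> T" for T
  proof (rule subspace_dim_equal[OF linear_subspace_image[OF lin\<psi> that(1)] that(1,2)])
    show "dim T \<le> dim (\<psi> ` T)"
    proof -
      have e: "span T = T" using that(1) by (simp only: span_eq_iff)
      show ?thesis using dim_image_eq[OF lin\<psi>, of T] that(3) unfolding e by simp
    qed
  qed
  show ?thesis
  proof (cases "inj_on \<psi> W")
    case True
    have surj: "\<psi> ` W = W" by (rule dimW[OF subspace_W _ True]) (use \<psi>W in blast)
    have "twisted_finite G \<phi> (ex ` W)"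
      unfolding twisted_finite_def
    proof (intro exI[of _ "{ex 0}"] conjI ballI)
      fix x assume "x \<in> ex ` W"
      then obtain v where "v \<in> W" and xv: "x = ex v" by blast
      then have "v \<in> \<psi> ` W" unfolding surj by simp
      then obtain u where "u \<in> W" "v = \<psi> u" by blast
      then have u: "u \<in> W" "x = ex (\<psi> u)" using xv by simp_all
      then have "x = ex u \<otimes> ex 0 \<otimes> inv (\<phi> (ex u))"
        using twist[OF u(1) subspace_0[OF subspace_W]] by simp
      then show "\<exists>y\<in>{ex 0}. \<exists>g\<in>ex ` W. x = g \<otimes> y \<otimes> inv (\<phi> g)" using u(1) by blast
    qed (use subspace_0[OF subspace_W] in auto)
    moreover have "finite {x \<in> ex ` W. \<phi> x = x}"
    proof -
      define A where "A = {u \<in> W. \<psi> u \<in> L}"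
      have spanW: "span L \<subseteq> W" by (rule span_minimal[OF _ subspace_W]) (auto simp: L_def)
      have "\<psi> ` span L \<subseteq> span L"
        using linear_span_image[OF lin\<psi>, of L] span_mono[of "\<psi> ` L" L] L_\<psi> by blast
      then have surjL: "\<psi> ` span L = span L"
        by (intro dimW subspace_span inj_on_subset[OF True spanW])
      \<comment> \<open>\<psi> maps the span of \<open>L\<close> onto itself and is injective on
        \<open>W\<close>, so the preimage of \<open>L\<close> stays in that span, where reduction
        modulo \<open>L\<close> is bounded.\<close>
      have A_span: "u \<in> span L" if "u \<in> A" for u
      proof -
        have u: "u \<in> W" "\<psi> u \<in> L" using that by (simp_all add: A_def)
        then have "\<psi> u \<in> \<psi> ` span L" unfolding surjL by (simp add: span_base)
        then obtain v where v: "v \<in> span L" "\<psi> u = \<psi> v" by blast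
        then have "u = v" using inj_onD[OF True v(2) u(1)] spanW by blast
        then show ?thesis using v(1) by simp
      qed
      obtain R where R: "\<And>x. x \<in> span L \<Longrightarrow> \<exists>l\<in>L. norm (x - l) \<le> R"
        using bounded_reduction[OF L_add L_neg L_zero] by blast
      obtain B where B: "B > 0" "\<And>x. norm (\<psi> x) \<le> B * norm x" using linear_bounded_pos[OF lin\<psi>] by metis
      \<comment> \<open>Two points of \<open>A\<close> closer than \<open>r0 / B\<close> have
        \<psi>-values differing by an element of \<open>L\<close> shorter than \<open>r0\<close>,
        which is zero. So \<open>A\<close> is separated.\<close>
      have "finite (A \<inter> cball 0 R)"
      proof (rule separated_bounded_imp_finite)
        show "bounded (A \<inter> cball 0 R)" by (intro bounded_Int disjI2 bounded_cball)
        show "0 < r0 / B" using r0 B by simp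
        fix x y assume xy: "x \<in> A \<inter> cball 0 R" "y \<in> A \<inter> cball 0 R" "dist x y < r0 / B"
        have "\<psi> x - \<psi> y = 0"
        proof (rule L_small)
          show "\<psi> x - \<psi> y \<in> L" using xy by (intro L_diff) (auto simp: A_def)
          have "norm (\<psi> x - \<psi> y) \<le> B * norm (x - y)" using B(2)[of "x - y"] linear_diff[OF lin\<psi>] by simp
          also have "\<dots> < r0" using xy(3) B(1) by (simp add: dist_norm field_simps)
          finally show "norm (\<psi> x - \<psi> y) < r0" .
        qed
        then show "x = y" using inj_onD[OF True, of x y] xy by (auto simp: A_def)
      qed
      moreover have "{x \<in> ex ` W. \<phi> x = x} \<subseteq> ex ` (A \<inter> cball 0 R)"
      proof clarify
        fix u assume u: "u \<in> W" "\<phi> (ex u) = ex u"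
        then have uA: "u \<in> A" using fixed[OF u(1)] by (simp add: A_def)
        obtain l where l: "l \<in> L" "norm (u - l) \<le> R" using R[OF A_span[OF uA]] by blast
        have lW: "l \<in> W" using l(1) by (simp add: L_def)
        have ul: "u - l \<in> W" by (rule subspace_diff[OF subspace_W u(1) lW])
        have "\<psi> (u - l) = \<psi> u - \<psi> l" by (rule linear_diff[OF lin\<psi>])
        then have "u - l \<in> A" using L_diff[of "\<psi> u" "\<psi> l"] L_\<psi>[OF l(1)] uA ul by (simp add: A_def)
        moreover have "ex u = ex (u - l)" using ex_eq[OF u(1) ul] l(1) by simp
        ultimately show "ex u \<in> ex ` (A \<inter> cball 0 R)" using l(2) by auto
      qed
      ultimately show ?thesis by (rule finite_surj)
    qed
    ultimately show ?thesis unfolding balanced_def by blast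
  next
    case False
    then obtain a b where ab: "a \<in> W" "b \<in> W" "a \<noteq> b" "\<psi> a = \<psi> b" unfolding inj_on_def by blast
    define w where "w = a - b"
    have w: "w \<in> W" "w \<noteq> 0" "\<psi> w = 0"
      using ab subspace_diff[OF subspace_W] linear_diff[OF lin\<psi>] by (simp_all add: w_def)
    have "infinite {x \<in> ex ` W. \<phi> x = x}"
    proof
      assume "finite {x \<in> ex ` W. \<phi> x = x}"
      moreover have "(\<lambda>t. ex (t *\<^sub>R w)) ` {0<..<r0 / norm w} \<subseteq> {x \<in> ex ` W. \<phi> x = x}"
      proof clarify
        fix t
        have tw: "t *\<^sub>R w \<in> W" by (rule subspace_scale[OF subspace_W w(1)])
        have "\<psi> (t *\<^sub>R w) = 0" using linear_scale[OF lin\<psi>, of t w] w(3) by simp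
        then show "ex (t *\<^sub>R w) \<in> ex ` W \<and> \<phi> (ex (t *\<^sub>R w)) = ex (t *\<^sub>R w)"
          using fixed[OF tw] tw L_zero by simp
      qed
      ultimately have "finite ((\<lambda>t. ex (t *\<^sub>R w)) ` {0<..<r0 / norm w})" by (rule rev_finite_subset)
      moreover have "inj_on (\<lambda>t. ex (t *\<^sub>R w)) {0<..<r0 / norm w}"
      proof (rule inj_onI)
        fix s t assume st: "s \<in> {0<..<r0 / norm w}" "t \<in> {0<..<r0 / norm w}" "ex (s *\<^sub>R w) = ex (t *\<^sub>R w)"
        have "s *\<^sub>R w = t *\<^sub>R w"
          by (rule ex_inj) (use st w W_in_V in \<open>auto simp: field_simps\<close>)
        then show "s = t" using w(2) by simp
      qed
      ultimately have "finite {0<..<r0 / norm w}" by (simp add: finite_image_iff)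
      then show False using infinite_Ioo[of 0 "r0 / norm w"] r0 w(2) by simp
    qed
    moreover have "\<not> twisted_finite G \<phi> (ex ` W)"
    proof
      assume "twisted_finite G \<phi> (ex ` W)"
      then obtain Y where Y: "finite Y" "Y \<subseteq> ex ` W"
        "\<forall>x\<in>ex ` W. \<exists>y\<in>Y. \<exists>g\<in>ex ` W. x = g \<otimes> y \<otimes> inv (\<phi> g)"
        unfolding twisted_finite_def by (elim exE conjE)
      obtain U where U: "finite U" "U \<subseteq> W" "Y = ex ` U"
        using finite_subset_image[OF Y(1,2)] by blast
      have "countable L"
      proof -
        have fin: "finite (L \<inter> cball 0 (real n))" for n
        proof (rule separated_bounded_imp_finite[OF _ r0])
          show "bounded (L \<inter> cball 0 (real n))" by (intro bounded_Int disjI2 bounded_cball)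
          fix x y assume "x \<in> L \<inter> cball 0 (real n)" "y \<in> L \<inter> cball 0 (real n)" "dist x y < r0"
          then show "x = y" using L_small[of "x - y"] L_diff[of x y] by (simp add: dist_norm)
        qed
        have "countable (\<Union>n. L \<inter> cball 0 (real n))"
          by (rule countable_UN) (simp_all add: countable_finite[OF fin])
        moreover have "L \<subseteq> (\<Union>n. L \<inter> cball 0 (real n))"
        proof
          fix x assume "x \<in> L"
          then show "x \<in> (\<Union>n. L \<inter> cball 0 (real n))" using real_arch_simple[of "norm x"] by auto
        qed
        ultimately show ?thesis by (rule countable_subset[rotated])
      qed
      have "\<psi> ` W \<noteq> W"
      proof
        assume eq: "\<psi> ` W = W"
        obtain B where B: "B \<subseteq> W" "independent B" "W \<subseteq> span B" "card B = dim W"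
          using basis_exists[of W] by metis
        have finB: "finite B" using B(2) by (rule independent_imp_finite)
        have spanB: "span B = W"
          using B(3) span_minimal[OF B(1) subspace_W] by (intro antisym)
        have "span (\<psi> ` B) = W" unfolding linear_span_image[OF lin\<psi>] spanB by (rule eq)
        then have sp: "W \<subseteq> span (\<psi> ` B)" by simp
        have sub: "\<psi> ` B \<subseteq> W" using B(1) \<psi>W by blast
        have "card B \<le> card (\<psi> ` B)"
          unfolding B(4) using span_card_ge_dim[OF _ sp] finB sub by simp
        then have c: "card (\<psi> ` B) = card B" using card_image_le[OF finB, of \<psi>] by simp
        have "independent (\<psi> ` B)"
          by (rule card_le_dim_spanning[OF sub sp]) (use finB c B(4) in simp_all)
        moreover have "inj_on \<psi> B" by (rule eq_card_imp_inj_on[OF finB c])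
        ultimately have "inj_on \<psi> (span B)"
          by (intro linear_inj_on_span_independent_image[OF lin\<psi>])
        then have "inj_on \<psi> W" unfolding spanB .
        then show False using False by blast
      qed
      then obtain v where v: "v \<in> W" "v \<notin> \<psi> ` W" using \<psi>W by blast
      \<comment> \<open>Each \<open>t\<close> is sent to the representative and the lattice vector
        by which \<open>t *\<^sub>R v\<close> is reached. As \<open>v\<close> is outside the image
        of \<psi>, two values of \<open>t\<close> cannot share this pair, and the reals would embed
        into a countable set.\<close>
      have "\<exists>p. p \<in> U \<times> L \<and> (\<exists>g\<in>W. t *\<^sub>R v = fst p + \<psi> g + snd p)" for t
      proof -
        have tv: "t *\<^sub>R v \<in> W" by (rule subspace_scale[OF subspace_W v(1)])
        then obtain y g where yg: "y \<in> Y" "g \<in> ex ` W" "ex (t *\<^sub>R v) = g \<otimes> y \<otimes> inv (\<phi> g)" using Y(3) by blast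
        then obtain u k where u: "u \<in> U" "y = ex u" and k: "k \<in> W" "g = ex k" using U(3) by blast
        have uW: "u \<in> W" using u(1) U(2) by blast
        have "ex (t *\<^sub>R v) = ex (u + \<psi> k)" using yg(3) twist[OF k(1) uW] unfolding u(2) k(2) by simp
        then have "t *\<^sub>R v - (u + \<psi> k) \<in> L"
          using ex_eq[OF tv subspace_add[OF subspace_W uW \<psi>W[OF k(1)]]] by blast
        then show ?thesis using u(1) k(1)
          by (intro exI[of _ "(u, t *\<^sub>R v - (u + \<psi> k))"] conjI bexI[of _ k]) auto
      qed
      then obtain p where p: "\<And>t. p t \<in> U \<times> L" "\<And>t. \<exists>g\<in>W. t *\<^sub>R v = fst (p t) + \<psi> g + snd (p t)" by metis
      have "inj p"
      proof (rule injI)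
        fix s t assume st: "p s = p t"
        obtain g h where gh: "g \<in> W" "h \<in> W" "s *\<^sub>R v = fst (p s) + \<psi> g + snd (p s)"
          "t *\<^sub>R v = fst (p t) + \<psi> h + snd (p t)" using p(2) by metis
        have "s *\<^sub>R v - t *\<^sub>R v = \<psi> g - \<psi> h" unfolding gh(3,4) st by simp
        then have e: "(s - t) *\<^sub>R v = \<psi> (g - h)" by (simp add: linear_diff[OF lin\<psi>] scaleR_diff_left)
        show "s = t"
        proof (rule ccontr)
          assume "s \<noteq> t"
          have "v = (1 / (s - t)) *\<^sub>R ((s - t) *\<^sub>R v)" using \<open>s \<noteq> t\<close> by simp
          also have "\<dots> = \<psi> ((1 / (s - t)) *\<^sub>R (g - h))" unfolding e linear_scale[OF lin\<psi>] ..
          finally have "v \<in> \<psi> ` W"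
            using subspace_scale[OF subspace_W subspace_diff[OF subspace_W gh(1,2)]] by blast
          then show False using v(2) by blast
        qed
      qed
      moreover have "countable (range p)"
      proof (rule countable_subset)
        show "range p \<subseteq> U \<times> L" using p(1) by blast
        show "countable (U \<times> L)" using U(1) \<open>countable L\<close> by (simp add: countable_finite)
      qed
      ultimately have "countable (UNIV :: real set)" by (metis countable_image_inj_on inj_on_def)
      then show False using uncountable_UNIV_real by blast
    qed
    ultimately show ?thesis unfolding balanced_def by blast
  qed
qed

end

section \<open>The quotient and induction on the dimension\<close>

text \<open>Surjectivity lets every \<open>g\<close> be written as \<open>\<phi> h\<close>; applying
  \<phi> to the commutation of \<open>h\<close> with the one-parameter subgroup of \<open>w\<close>
  gives that of \<open>g\<close> with its image.\<close>

lemma (in exp_group) surjective_endomorphism_W: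
  assumes \<phi>: "\<phi> \<in> hom G G" "\<phi> ` carrier G = carrier G"
    and f: "linear f" "\<And>x. x \<in> V \<Longrightarrow> f x \<in> V" "\<And>x. x \<in> V \<Longrightarrow> \<phi> (ex x) = ex (f x)"
    and w: "w \<in> W"
  shows "f w \<in> W"
  unfolding W_iff
proof (intro conjI ballI allI)
  interpret f: group_hom G G \<phi>
    by (rule group_hom.intro[OF is_group is_group group_hom_axioms.intro[OF \<phi>(1)]])
  show "f w \<in> V" by (rule f(2)[OF W_in_V[OF w]])
  fix g t assume g: "g \<in> carrier G"
  obtain h where h: "h \<in> carrier G" "\<phi> h = g" using g \<phi>(2) by (metis imageE)
  have tw: "t *\<^sub>R w \<in> V" using W_in_V[OF w] by simp
  have e: "\<phi> (ex (t *\<^sub>R w)) = ex (t *\<^sub>R f w)" using f(3)[OF tw] linear_scale[OF f(1)] by simp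
  have "h \<otimes> ex (t *\<^sub>R w) \<otimes> inv h = ex (t *\<^sub>R w)" using w h(1) unfolding W_iff by blast
  then have "\<phi> (h \<otimes> ex (t *\<^sub>R w) \<otimes> inv h) = \<phi> (ex (t *\<^sub>R w))" by simp
  then show "g \<otimes> ex (t *\<^sub>R f w) \<otimes> inv g = ex (t *\<^sub>R f w)"
    using h ex_closed[OF tw] by (simp add: e)
qed

text \<open>The new coordinates are the orthogonal complement of \<open>W\<close> in
  \<open>V\<close>, and all local data are composed with the projection \<open>Q\<close>. Local
  injectivity is the delicate axiom. If two small vectors have equal images, their quotient in the
  group lies in the image of \<open>W\<close>; by \<open>ex_W_local\<close> its small coordinate
  lies in \<open>W\<close>, so the vectors differ by an element of \<open>W\<close> and hence
  coincide.\<close>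

lemma (in exp_group) quotient_exp_group:
  assumes H: "group (H :: 'a monoid)" and q: "q \<in> hom G H" "q ` carrier G = carrier H"
    and ker: "kernel G H q = ex ` W"
  shows "\<exists>V' \<mu>' r'. exp_group H V' (\<lambda>x. q (ex x)) \<mu>' r' \<and> (V' :: 'e set) \<subseteq> V \<and> dim V = dim W + dim V' \<and>
    (\<forall>\<phi> \<phi>'. small_cts \<phi> \<longrightarrow> (\<forall>x\<in>carrier G. \<phi>' (q x) = q (\<phi> x)) \<longrightarrow>
       exp_group.small_cts V' (\<lambda>x. q (ex x)) \<phi>')"
proof -
  interpret H: group H by (rule H)
  interpret q: group_hom G H q by (rule group_hom.intro[OF is_group H group_hom_axioms.intro[OF q(1)]])
  obtain P where P: "linear P" "\<And>x. P x \<in> W" "\<And>x w. w \<in> W \<Longrightarrow> (x - P x) \<bullet> w = 0"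
    "\<And>x. norm (x - P x) \<le> norm x" "\<And>x. x \<in> W \<Longrightarrow> P x = x"
    using orthogonal_projection_exists[OF subspace_W] by metis
  define Q where "Q x = x - P x" for x
  have Q: "linear Q" unfolding Q_def by (intro linear_compose_sub P linear_id[unfolded id_def])
  define V' where "V' = {x \<in> V. P x = 0}"
  have V'V: "x \<in> V" if "x \<in> V'" for x using that by (simp add: V'_def)
  have V': "subspace V'"
  proof (rule subspaceI)
    show "0 \<in> V'" using V_zero linear_0[OF P(1)] by (simp add: V'_def)
    show "x + y \<in> V'" if "x \<in> V'" "y \<in> V'" for x y
      using that V_add linear_add[OF P(1)] by (simp add: V'_def)
    show "c *\<^sub>R x \<in> V'" if "x \<in> V'" for c x
      using that linear_scale[OF P(1)] by (simp add: V'_def)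
  qed
  have QV': "Q x \<in> V'" if "x \<in> V" for x
    using subspace_diff[OF V that W_in_V[OF P(2)]] linear_diff[OF P(1)] P(5)[OF P(2)]
    by (simp add: V'_def Q_def)
  have Q_id: "Q x = x" if "x \<in> V'" for x using that by (simp add: V'_def Q_def)
  have Qn: "norm (Q x) \<le> norm x" for x unfolding Q_def by (rule P(4))
  have V'W: "x = 0" if "x \<in> V'" "x \<in> W" for x using that P(5) by (simp add: V'_def)
  have qW: "q (ex w) = \<one>\<^bsub>H\<^esub>" if "w \<in> W" for w
    using imageI[OF that, of ex] unfolding ker[symmetric] kernel_def by blast
  have qQ: "q (ex (Q x)) = q (ex x)" if x: "x \<in> V" for x
  proof -
    have "ex x = ex (Q x) \<otimes> ex (P x)"
      using ex_add_W[OF V'V[OF QV'[OF x]] P(2)[of x]] by (simp add: Q_def)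
    then show ?thesis
      using qW[OF P(2)[of x]] ex_closed[OF V'V[OF QV'[OF x]]] ex_closed[OF W_in_V[OF P(2)[of x]]] by simp
  qed
  define \<mu>' where "\<mu>' x y = Q (\<mu> x y)" for x y
  \<comment> \<open>Replacing \<open>y\<close> by \<open>Q y\<close> changes neither
    \<open>q (ex y)\<close> nor, except to decrease it, the norm. The fact serves conjugation in
    \<open>H\<close> as well as the induced endomorphism.\<close>
  have small': "\<exists>\<delta>>0. \<forall>x\<in>V'. norm x < \<delta> \<longrightarrow> (\<exists>y\<in>V'. norm y < \<epsilon> \<and> \<phi>' (q (ex x)) = q (ex y))"
    if cts: "\<exists>\<delta>>0. \<forall>x\<in>V. norm x < \<delta> \<longrightarrow> (\<exists>y\<in>V. norm y < \<epsilon> \<and> \<phi> (ex x) = ex y)"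
      and comm: "\<And>x. x \<in> carrier G \<Longrightarrow> \<phi>' (q x) = q (\<phi> x)" for \<epsilon> \<phi> \<phi>'
  proof -
    obtain \<delta> where \<delta>: "\<delta> > 0" "\<And>x. \<lbrakk>x \<in> V; norm x < \<delta>\<rbrakk> \<Longrightarrow> \<exists>y\<in>V. norm y < \<epsilon> \<and> \<phi> (ex x) = ex y"
      using cts by blast
    have "\<exists>y\<in>V'. norm y < \<epsilon> \<and> \<phi>' (q (ex x)) = q (ex y)" if x: "x \<in> V'" "norm x < \<delta>" for x
    proof -
      obtain y where y: "y \<in> V" "norm y < \<epsilon>" "\<phi> (ex x) = ex y" using \<delta>(2)[OF V'V[OF x(1)] x(2)] by blast
      have "\<phi>' (q (ex x)) = q (ex (Q y))" using comm[OF ex_closed[OF V'V[OF x(1)]]] y(3) qQ[OF y(1)] by simp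
      moreover have "norm (Q y) < \<epsilon>" using Qn[of y] y(2) by (rule le_less_trans)
      ultimately show ?thesis using QV'[OF y(1)] by blast
    qed
    then show ?thesis using \<delta>(1) by blast
  qed
  obtain r1 where r1: "r1 > 0" "\<And>x. \<lbrakk>x \<in> V; norm x < r1; ex x \<in> ex ` W\<rbrakk> \<Longrightarrow> x \<in> W"
    using ex_W_local by blast
  obtain \<delta> where \<delta>: "good 1 \<delta>" using good_exists[OF zero_less_one] by blast
  \<comment> \<open>For vectors shorter than \<open>r'\<close> the coordinate
    \<open>\<mu> (- y) x\<close> has norm below \<open>3 * r'\<close>, and adding \<open>y\<close>
    keeps it below \<open>4 * r'\<close>. Those must not exceed \<open>r1\<close> and
    \<open>r0\<close>.\<close>
  define r' where "r' = min \<delta> (min r0 r1) / 4"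
  have r': "r' > 0" "r' \<le> \<delta>" "3 * r' \<le> r1" "4 * r' \<le> r0"
    using good_pos[OF \<delta>] r0 r1(1) by (auto simp: r'_def)
  have "exp_group H V' (\<lambda>x. q (ex x)) \<mu>' r'"
  proof (intro exp_group.intro exp_group_axioms.intro dyadic_exp.intro dyadic_exp_axioms.intro)
    show "group H" "subspace V'" "0 < r'" by (rule H, rule V', rule r'(1))
    show "q (ex x) \<in> carrier H" if "x \<in> V'" for x
      using ex_closed[OF V'V[OF that]] by simp
    show "q (ex x) = q (ex ((1/2) *\<^sub>R x)) \<otimes>\<^bsub>H\<^esub> q (ex ((1/2) *\<^sub>R x))" if "x \<in> V'" for x
      using ex_double[OF V'V[OF that]] ex_closed[of "(1/2) *\<^sub>R x"] V'V[OF that] by (metis q.hom_mult V_scale)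
    show "q (ex ((s + t) *\<^sub>R x)) = q (ex (s *\<^sub>R x)) \<otimes>\<^bsub>H\<^esub> q (ex (t *\<^sub>R x))" if "x \<in> V'" for x s t
      using ex_add[OF V'V[OF that], of s t] ex_closed V'V[OF that] by simp
    show "x = y" if xy: "x \<in> V'" "y \<in> V'" "norm x < r'" "norm y < r'" "q (ex x) = q (ex y)" for x y
    proof -
      have V: "x \<in> V" "- y \<in> V" "y \<in> V" using V'V xy V_neg by auto
      have n: "norm (- y) < \<delta>" "norm x < \<delta>" using xy r'(2) by auto
      have m: "ex (- y) \<otimes> ex x = ex (\<mu> (- y) x)" by (rule good_mult[OF \<delta> V(2,1) n])
      have mV: "\<mu> (- y) x \<in> V" by (rule good_closed[OF \<delta> V(2,1) n])
      have mn: "norm (\<mu> (- y) x) \<le> norm (- y) + 2 * norm x"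
        by (rule mu_norm_le[OF good_approx[OF \<delta> V(2,1) n]]) simp
      have "q (ex (\<mu> (- y) x)) = \<one>\<^bsub>H\<^esub>"
        unfolding m[symmetric] using xy(5) V ex_closed by (simp add: ex_neg)
      then have "ex (\<mu> (- y) x) \<in> ex ` W"
        unfolding ker[symmetric] kernel_def using ex_closed[OF mV] by blast
      moreover have "norm (\<mu> (- y) x) < r1" using mn xy(3,4) r'(3) by simp
      ultimately have w: "\<mu> (- y) x \<in> W" using r1(2)[OF mV] by blast
      have "ex y \<otimes> (ex (- y) \<otimes> ex x) = ex x"
        using V ex_closed by (simp add: ex_neg r_cancel_inv)
      then have "ex x = ex (y + \<mu> (- y) x)" using ex_add_W[OF V(3) w] m by simp
      moreover have "norm (y + \<mu> (- y) x) < r0"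
        using norm_triangle_ineq[of y "\<mu> (- y) x"] mn xy(3,4) r'(4) by simp
      moreover have "norm x < r0" using xy(3) r'(1,4) by simp
      ultimately have "x = y + \<mu> (- y) x"
        by (intro ex_inj V_add V mV) auto
      then have "x - y = \<mu> (- y) x" by (metis add_diff_cancel_left')
      then have "x - y \<in> W" using w by simp
      then have "x - y = 0" by (rule V'W[OF subspace_diff[OF V' xy(1,2)]])
      then show ?thesis by simp
    qed
    show "\<mu>' x 0 = x" if "x \<in> V'" "norm x < r'" for x
      using mu_zero[OF V'V[OF that(1)]] Q_id[OF that(1)] that(2) r'(1,4) by (simp add: \<mu>'_def)
    show "\<exists>d>0. \<forall>x\<in>V'. \<forall>y\<in>V'. norm x < d \<longrightarrow> norm y < d \<longrightarrow>
        \<mu>' x y \<in> V' \<and> q (ex x) \<otimes>\<^bsub>H\<^esub> q (ex y) = q (ex (\<mu>' x y))"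
    proof (intro exI[of _ \<delta>] conjI ballI impI)
      show "\<delta> > 0" by (rule good_pos[OF \<delta>])
      fix x y assume xy: "x \<in> V'" "y \<in> V'" "norm x < \<delta>" "norm y < \<delta>"
      note g = V'V[OF xy(1)] V'V[OF xy(2)] xy(3,4)
      show "\<mu>' x y \<in> V'" unfolding \<mu>'_def by (rule QV'[OF good_closed[OF \<delta> g]])
      show "q (ex x) \<otimes>\<^bsub>H\<^esub> q (ex y) = q (ex (\<mu>' x y))"
        unfolding \<mu>'_def qQ[OF good_closed[OF \<delta> g]] good_mult[OF \<delta> g, symmetric]
        using g ex_closed by simp
    qed
    show "\<exists>d>0. \<forall>x\<in>V'. \<forall>y\<in>V'. \<forall>x'\<in>V'. \<forall>y'\<in>V'. norm x < d \<longrightarrow> norm y < d \<longrightarrow> norm x' < d \<longrightarrow> norm y' < d \<longrightarrow>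
        norm (\<mu>' x y - \<mu>' x' y' - (x - x') - (y - y')) \<le> \<epsilon> * (norm (x - x') + norm (y - y'))"
      if ep: "0 < \<epsilon>" for \<epsilon>
    proof -
      obtain d where d: "d > 0" "\<And>x y x' y'. \<lbrakk>x \<in> V; y \<in> V; x' \<in> V; y' \<in> V;
          norm x < d; norm y < d; norm x' < d; norm y' < d\<rbrakk> \<Longrightarrow>
          norm (\<mu> x y - \<mu> x' y' - (x - x') - (y - y')) \<le> \<epsilon> * (norm (x - x') + norm (y - y'))"
        using mu_diff[OF ep] by auto
      have "norm (\<mu>' x y - \<mu>' x' y' - (x - x') - (y - y')) \<le> \<epsilon> * (norm (x - x') + norm (y - y'))"
        if v: "x \<in> V'" "y \<in> V'" "x' \<in> V'" "y' \<in> V'" and n: "norm x < d" "norm y < d" "norm x' < d" "norm y' < d"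
        for x y x' y'
      proof -
        have "\<mu>' x y - \<mu>' x' y' - (x - x') - (y - y') = Q (\<mu> x y - \<mu> x' y' - (x - x') - (y - y'))"
          using Q_id v by (simp add: \<mu>'_def linear_diff[OF Q])
        also have "norm \<dots> \<le> norm (\<mu> x y - \<mu> x' y' - (x - x') - (y - y'))" by (rule Qn)
        also have "\<dots> \<le> \<epsilon> * (norm (x - x') + norm (y - y'))" by (rule d(2)[OF v[THEN V'V] n])
        finally show ?thesis .
      qed
      then show ?thesis using d(1) by blast
    qed
    show "\<exists>d>0. \<forall>x\<in>V'. norm x < d \<longrightarrow> (\<exists>y\<in>V'. norm y < \<epsilon> \<and> g \<otimes>\<^bsub>H\<^esub> q (ex x) \<otimes>\<^bsub>H\<^esub> inv\<^bsub>H\<^esub> g = q (ex y))"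
      if g: "g \<in> carrier H" and ep: "0 < \<epsilon>" for g \<epsilon>
    proof -
      obtain h where h: "h \<in> carrier G" "q h = g" using g q(2) by (metis imageE)
      show ?thesis
        by (rule small'[of \<epsilon> "\<lambda>x. h \<otimes> x \<otimes> inv h" "\<lambda>x. g \<otimes>\<^bsub>H\<^esub> x \<otimes>\<^bsub>H\<^esub> inv\<^bsub>H\<^esub> g", OF conj_small[OF h(1) ep]])
           (use h in simp)
    qed
    show "\<exists>S. finite S \<and> generate H (S \<union> (\<lambda>x. q (ex x)) ` V') = carrier H"
    proof -
      obtain S where S: "finite S" "generate G (S \<union> ex ` V) = carrier G" using finitely_generated by blast
      have Sc: "S \<union> ex ` V \<subseteq> carrier G" unfolding S(2)[symmetric] by (rule subsetI) (rule generate.incl)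
      have "q ` (S \<union> ex ` V) = q ` S \<union> (\<lambda>x. q (ex x)) ` V'"
      proof -
        have "q ` ex ` V \<subseteq> (\<lambda>x. q (ex x)) ` V'"
        proof clarify
          fix x assume "x \<in> V"
          then show "q (ex x) \<in> (\<lambda>x. q (ex x)) ` V'" using QV'[of x] qQ[of x] by (metis imageI)
        qed
        moreover have "(\<lambda>x. q (ex x)) ` V' \<subseteq> q ` ex ` V" using V'V by blast
        ultimately show ?thesis by (simp only: image_Un) blast
      qed
      then have "generate H (q ` S \<union> (\<lambda>x. q (ex x)) ` V') = carrier H"
        using q.generate_img[OF Sc] S(2) q(2) by simp
      then show ?thesis using S(1) by blast
    qed
  qed
  moreover have "V' \<subseteq> V" using V'V by blast
  moreover have "dim V = dim W + dim V'"
  proof -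
    have "{x + y | x y. x \<in> W \<and> y \<in> V'} = V"
    proof (intro subset_antisym subsetI)
      fix z assume "z \<in> {x + y | x y. x \<in> W \<and> y \<in> V'}"
      then show "z \<in> V" using V_add W_in_V V'V by blast
    next
      fix z assume z: "z \<in> V"
      have "z = P z + Q z" by (simp add: Q_def)
      then show "z \<in> {x + y | x y. x \<in> W \<and> y \<in> V'}" using P(2)[of z] QV'[OF z] by blast
    qed
    moreover have "W \<inter> V' = {0}"
      using V'W subspace_0[OF V'] subspace_0[OF subspace_W] by blast
    ultimately show ?thesis using dim_sums_Int[OF subspace_W V'] by simp
  qed
  moreover have "exp_group.small_cts V' (\<lambda>x. q (ex x)) \<phi>'"
    if eg: "exp_group H V' (\<lambda>x. q (ex x)) \<mu>' r'" and "small_cts \<phi>" "\<forall>x\<in>carrier G. \<phi>' (q x) = q (\<phi> x)" for \<phi> \<phi>'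
    unfolding exp_group.small_cts_def[OF eg]
  proof (intro allI impI)
    fix \<epsilon> :: real assume "0 < \<epsilon>"
    then show "\<exists>\<delta>>0. \<forall>x\<in>V'. norm x < \<delta> \<longrightarrow> (\<exists>y\<in>V'. norm y < \<epsilon> \<and> \<phi>' (q (ex x)) = q (ex y))"
      by (intro small'[of \<epsilon> \<phi> \<phi>']) (use that(2,3) in \<open>simp_all add: small_cts_def\<close>)
  qed
  ultimately show ?thesis by blast
qed

theorem balanced_exp_group:
  fixes G :: "'a monoid" and V :: "'e::euclidean_space set"
  assumes "exp_group G V ex \<mu> r0" "lower_central G c = {\<one>\<^bsub>G\<^esub>}"
    and "\<phi> \<in> hom G G" "\<phi> ` carrier G = carrier G" "exp_group.small_cts V ex \<phi>"
  shows "balanced G \<phi> (carrier G)"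
  using assms
proof (induction "dim V" arbitrary: G V ex \<mu> r0 \<phi> rule: less_induct)
  case (less V G ex \<mu> r0 \<phi>)
  interpret exp_group G V ex \<mu> r0 by (rule less.prems(1))
  show ?case
  proof (cases "V = {0}")
    \<comment> \<open>Now the range of \<open>ex\<close> is a single point, so \<open>G\<close> is
      finitely generated.\<close>
    case True
    obtain S where S: "finite S" "generate G (S \<union> ex ` V) = carrier G" using finitely_generated by blast
    show ?thesis
      by (rule balanced_finitely_generated_nilpotent[OF is_group less.prems(2) _ S(2) less.prems(3)])
         (simp add: S(1) True)
  next
    case False
    then obtain v where v: "v \<in> V" "v \<noteq> 0" using V_zero by blast
    obtain w where w: "w \<in> W" "w \<noteq> 0" using W_nontrivial[OF less.prems(2) v] by blast
    have dimW: "dim W > 0" using w dim_eq_0[of W] by (metis gr0I singletonD subsetD)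
    obtain f where f: "linear f" and f': "\<forall>x\<in>V. f x \<in> V \<and> \<phi> (ex x) = ex (f x)"
      using hom_linear[OF less.prems(3,5)] by blast
    have fW: "f x \<in> W" if "x \<in> W" for x
      by (rule surjective_endomorphism_W[OF less.prems(3,4) f _ _ that]) (use f' in blast)+
    have bN: "balanced G \<phi> (ex ` W)"
      by (rule balanced_ex_W[OF less.prems(3) f fW]) (use f' W_in_V in blast)+
    have central: "n \<otimes>\<^bsub>G\<^esub> g = g \<otimes>\<^bsub>G\<^esub> n" if "n \<in> ex ` W" "g \<in> carrier G" for n g
      using that ex_W_central by blast
    obtain H :: "'a monoid" and q where H: "group H" and q: "q \<in> hom G H" "q ` carrier G = carrier H"
      and ker: "kernel G H q = ex ` W"
      by (rule central_quotient[OF subgroup_ex_W central])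
    interpret q: group_hom G H q
      by (rule group_hom.intro[OF is_group H group_hom_axioms.intro[OF q(1)]])
    have "\<phi> x \<in> ex ` W" if "x \<in> ex ` W" for x
      using that fW f' W_in_V by blast
    then obtain \<phi>' where \<phi>': "\<phi>' \<in> hom H H" "\<And>x. x \<in> carrier G \<Longrightarrow> \<phi>' (q x) = q (\<phi> x)"
      using q.hom_descends[OF q(2) less.prems(3)] unfolding ker by blast
    from quotient_exp_group[OF H q ker] obtain V' \<mu>' r' where
      eg: "exp_group H V' (\<lambda>x. q (ex x)) \<mu>' r'" and dim: "dim V = dim W + dim V'" and
      sc: "\<forall>\<phi> \<phi>'. small_cts \<phi> \<longrightarrow> (\<forall>x\<in>carrier G. \<phi>' (q x) = q (\<phi> x)) \<longrightarrow>
       exp_group.small_cts V' (\<lambda>x. q (ex x)) \<phi>'"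
      by (elim exE conjE)
    have "lower_central H c \<subseteq> q ` {\<one>\<^bsub>G\<^esub>}"
      using q.lower_central_surj[OF q(2), of c] unfolding less.prems(2) .
    then have "lower_central H c \<subseteq> {\<one>\<^bsub>H\<^esub>}" by simp
    then have lc: "lower_central H c = {\<one>\<^bsub>H\<^esub>}"
      using subgroup.one_closed[OF group.lower_central_subgroup[OF H, of c]] by blast
    have surj: "\<phi>' ` carrier H = carrier H"
    proof -
      have "\<phi>' ` carrier H = (\<lambda>x. \<phi>' (q x)) ` carrier G" unfolding q(2)[symmetric] by (rule image_image)
      also have "\<dots> = (\<lambda>x. q (\<phi> x)) ` carrier G" by (rule image_cong) (simp_all add: \<phi>'(2))
      also have "\<dots> = q ` \<phi> ` carrier G" by (rule image_image[symmetric])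
      also have "\<dots> = carrier H" unfolding less.prems(4) q(2) ..
      finally show ?thesis .
    qed
    have "small_cts \<phi> \<longrightarrow> (\<forall>x\<in>carrier G. \<phi>' (q x) = q (\<phi> x)) \<longrightarrow> exp_group.small_cts V' (\<lambda>x. q (ex x)) \<phi>'"
      using sc by blast
    then have "exp_group.small_cts V' (\<lambda>x. q (ex x)) \<phi>'" using less.prems(5) \<phi>'(2) by simp
    then have "balanced H \<phi>' (carrier H)"
      by (intro less.hyps[OF _ eg lc \<phi>'(1) surj]) (use dim dimW in simp_all)
    then show ?thesis
      by (intro balanced_extension[OF is_group H q ker[symmetric] central less.prems(3) \<phi>' bN])
  qed
qed

section \<open>One-parameter subgroups from halving\<close>

context dyadic_exp
begin

lemma good_mono:
  assumes g: "good \<epsilon> d" and \<delta>: "0 < \<delta>" "\<delta> \<le> d"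
  shows "good \<epsilon> \<delta>"
  unfolding good_def
proof (intro conjI ballI impI)
  show "0 < \<delta>" "\<delta> \<le> r0" using \<delta> good_le[OF g] by auto
  fix x y y' assume *: "x \<in> V" "y \<in> V" "y' \<in> V" "norm x < \<delta>" "norm y < \<delta>" "norm y' < \<delta>"
  then have n: "norm x < d" "norm y < d" "norm y' < d" using \<delta>(2) by auto
  show "\<mu> x y \<in> V" by (rule good_closed[OF g *(1,2) n(1,2)])
  show "ex x \<otimes> ex y = ex (\<mu> x y)" by (rule good_mult[OF g *(1,2) n(1,2)])
  show "norm (\<mu> x y - \<mu> x y' - (y - y')) \<le> \<epsilon> * norm (y - y')" by (rule good_diff[OF g *(1-3) n])
qed

text \<open>The induction generalises over \<open>x\<close>, because the commutation needed for one
  more summand is that of powers of \<open>ex\<close> at every scaled-down copy of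
  \<open>x\<close>.\<close>

lemma ex_nat_mult: "x \<in> V \<Longrightarrow> ex (real n *\<^sub>R x) = ex x [^] n"
proof (induction n arbitrary: x)
  case 0
  then show ?case by (simp add: ex_zero)
next
  case (Suc n)
  have "ex (real n *\<^sub>R x + x) = ex (real n *\<^sub>R x) \<otimes> ex x"
  proof (rule ex_add_if_dyadic_commuting)
    fix k
    let ?y = "(1/2)^k *\<^sub>R x"
    have y: "?y \<in> V" using Suc.prems by simp
    have "ex ((1/2)^k *\<^sub>R real n *\<^sub>R x) = ex ?y [^] n"
      using Suc.IH[OF y] by (simp add: mult.commute)
    then show "ex ((1/2)^k *\<^sub>R real n *\<^sub>R x) \<otimes> ex ?y = ex ?y \<otimes> ex ((1/2)^k *\<^sub>R real n *\<^sub>R x)"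
      using nat_pow_Suc2[OF ex_closed[OF y], of n] by simp
  qed (use Suc.prems in simp_all)
  then show ?case using Suc by (simp add: algebra_simps)
qed

text \<open>Halving relates no vector to its negative, so continuity of inversion comes in. The
  small coordinates \<open>y n\<close> of the inverses of the iterated square roots must halve at
  each step. Hence \<open>v\<close> and \<open>y 0\<close> commute at all dyadic scales,
  \<open>ex (v + y 0) = \<one>\<close>, and injectivity gives \<open>y 0 = - v\<close>. The bound
  \<open>r0 / 2\<close> leaves room for one sum or one doubling.\<close>

lemma ex_uminus:
  assumes inv_small: "\<exists>\<delta>>0. \<forall>x\<in>V. norm x < \<delta> \<longrightarrow> (\<exists>y\<in>V. norm y < r0 / 2 \<and> inv (ex x) = ex y)"
    and x: "x \<in> V"
  shows "ex (- x) = inv (ex x)"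
proof -
  obtain \<delta> where \<delta>: "\<delta> > 0" "\<And>x. \<lbrakk>x \<in> V; norm x < \<delta>\<rbrakk> \<Longrightarrow> \<exists>y\<in>V. norm y < r0 / 2 \<and> inv (ex x) = ex y"
    using inv_small by blast
  have small: "ex (- v) = inv (ex v)" if v: "v \<in> V" "norm v < \<delta>" "norm v < r0 / 2" for v
  proof -
    have vn: "(1/2)^n *\<^sub>R v \<in> V \<and> norm ((1/2)^n *\<^sub>R v) < \<delta>" for n
    proof -
      have "(1/2)^n * norm v \<le> norm v" by (rule mult_left_le_one_le) (auto simp: power_le_one)
      then show ?thesis using v by simp
    qed
    have "\<forall>n. \<exists>y. y \<in> V \<and> norm y < r0 / 2 \<and> inv (ex ((1/2)^n *\<^sub>R v)) = ex y"
      using vn \<delta>(2) by blast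
    then obtain y where y: "\<And>n. y n \<in> V" "\<And>n. norm (y n) < r0 / 2"
      "\<And>n. inv (ex ((1/2)^n *\<^sub>R v)) = ex (y n)" by metis
    have yn: "y n = (1/2)^n *\<^sub>R y 0" for n
    proof (induction n)
      case (Suc n)
      let ?w = "(1/2)^Suc n *\<^sub>R v"
      have w: "ex ?w \<in> carrier G" using vn[of "Suc n"] by (intro ex_closed) blast
      have "ex ((1/2)^n *\<^sub>R v) = ex ?w \<otimes> ex ?w"
        using ex_double[of "(1/2)^n *\<^sub>R v"] vn[of n] by simp
      then have "ex (y n) = ex (y (Suc n)) \<otimes> ex (y (Suc n))"
        using w y(3)[of n] y(3)[of "Suc n"] by (simp add: inv_mult_group)
      also have "\<dots> = ex (2 *\<^sub>R y (Suc n))"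
        using ex_double[of "2 *\<^sub>R y (Suc n)"] y(1)[of "Suc n"] by simp
      finally have "y n = 2 *\<^sub>R y (Suc n)"
        by (rule ex_inj[rotated 4]) (use y(1,2)[of n] y(1,2)[of "Suc n"] r0 in auto)
      then have "y (Suc n) = (1/2) *\<^sub>R y n" by simp
      then show ?case by (simp only: Suc.IH scaleR_scaleR power_Suc)
    qed simp
    have "ex (v + y 0) = ex v \<otimes> ex (y 0)"
    proof (rule ex_add_if_dyadic_commuting[OF v(1) y(1)])
      fix n
      have c: "ex ((1/2)^n *\<^sub>R v) \<in> carrier G" using vn[of n] by (intro ex_closed) blast
      show "ex ((1/2)^n *\<^sub>R v) \<otimes> ex ((1/2)^n *\<^sub>R y 0) = ex ((1/2)^n *\<^sub>R y 0) \<otimes> ex ((1/2)^n *\<^sub>R v)"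
        unfolding yn[symmetric] y(3)[symmetric] using c by simp
    qed
    also have "\<dots> = \<one>" using y(3)[of 0] ex_closed[OF v(1)] by (simp flip: y(3))
    finally have "v + y 0 = 0"
      by (intro ex_inj V_add V_zero v(1) y(1))
         (use norm_triangle_ineq[of v "y 0"] v(3) y(2)[of 0] r0 ex_zero in auto)
    then have "- v = y 0" by (simp add: add_eq_0_iff)
    then show ?thesis using y(3)[of 0] by simp
  qed
  have "\<forall>\<^sub>F m in sequentially. (1/2)^m * norm x < \<delta> \<and> (1/2)^m * norm x < r0 / 2"
    using \<delta>(1) r0 by (intro eventually_conj eventually_half_power_less) auto
  then obtain m where m: "(1/2)^m * norm x < \<delta>" "(1/2)^m * norm x < r0 / 2"
    by (auto simp: eventually_sequentially)
  let ?y = "(1/2)^m *\<^sub>R x"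
  have y: "?y \<in> V" using x by simp
  have "ex (- x) = ex ((1/2)^m *\<^sub>R (- x)) [^] (2^m :: nat)" by (rule ex_pow_half[OF V_neg[OF x]])
  also have "(1/2)^m *\<^sub>R (- x) = - ?y" by simp
  also have "ex (- ?y) = inv (ex ?y)" using m by (intro small y) auto
  also have "inv (ex ?y) [^] (2^m :: nat) = inv (ex ?y [^] (2^m :: nat))" by (rule nat_pow_inv[OF ex_closed[OF y]])
  also have "ex ?y [^] (2^m :: nat) = ex x" by (rule ex_pow_half[OF x, symmetric])
  finally show ?thesis .
qed

lemma ex_int_mult:
  assumes neg: "\<And>x. x \<in> V \<Longrightarrow> ex (- x) = inv (ex x)" and x: "x \<in> V"
  shows "ex (real_of_int i *\<^sub>R x) = ex x [^] i"
proof (cases i)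
  case (nonneg n)
  then show ?thesis using ex_nat_mult[OF x, of n] by (simp add: int_pow_int)
next
  case neg': (neg n)
  have "real_of_int i *\<^sub>R x = - (real (Suc n) *\<^sub>R x)" by (simp add: neg' del: of_nat_Suc)
  then have "ex (real_of_int i *\<^sub>R x) = inv (ex x [^] Suc n)"
    using neg[of "real (Suc n) *\<^sub>R x"] ex_nat_mult[OF x, of "Suc n"] x by (simp del: of_nat_Suc)
  also have "\<dots> = ex x [^] i" unfolding neg' by (rule int_pow_neg_int[OF ex_closed[OF x], symmetric])
  finally show ?thesis .
qed

lemma dyadic_floor_tendsto: "(\<lambda>n. (1/2)^n * real_of_int \<lfloor>2^n * s\<rfloor>) \<longlonglongrightarrow> s"
proof -
  have "(\<lambda>n. (1/2)^n * frac (2^n * s)) \<longlonglongrightarrow> 0"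
  proof (rule Lim_null_comparison[where g = "\<lambda>n. (1/2)^n"])
    show "\<forall>\<^sub>F n in sequentially. norm ((1/2)^n * frac (2^n * s)) \<le> (1/2)^n"
      by (intro always_eventually allI) (simp add: mult_left_le less_imp_le[OF frac_lt_1])
  qed (rule LIMSEQ_realpow_zero; simp)
  then have "(\<lambda>n. s - (1/2)^n * frac (2^n * s)) \<longlonglongrightarrow> s - 0" by (intro tendsto_diff tendsto_const)
  moreover have "s - (1/2)^n * frac (2^n * s) = (1/2)^n * real_of_int \<lfloor>2^n * s\<rfloor>" for n
    by (simp add: frac_def power_divide field_simps)
  ultimately show ?thesis by simp
qed

lemma mu_tendsto:
  assumes good: "good 1 \<delta>" "\<forall>x\<in>V. \<forall>y\<in>V. \<forall>x'\<in>V. \<forall>y'\<in>V.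
      norm x < \<delta> \<longrightarrow> norm y < \<delta> \<longrightarrow> norm x' < \<delta> \<longrightarrow> norm y' < \<delta> \<longrightarrow>
      norm (\<mu> x y - \<mu> x' y' - (x - x') - (y - y')) \<le> norm (x - x') + norm (y - y')"
    and lim: "p \<longlonglongrightarrow> x" "q \<longlonglongrightarrow> y" and V: "\<And>n. p n \<in> V" "\<And>n. q n \<in> V" "x \<in> V" "y \<in> V"
    and n: "norm x < \<delta>" "norm y < \<delta>"
  shows "(\<lambda>n. \<mu> (p n) (q n)) \<longlonglongrightarrow> \<mu> x y"
proof -
  have "(\<lambda>n. \<mu> (p n) (q n) - \<mu> x y) \<longlonglongrightarrow> 0"
  proof (rule Lim_null_comparison[where g = "\<lambda>n. 2 * (norm (p n - x) + norm (q n - y))"])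
    show "\<forall>\<^sub>F n in sequentially. norm (\<mu> (p n) (q n) - \<mu> x y) \<le> 2 * (norm (p n - x) + norm (q n - y))"
      using order_tendstoD(2)[OF tendsto_norm[OF lim(1)] n(1)] order_tendstoD(2)[OF tendsto_norm[OF lim(2)] n(2)]
    proof eventually_elim
      case (elim k)
      let ?d = "\<mu> (p k) (q k) - \<mu> x y"
      have "norm (?d - (p k - x) - (q k - y)) \<le> norm (p k - x) + norm (q k - y)"
        using good(2) V elim n by blast
      moreover have "norm ?d \<le> norm (?d - (p k - x) - (q k - y)) + (norm (p k - x) + norm (q k - y))"
      proof -
        have "?d = (?d - (p k - x) - (q k - y)) + ((p k - x) + (q k - y))" by simp
        then show ?thesis by (metis add_left_mono norm_triangle_ineq norm_triangle_le)
      qed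
      ultimately show ?case by argo
    qed
    have "(\<lambda>n. 2 * (norm (p n - x) + norm (q n - y))) \<longlonglongrightarrow> 2 * (norm (x - x) + norm (y - y))"
      by (intro tendsto_intros lim)
    then show "(\<lambda>n. 2 * (norm (p n - x) + norm (q n - y))) \<longlonglongrightarrow> 0" by simp
  qed
  then show ?thesis by (rule LIM_zero_cancel)
qed

text \<open>Integer powers give the law for dyadic scalars with a common denominator. For small
  vectors it passes to the limit inside \<mu>, which is continuous there, since \<open>ex\<close>
  itself is not known to be continuous in a topology.\<close>

lemma ex_add_real:
  assumes neg: "\<And>x. x \<in> V \<Longrightarrow> ex (- x) = inv (ex x)" and v: "v \<in> V"
  shows "ex ((s + t) *\<^sub>R v) = ex (s *\<^sub>R v) \<otimes> ex (t *\<^sub>R v)"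
proof -
  obtain d1 where d1: "good 1 d1" using good_exists[OF zero_less_one] by blast
  obtain d2 where d2: "d2 > 0" "\<forall>x\<in>V. \<forall>y\<in>V. \<forall>x'\<in>V. \<forall>y'\<in>V.
      norm x < d2 \<longrightarrow> norm y < d2 \<longrightarrow> norm x' < d2 \<longrightarrow> norm y' < d2 \<longrightarrow>
      norm (\<mu> x y - \<mu> x' y' - (x - x') - (y - y')) \<le> 1 * (norm (x - x') + norm (y - y'))"
    using mu_diff[OF zero_less_one] by blast
  \<comment> \<open>The third accounts for \<open>norm x + 2 * norm y\<close>, the bound on the norm
    of a product coordinate.\<close>
  define \<delta> where "\<delta> = min d1 d2 / 3"
  have \<delta>: "\<delta> > 0" "3 * \<delta> \<le> d1" "3 * \<delta> \<le> d2" using d1 d2(1) good_pos[OF d1] by (auto simp: \<delta>_def)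
  have g: "good 1 \<delta>" by (rule good_mono[OF d1]) (use \<delta> in auto)
  have g2: "\<forall>x\<in>V. \<forall>y\<in>V. \<forall>x'\<in>V. \<forall>y'\<in>V.
      norm x < \<delta> \<longrightarrow> norm y < \<delta> \<longrightarrow> norm x' < \<delta> \<longrightarrow> norm y' < \<delta> \<longrightarrow>
      norm (\<mu> x y - \<mu> x' y' - (x - x') - (y - y')) \<le> norm (x - x') + norm (y - y')"
  proof (intro ballI impI)
    fix x y x' y' assume "x \<in> V" "y \<in> V" "x' \<in> V" "y' \<in> V" "norm x < \<delta>" "norm y < \<delta>" "norm x' < \<delta>" "norm y' < \<delta>"
    then show "norm (\<mu> x y - \<mu> x' y' - (x - x') - (y - y')) \<le> norm (x - x') + norm (y - y')"
      using d2(2)[rule_format, of x y x' y'] \<delta>(1,3) by simp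
  qed
  have r: "3 * \<delta> \<le> r0" using good_le[OF d1] \<delta>(2) by simp
  have dyadic: "ex ((1/2)^n *\<^sub>R (real_of_int i + real_of_int j) *\<^sub>R w) =
      ex ((1/2)^n *\<^sub>R real_of_int i *\<^sub>R w) \<otimes> ex ((1/2)^n *\<^sub>R real_of_int j *\<^sub>R w)" if w: "w \<in> V" for n i j w
  proof -
    let ?y = "(1/2)^n *\<^sub>R w"
    have y: "?y \<in> V" using w by simp
    have "ex ((1/2)^n *\<^sub>R real_of_int k *\<^sub>R w) = ex ?y [^] k" for k
      using ex_int_mult[OF neg y, of k] by (simp add: mult.commute)
    from this[of i] this[of j] this[of "i + j"] show ?thesis
      using int_pow_mult[OF ex_closed[OF y], of i j] by simp
  qed
  have small: "ex ((s + t) *\<^sub>R w) = ex (s *\<^sub>R w) \<otimes> ex (t *\<^sub>R w)"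
    if w: "w \<in> V" and n: "norm (s *\<^sub>R w) < \<delta>" "norm (t *\<^sub>R w) < \<delta>" for s t w
  proof -
    define a where "a s n = (1/2)^n * real_of_int \<lfloor>2^n * s\<rfloor>" for s :: real and n
    have lim: "(\<lambda>n. a s n *\<^sub>R w) \<longlonglongrightarrow> s *\<^sub>R w" for s
      unfolding a_def by (intro tendsto_scaleR dyadic_floor_tendsto tendsto_const)
    have eq: "\<forall>\<^sub>F n in sequentially. \<mu> (a s n *\<^sub>R w) (a t n *\<^sub>R w) = (a s n + a t n) *\<^sub>R w"
      using order_tendstoD(2)[OF tendsto_norm[OF lim[of s]] n(1)] order_tendstoD(2)[OF tendsto_norm[OF lim[of t]] n(2)]
    proof eventually_elim
      case (elim k)
      have V: "a s k *\<^sub>R w \<in> V" "a t k *\<^sub>R w \<in> V" using w by simp_all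
      show ?case
      proof (rule ex_inj)
        show "\<mu> (a s k *\<^sub>R w) (a t k *\<^sub>R w) \<in> V" by (rule good_closed[OF g V elim])
        show "(a s k + a t k) *\<^sub>R w \<in> V" using w by simp
        have "norm (\<mu> (a s k *\<^sub>R w) (a t k *\<^sub>R w)) \<le> norm (a s k *\<^sub>R w) + 2 * norm (a t k *\<^sub>R w)"
          by (rule mu_norm_le[OF good_approx[OF g V elim] order.refl])
        then show "norm (\<mu> (a s k *\<^sub>R w) (a t k *\<^sub>R w)) < r0" using elim r by argo
        have "norm ((a s k + a t k) *\<^sub>R w) \<le> norm (a s k *\<^sub>R w) + norm (a t k *\<^sub>R w)"
          unfolding scaleR_add_left by (rule norm_triangle_ineq)
        then show "norm ((a s k + a t k) *\<^sub>R w) < r0" using elim r \<delta>(1) by argo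
        have "ex (\<mu> (a s k *\<^sub>R w) (a t k *\<^sub>R w)) = ex (a s k *\<^sub>R w) \<otimes> ex (a t k *\<^sub>R w)"
          by (rule good_mult[OF g V elim, symmetric])
        also have "\<dots> = ex ((a s k + a t k) *\<^sub>R w)"
          using dyadic[OF w, of k "\<lfloor>2^k * s\<rfloor>" "\<lfloor>2^k * t\<rfloor>"] by (simp add: a_def algebra_simps)
        finally show "ex (\<mu> (a s k *\<^sub>R w) (a t k *\<^sub>R w)) = ex ((a s k + a t k) *\<^sub>R w)" .
      qed
    qed
    have V: "s *\<^sub>R w \<in> V" "t *\<^sub>R w \<in> V" using w by simp_all
    have l1: "(\<lambda>n. \<mu> (a s n *\<^sub>R w) (a t n *\<^sub>R w)) \<longlonglongrightarrow> \<mu> (s *\<^sub>R w) (t *\<^sub>R w)"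
      by (rule mu_tendsto[OF g g2 lim lim _ _ V n]) (use w in simp_all)
    have "(\<lambda>n. (a s n + a t n) *\<^sub>R w) \<longlonglongrightarrow> s *\<^sub>R w + t *\<^sub>R w"
      unfolding scaleR_add_left by (intro tendsto_add lim)
    then have l2: "(\<lambda>n. \<mu> (a s n *\<^sub>R w) (a t n *\<^sub>R w)) \<longlonglongrightarrow> s *\<^sub>R w + t *\<^sub>R w"
      using eq by (rule Lim_transform_eventually[OF _ eventually_mono]) simp
    have "\<mu> (s *\<^sub>R w) (t *\<^sub>R w) = (s + t) *\<^sub>R w"
      unfolding scaleR_add_left by (rule LIMSEQ_unique[OF l1 l2])
    then show ?thesis using good_mult[OF g V n] by simp
  qed
  \<comment> \<open>For arbitrary sizes the small case is used only to get commutation: it is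
    symmetric in \<open>s\<close> and \<open>t\<close>, and commuting elements have commuting
    powers.\<close>
  have "ex (s *\<^sub>R v + t *\<^sub>R v) = ex (s *\<^sub>R v) \<otimes> ex (t *\<^sub>R v)"
  proof (rule ex_add_if_dyadic_commuting)
    fix n
    let ?w = "(1/2)^n *\<^sub>R v"
    have w: "?w \<in> V" using v by simp
    have "\<forall>\<^sub>F m in sequentially. (1/2)^m * norm (s *\<^sub>R ?w) < \<delta> \<and> (1/2)^m * norm (t *\<^sub>R ?w) < \<delta>"
      using \<delta>(1) by (intro eventually_conj eventually_half_power_less)
    then obtain m where m: "(1/2)^m * norm (s *\<^sub>R ?w) < \<delta>" "(1/2)^m * norm (t *\<^sub>R ?w) < \<delta>"
      by (auto simp: eventually_sequentially)
    let ?u = "(1/2)^m *\<^sub>R ?w"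
    have u: "?u \<in> V" by (rule V_scale[OF w])
    have nu: "norm (s *\<^sub>R ?u) < \<delta>" "norm (t *\<^sub>R ?u) < \<delta>" using m by (simp_all add: abs_mult mult.commute mult.left_commute)
    have c0: "ex (s *\<^sub>R ?u) \<otimes> ex (t *\<^sub>R ?u) = ex (t *\<^sub>R ?u) \<otimes> ex (s *\<^sub>R ?u)"
      using small[OF u nu] small[OF u nu(2,1)] by (simp add: add.commute)
    note cl = ex_closed[OF V_scale[OF u]]
    have c1: "ex (s *\<^sub>R ?u) [^] (2^m::nat) \<otimes> ex (t *\<^sub>R ?u) = ex (t *\<^sub>R ?u) \<otimes> ex (s *\<^sub>R ?u) [^] (2^m::nat)"
      by (rule group_commutes_pow[OF c0 cl cl])
    have "ex (t *\<^sub>R ?u) [^] (2^m::nat) \<otimes> ex (s *\<^sub>R ?u) [^] (2^m::nat) =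
        ex (s *\<^sub>R ?u) [^] (2^m::nat) \<otimes> ex (t *\<^sub>R ?u) [^] (2^m::nat)"
      by (rule group_commutes_pow[OF c1[symmetric] cl nat_pow_closed[OF cl]])
    moreover have "ex (c *\<^sub>R ?u) [^] (2^m::nat) = ex ((1/2)^n *\<^sub>R c *\<^sub>R v)" for c
      using ex_pow_half[of "(1/2)^n *\<^sub>R c *\<^sub>R v" m] v by (simp add: mult.commute mult.left_commute)
    ultimately show "ex ((1/2)^n *\<^sub>R s *\<^sub>R v) \<otimes> ex ((1/2)^n *\<^sub>R t *\<^sub>R v) =
        ex ((1/2)^n *\<^sub>R t *\<^sub>R v) \<otimes> ex ((1/2)^n *\<^sub>R s *\<^sub>R v)" by simp
  qed (use v in simp_all)
  then show ?thesis by (simp add: scaleR_add_left)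
qed

end

section \<open>Linearising the squaring map\<close>

text \<open>Write \<open>p = 2 ^ k * u\<close> and \<open>n = 2 ^ k * norm (x - y)\<close>. After
  \<open>k\<close> steps the points have norm at most \<open>2 * p\<close> and distance at most
  \<open>2 * n\<close>, so one more step adds an error of \<open>4 * K * p * n\<close> and doubles
  the old error \<open>2 * K * p * n\<close>. The total is \<open>8 * K * p * n\<close>, the claim
  at the next index. The conditions on \<open>c\<close> keep the iterates in the domain and the
  accumulated relative error at most 1.\<close>

lemma iterate_estimate:
  fixes s :: "'e::real_normed_vector \<Rightarrow> 'e"
  assumes est: "\<And>\<rho> x y. \<lbrakk>\<rho> \<le> R; norm x \<le> \<rho>; norm y \<le> \<rho>\<rbrakk> \<Longrightarrow> norm (s x - s y - 2 *\<^sub>R (x - y)) \<le> K * \<rho> * norm (x - y)"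
    and s0: "s 0 = 0" and K: "0 \<le> K" and c: "2 * K * c \<le> 1" "2 * c \<le> R"
    and u: "2 ^ k * u \<le> c" "norm x \<le> u" "norm y \<le> u"
  shows "norm ((s ^^ k) x - (s ^^ k) y - 2 ^ k *\<^sub>R (x - y)) \<le> 2 * K * (2 ^ k * u) * (2 ^ k * norm (x - y))"
  using u
proof (induction k arbitrary: x y)
  case 0
  have "0 \<le> u" using 0(2) norm_ge_zero order_trans by blast
  then show ?case using K by simp
next
  case (Suc k)
  have u0: "0 \<le> u" using Suc.prems(2) norm_ge_zero order_trans by blast
  define p where "p = 2 ^ k * u"
  have p: "0 \<le> p" "2 * p \<le> c" using u0 Suc.prems(1) by (simp_all add: p_def)
  then have pc: "p \<le> c" by simp
  have Kp: "2 * K * p \<le> 1" using mult_left_mono[OF pc, of "2 * K"] K c(1) by simp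
  have IH: "norm ((s ^^ k) x - (s ^^ k) y - 2 ^ k *\<^sub>R (x - y)) \<le> 2 * K * p * (2 ^ k * norm (x - y))"
    if "norm x \<le> u" "norm y \<le> u" for x y
    using Suc.IH[of x y] that pc by (simp add: p_def)
  have sk0: "(s ^^ k) 0 = 0" by (induction k) (simp_all add: s0)
  have grow: "norm ((s ^^ k) x - (s ^^ k) y) \<le> 2 * (2 ^ k * norm (x - y))" if xy: "norm x \<le> u" "norm y \<le> u" for x y
  proof -
    let ?d = "(s ^^ k) x - (s ^^ k) y - 2 ^ k *\<^sub>R (x - y)"
    have "norm ((s ^^ k) x - (s ^^ k) y) \<le> norm ?d + norm (2 ^ k *\<^sub>R (x - y))"
      using norm_triangle_ineq[of ?d "2 ^ k *\<^sub>R (x - y)"] by simp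
    also have "\<dots> \<le> 1 * (2 ^ k * norm (x - y)) + 2 ^ k * norm (x - y)"
    proof (rule add_mono)
      have "norm ?d \<le> 2 * K * p * (2 ^ k * norm (x - y))" by (rule IH[OF xy])
      also have "\<dots> \<le> 1 * (2 ^ k * norm (x - y))" by (rule mult_right_mono[OF Kp]) simp
      finally show "norm ?d \<le> 1 * (2 ^ k * norm (x - y))" .
    qed simp
    finally show ?thesis by (simp only: mult_1 mult_2)
  qed
  have bound: "norm ((s ^^ k) x) \<le> 2 * p" if "norm x \<le> u" for x
  proof -
    have "norm ((s ^^ k) x) \<le> 2 * (2 ^ k * norm x)" using grow[of x 0] that u0 by (simp add: sk0)
    also have "\<dots> \<le> 2 * (2 ^ k * u)" using that by simp
    finally show ?thesis by (simp add: p_def)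
  qed
  let ?a = "(s ^^ k) x" and ?b = "(s ^^ k) y"
  let ?n = "2 ^ k * norm (x - y)"
  have "norm (s ?a - s ?b - 2 *\<^sub>R (?a - ?b)) \<le> K * (2 * p) * norm (?a - ?b)"
    by (rule est) (use bound Suc.prems(2,3) pc c(2) in auto)
  also have "\<dots> \<le> K * (2 * p) * (2 * ?n)"
    by (intro mult_left_mono grow Suc.prems(2,3)) (use K p in simp)
  finally have e1: "norm (s ?a - s ?b - 2 *\<^sub>R (?a - ?b)) \<le> 4 * K * p * ?n" by simp
  have e2: "norm (?a - ?b - 2 ^ k *\<^sub>R (x - y)) \<le> 2 * K * p * ?n" by (rule IH[OF Suc.prems(2,3)])
  have "(s ^^ Suc k) x - (s ^^ Suc k) y - 2 ^ Suc k *\<^sub>R (x - y) =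
      (s ?a - s ?b - 2 *\<^sub>R (?a - ?b)) + 2 *\<^sub>R (?a - ?b - 2 ^ k *\<^sub>R (x - y))"
    by (simp add: scaleR_diff_right)
  then have "norm ((s ^^ Suc k) x - (s ^^ Suc k) y - 2 ^ Suc k *\<^sub>R (x - y)) =
      norm ((s ?a - s ?b - 2 *\<^sub>R (?a - ?b)) + 2 *\<^sub>R (?a - ?b - 2 ^ k *\<^sub>R (x - y)))"
    by (rule arg_cong)
  also have "\<dots> \<le> norm (s ?a - s ?b - 2 *\<^sub>R (?a - ?b)) + norm (2 *\<^sub>R (?a - ?b - 2 ^ k *\<^sub>R (x - y)))"
    by (rule norm_triangle_ineq)
  also have "\<dots> = norm (s ?a - s ?b - 2 *\<^sub>R (?a - ?b)) + 2 * norm (?a - ?b - 2 ^ k *\<^sub>R (x - y))"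
    by simp
  also have "\<dots> \<le> 4 * K * p * ?n + 2 * (2 * K * p * ?n)"
    by (intro add_mono mult_left_mono e1 e2) simp
  also have "\<dots> = 2 * K * (2 ^ Suc k * u) * (2 ^ Suc k * norm (x - y))" by (simp add: p_def)
  finally show ?case .
qed

text \<open>
  Linearisation of a map that is tangent to \<open>x \<mapsto> 2x\<close> at \<open>0\<close>:
  \<open>E v\<close> is the limit of the \<open>n\<close>-th iterates of \<open>s\<close> at \<open>v / 2^n\<close>.
\<close>

lemma doubling_linearisation:
  fixes s :: "'e::euclidean_space \<Rightarrow> 'e"
  assumes est: "\<And>\<rho> x y. \<lbrakk>\<rho> \<le> R; norm x \<le> \<rho>; norm y \<le> \<rho>\<rbrakk> \<Longrightarrow> norm (s x - s y - 2 *\<^sub>R (x - y)) \<le> K * \<rho> * norm (x - y)"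
    and s0: "s 0 = 0" and K: "0 < K" and R: "0 < R"
  shows "\<exists>E c. 0 < c \<and> c \<le> R \<and> K * c \<le> 1 \<and> E 0 = (0::'e) \<and>
    (\<forall>b x y. b \<le> c \<longrightarrow> norm x \<le> b \<longrightarrow> norm y \<le> b \<longrightarrow> norm (E x - E y - (x - y)) \<le> 2 * K * b * norm (x - y)) \<and>
    (\<forall>x. norm (2 *\<^sub>R x) \<le> c \<longrightarrow> E (2 *\<^sub>R x) = s (E x))"
proof -
  define c where "c = min (1 / (2 * K)) (R / 2)"
  have c: "0 < c" "2 * K * c \<le> 1" "2 * c \<le> R"
  proof -
    show "0 < c" using K R by (simp add: c_def)
    have "2 * K * c \<le> 2 * K * (1 / (2 * K))" using K by (intro mult_left_mono) (auto simp: c_def)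
    then show "2 * K * c \<le> 1" using K by simp
    show "2 * c \<le> R" by (simp add: c_def)
  qed
  define f where "f n v = (s ^^ n) ((1/2) ^ n *\<^sub>R v)" for n v
  have lip: "norm (f n x - f n y - (x - y)) \<le> 2 * K * b * norm (x - y)"
    if b: "b \<le> c" "norm x \<le> b" "norm y \<le> b" for n b x y
  proof -
    have e: "norm ((s ^^ n) ((1/2)^n *\<^sub>R x) - (s ^^ n) ((1/2)^n *\<^sub>R y) - 2 ^ n *\<^sub>R ((1/2)^n *\<^sub>R x - (1/2)^n *\<^sub>R y))
      \<le> 2 * K * (2 ^ n * ((1/2)^n * b)) * (2 ^ n * norm ((1/2)^n *\<^sub>R x - (1/2)^n *\<^sub>R y))"
      by (rule iterate_estimate[OF est s0 less_imp_le[OF K] c(2,3)])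
         (use b in \<open>simp_all add: power_divide divide_right_mono\<close>)
    have h: "2 ^ n *\<^sub>R ((1/2)^n *\<^sub>R x - (1/2)^n *\<^sub>R y) = x - y"
      by (simp add: power_divide flip: scaleR_diff_right)
    have "2 ^ n * norm ((1/2)^n *\<^sub>R x - (1/2)^n *\<^sub>R y) = norm (2 ^ n *\<^sub>R ((1/2)^n *\<^sub>R x - (1/2)^n *\<^sub>R y))" by simp
    also have "\<dots> = norm (x - y)" unfolding h ..
    finally show ?thesis using e unfolding h f_def by (simp add: power_divide)
  qed
  have f0: "f n 0 = 0" for n
  proof -
    have "(s ^^ n) 0 = 0" by (induction n) (simp_all add: s0)
    then show ?thesis by (simp add: f_def)
  qed
  \<comment> \<open>Consecutive terms arise by applying \<open>s ^^ n\<close> to \<open>s z\<close>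
    and \<open>2 *\<^sub>R z\<close>. These differ by at most \<open>K\<close> times the square of
    \<open>norm z\<close>, which is of order \<open>1 / 4 ^ n\<close>, and \<open>s ^^ n\<close>
    expands distances at most by twice \<open>2 ^ n\<close>. Both points have norm at most
    \<open>4 * norm z\<close>; as \<open>2 ^ n * (4 * norm z)\<close> is twice
    \<open>norm v\<close>, the radius is \<open>c / 2\<close>.\<close>
  have step: "norm (f (Suc n) v - f n v) \<le> c * (1/2) ^ n" if v: "norm v \<le> c / 2" for n v
  proof -
    define z where "z = (1/2) ^ Suc n *\<^sub>R v"
    let ?x = "s z" and ?y = "(1/2) ^ n *\<^sub>R v"
    have y: "?y = 2 *\<^sub>R z" by (simp add: z_def)
    have nz: "norm z = (1/2) ^ Suc n * norm v" by (simp add: z_def)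
    have "(1/2) ^ Suc n * norm v \<le> 1 * norm v" by (intro mult_right_mono power_le_one) auto
    then have nzc: "norm z \<le> c / 2" unfolding nz using v by simp
    then have zR: "norm z \<le> R" using c by simp
    have d: "norm (?x - ?y) \<le> K * norm z * norm z" using est[OF zR, of z 0] by (simp add: s0 y)
    have "K * norm z * norm z \<le> K * (c / 2) * norm z" using nzc K by (intro mult_right_mono mult_left_mono) auto
    also have "\<dots> = (2 * K * c) * (norm z / 4)" by simp
    also have "\<dots> \<le> 1 * (norm z / 4)" using c(2) by (intro mult_right_mono) auto
    finally have d2: "norm (?x - ?y) \<le> norm z / 4" using d by simp
    have nx: "norm ?x \<le> 2 * norm z + norm z / 4"
      using norm_triangle_ineq[of "?x - ?y" ?y] d2 unfolding y by simp
    have e: "norm ((s ^^ n) ?x - (s ^^ n) ?y - 2 ^ n *\<^sub>R (?x - ?y)) \<le> 2 * K * (2 ^ n * (4 * norm z)) * (2 ^ n * norm (?x - ?y))"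
    proof (rule iterate_estimate[OF est s0 less_imp_le[OF K] c(2,3)])
      show "2 ^ n * (4 * norm z) \<le> c" unfolding nz using v by (simp add: power_divide)
      show "norm ?x \<le> 4 * norm z" using nx norm_ge_zero[of z] by argo
      show "norm ?y \<le> 4 * norm z" unfolding y by simp
    qed
    have "2 * K * (2 ^ n * (4 * norm z)) \<le> 2 * K * c"
      using v K unfolding nz by (intro mult_left_mono) (auto simp: power_divide)
    then have le1: "2 * K * (2 ^ n * (4 * norm z)) \<le> 1" by (rule order_trans[OF _ c(2)])
    have "norm ((s ^^ n) ?x - (s ^^ n) ?y - 2 ^ n *\<^sub>R (?x - ?y)) \<le> 1 * (2 ^ n * norm (?x - ?y))"
      by (rule order_trans[OF e mult_right_mono[OF le1]]) simp
    then have "norm ((s ^^ n) ?x - (s ^^ n) ?y) \<le> 2 * (2 ^ n * norm (?x - ?y))"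
      using norm_triangle_ineq[of "(s ^^ n) ?x - (s ^^ n) ?y - 2 ^ n *\<^sub>R (?x - ?y)" "2 ^ n *\<^sub>R (?x - ?y)"] by simp
    also have "\<dots> \<le> 2 * (2 ^ n * (K * norm z * norm z))" using d by simp
    also have "\<dots> = (2 * K * (2 ^ n * (4 * norm z))) * (norm z / 4)" by simp
    also have "\<dots> \<le> 1 * (norm z / 4)" using le1 by (intro mult_right_mono) auto
    also have "\<dots> \<le> c * (1/2) ^ n"
    proof -
      have "(1/2) ^ n * norm v \<le> (1/2) ^ n * (c / 2)" using v by (intro mult_left_mono) auto
      moreover have "0 \<le> (1/2) ^ n * c" using c(1) by simp
      ultimately show ?thesis unfolding nz by (simp add: field_simps)
    qed
    finally have "norm ((s ^^ n) ?x - (s ^^ n) ?y) \<le> c * (1/2) ^ n" .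
    moreover have "f (Suc n) v = (s ^^ n) ?x" unfolding f_def z_def[symmetric] by (simp only: funpow_Suc_right comp_apply)
    moreover have "f n v = (s ^^ n) ?y" by (simp add: f_def)
    ultimately show ?thesis by simp
  qed
  have conv: "convergent (\<lambda>n. f n v)" if v: "norm v \<le> c / 2" for v
  proof -
    have "summable (\<lambda>n. f (Suc n) v - f n v)"
      by (rule summable_comparison_test'[where g = "\<lambda>n. c * (1/2) ^ n" and N = 0])
         (use step[OF v] in \<open>simp_all add: summable_mult summable_geometric\<close>)
    then have "convergent (\<lambda>n. \<Sum>i<n. f (Suc i) v - f i v)" by (simp add: summable_iff_convergent)
    moreover have "(\<Sum>i<n. f (Suc i) v - f i v) = f n v - f 0 v" for n
      by (rule sum_lessThan_telescope)
    ultimately have "convergent (\<lambda>n. f n v - f 0 v)" by simp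
    then have "convergent (\<lambda>n. (f n v - f 0 v) + f 0 v)" by (intro convergent_add convergent_const)
    then show ?thesis by simp
  qed
  define E where "E v = lim (\<lambda>n. f n v)" for v
  have E: "(\<lambda>n. f n v) \<longlonglongrightarrow> E v" if "norm v \<le> c / 2" for v
    using conv[OF that] by (simp add: E_def convergent_LIMSEQ_iff)
  have E0: "E 0 = 0" using LIMSEQ_unique[OF E[of 0]] c(1) by (simp add: f0)
  have E_lip: "norm (E x - E y - (x - y)) \<le> 2 * K * b * norm (x - y)"
    if b: "b \<le> c / 2" "norm x \<le> b" "norm y \<le> b" for b x y
  proof (rule LIMSEQ_le_const2)
    show "(\<lambda>n. norm (f n x - f n y - (x - y))) \<longlonglongrightarrow> norm (E x - E y - (x - y))"
      by (intro tendsto_norm tendsto_diff E tendsto_const) (use b in linarith)+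
    show "\<exists>N. \<forall>n\<ge>N. norm (f n x - f n y - (x - y)) \<le> 2 * K * b * norm (x - y)"
      using lip[of b x y] b c(1) by (intro exI[of _ 0] allI impI) simp
  qed
  have E_norm: "norm (E x) \<le> 2 * norm x" if "norm x \<le> c / 2" for x
  proof -
    have "norm (E x - x) \<le> 2 * K * (c / 2) * norm x"
      using E_lip[of "c / 2" x 0] that c(1) by (simp add: E0)
    also have "\<dots> \<le> 1 * norm x" using c(2) K by (intro mult_right_mono) auto
    finally show ?thesis using norm_triangle_ineq[of "E x - x" x] by simp
  qed
  have E_double: "E (2 *\<^sub>R x) = s (E x)" if x: "norm (2 *\<^sub>R x) \<le> c / 2" for x
  proof -
    have "2 * norm x \<le> c / 2" using x by simp
    then have x': "norm x \<le> c / 2" using norm_ge_zero[of x] by argo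
    have lim1: "(\<lambda>n. f (Suc n) (2 *\<^sub>R x)) \<longlonglongrightarrow> E (2 *\<^sub>R x)" by (rule LIMSEQ_Suc[OF E[OF x]])
    have "f (Suc n) (2 *\<^sub>R x) = s (f n x)" for n by (simp add: f_def)
    then have lim1: "(\<lambda>n. s (f n x)) \<longlonglongrightarrow> E (2 *\<^sub>R x)" using lim1 by simp
    have ER: "norm (E x) < R" using E_norm[OF x'] x c by simp
    have "(\<lambda>n. s (f n x) - s (E x)) \<longlonglongrightarrow> 0"
    proof (rule Lim_null_comparison[where g = "\<lambda>n. (K * R + 2) * norm (f n x - E x)"])
      show "\<forall>\<^sub>F n in sequentially. norm (s (f n x) - s (E x)) \<le> (K * R + 2) * norm (f n x - E x)"
        using order_tendstoD(2)[OF tendsto_norm[OF E[OF x']] ER]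
      proof eventually_elim
        case (elim n)
        let ?d = "f n x - E x"
        have "norm (s (f n x) - s (E x) - 2 *\<^sub>R ?d) \<le> K * R * norm ?d"
          by (rule est) (use elim ER in auto)
        then show ?case
          using norm_triangle_ineq[of "s (f n x) - s (E x) - 2 *\<^sub>R ?d" "2 *\<^sub>R ?d"] by (simp add: distrib_right)
      qed
      have "(\<lambda>n. (K * R + 2) * norm (f n x - E x)) \<longlonglongrightarrow> (K * R + 2) * norm (E x - E x)"
        by (intro tendsto_intros E x')
      then show "(\<lambda>n. (K * R + 2) * norm (f n x - E x)) \<longlonglongrightarrow> 0" by simp
    qed
    then have "(\<lambda>n. s (f n x)) \<longlonglongrightarrow> s (E x)" by (rule LIM_zero_cancel)
    then show ?thesis using lim1 LIMSEQ_unique by blast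
  qed
  show ?thesis
  proof (intro exI[of _ E] exI[of _ "c / 2"] conjI allI impI)
    show "0 < c / 2" "c / 2 \<le> R" using c by simp_all
    show "K * (c / 2) \<le> 1" using c(2) by simp
  qed (use E0 E_lip E_double in auto)
qed

section \<open>The exponential map of a local group\<close>

text \<open>Group multiplication in coordinates centred at the identity. \<open>m_est\<close> bounds
  the deviation of \<open>m\<close> from addition with a Lipschitz constant proportional to the
  radius; differentiability at the origin alone would give only a constant tending to zero, without
  a rate for the convergence of the iterated square roots.\<close>

locale local_group = group G for G (structure) +
  fixes e :: "'e::euclidean_space \<Rightarrow> 'a" and m :: "'e \<Rightarrow> 'e \<Rightarrow> 'e" and R R0 K :: real
  assumes R: "0 < R0" "R0 < R" and K: "0 < K"
    and e_closed: "norm x < R \<Longrightarrow> e x \<in> carrier G"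
    and e_zero: "e 0 = \<one>"
    and e_inj: "\<lbrakk>norm x < R; norm y < R; e x = e y\<rbrakk> \<Longrightarrow> x = y"
    and m_mult: "\<lbrakk>norm x \<le> R0; norm y \<le> R0\<rbrakk> \<Longrightarrow> norm (m x y) < R \<and> e x \<otimes> e y = e (m x y)"
    and m_est: "\<lbrakk>\<rho> \<le> R0; norm x \<le> \<rho>; norm y \<le> \<rho>; norm x' \<le> \<rho>; norm y' \<le> \<rho>\<rbrakk> \<Longrightarrow>
      norm (m x y - m x' y' - (x - x') - (y - y')) \<le> K * \<rho> * (norm (x - x') + norm (y - y'))"
begin

lemma m_zero: "norm x \<le> R0 \<Longrightarrow> m x 0 = x"
proof (rule e_inj)
  assume x: "norm x \<le> R0"
  then show "norm (m x 0) < R" "norm x < R" using m_mult[of x 0] R by auto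
  then show "e (m x 0) = e x" using m_mult[of x 0] x R(1) e_closed[of x] e_zero by auto
qed

text \<open>Let \<open>E\<close> turn doubling into squaring near zero. Then \<open>e (E x)\<close>
  respects halving for small \<open>x\<close>, and taking powers of two extends it to all vectors.
  The product is \<mu>, which is \<open>m\<close> conjugated by \<open>E\<close>; as
  \<open>E\<close> is close to the identity in the Lipschitz sense, the estimate for
  \<open>m\<close> carries over. The last two clauses say that \<open>e\<close> and
  \<open>ex\<close> define the same small elements.\<close>

lemma dyadic_exp_exists:
  "\<exists>ex \<mu> r0. dyadic_exp G (UNIV :: 'e set) ex \<mu> r0 \<and>
     (\<forall>\<epsilon>>0. \<exists>\<delta>>0. \<forall>x. norm x < \<delta> \<longrightarrow> (\<exists>y. norm y < \<epsilon> \<and> e x = ex y)) \<and>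
     (\<forall>\<epsilon>>0. \<exists>\<delta>>0. \<forall>x. norm x < \<delta> \<longrightarrow> (\<exists>y. norm y < \<epsilon> \<and> ex x = e y))"
proof -
  define s where "s x = m x x" for x
  have s_est: "norm (s x - s y - 2 *\<^sub>R (x - y)) \<le> 2 * K * \<rho> * norm (x - y)"
    if "\<rho> \<le> R0" "norm x \<le> \<rho>" "norm y \<le> \<rho>" for \<rho> x y
    using m_est[of \<rho> x x y y] that by (simp add: s_def scaleR_2 algebra_simps)
  have s0: "s 0 = 0" using m_zero[of 0] R by (simp add: s_def)
  from doubling_linearisation[of R0 s "2 * K", OF s_est s0 _ R(1)] K
  obtain E c where c: "0 < c" "c \<le> R0" "2 * K * c \<le> 1" and E0: "E 0 = 0"
    and E_lip': "\<forall>b x y. b \<le> c \<longrightarrow> norm x \<le> b \<longrightarrow> norm y \<le> b \<longrightarrow> norm (E x - E y - (x - y)) \<le> 2 * (2 * K) * b * norm (x - y)"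
    and E_double': "\<forall>x. norm (2 *\<^sub>R x) \<le> c \<longrightarrow> E (2 *\<^sub>R x) = s (E x)"
    by auto
  have E_lip: "norm (E x - E y - (x - y)) \<le> 4 * K * b * norm (x - y)"
    if "b \<le> c" "norm x \<le> b" "norm y \<le> b" for b x y
    using E_lip'[rule_format, OF that] by simp
  \<comment> \<open>On the ball of radius \<open>c1\<close> the map \<open>E\<close> differs from
    the identity by a map of Lipschitz constant at most 1/4. So \<open>E\<close> and its inverse
    change distances at most by the factor 2.\<close>
  define c1 where "c1 = min (c / 2) (1 / (16 * K))"
  have c1: "0 < c1" "2 * c1 \<le> c" "4 * K * c1 \<le> 1 / 4"
  proof -
    show "0 < c1" "2 * c1 \<le> c" using c(1) K by (auto simp: c1_def)
    have "4 * K * c1 \<le> 4 * K * (1 / (16 * K))" using K by (intro mult_left_mono) (auto simp: c1_def)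
    then show "4 * K * c1 \<le> 1 / 4" using K by simp
  qed
  have E4: "norm (E x - E y - (x - y)) \<le> norm (x - y) / 4" if "norm x \<le> c1" "norm y \<le> c1" for x y
  proof -
    have "norm (E x - E y - (x - y)) \<le> 4 * K * c1 * norm (x - y)"
      by (rule E_lip) (use that c1(1,2) in auto)
    also have "\<dots> \<le> 1 / 4 * norm (x - y)" by (rule mult_right_mono[OF c1(3)]) simp
    finally show ?thesis by simp
  qed
  have E_up: "norm (E x - E y) \<le> 2 * norm (x - y)" if "norm x \<le> c1" "norm y \<le> c1" for x y
  proof -
    have "norm (E x - E y) \<le> norm (E x - E y - (x - y)) + norm (x - y)"
      using norm_triangle_ineq[of "E x - E y - (x - y)" "x - y"] by (simp only: diff_add_cancel)
    then show ?thesis using E4[OF that] norm_ge_zero[of "x - y"] by argo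
  qed
  have E_low: "norm (x - y) \<le> 2 * norm (E x - E y)" if "norm x \<le> c1" "norm y \<le> c1" for x y
  proof -
    have "norm (x - y) \<le> norm (E x - E y) + norm (E x - E y - (x - y))"
      using norm_triangle_ineq4[of "E x - E y" "E x - E y - (x - y)"] by simp
    then show ?thesis using E4[OF that] norm_ge_zero[of "x - y"] by argo
  qed
  have En: "norm (E x) \<le> 2 * norm x" if "norm x \<le> c1" for x
    using E_up[OF that, of 0] c1(1) by (simp add: E0)
  have ER0: "norm (E x) \<le> R0" if "norm x \<le> c1" for x
    using En[OF that] that c1(2) c(2) by simp
  have ER: "norm (E x) < R" if "norm x \<le> c1" for x using ER0[OF that] R(2) by simp
  have E_inj: "x = y" if "norm x \<le> c1" "norm y \<le> c1" "E x = E y" for x y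
    using E_low[OF that(1,2)] that(3) by simp
  \<comment> \<open>Invariance of domain puts a ball into the image of \<open>E\<close>, so products
    of small elements have coordinates under \<open>E\<close> again.\<close>
  have E_open: "\<exists>\<eta>>0. ball 0 \<eta> \<subseteq> E ` ball 0 b" if b: "0 < b" "b \<le> c1" for b
  proof -
    have "continuous_on (ball 0 b) E"
      by (rule lipschitz_on_continuous_on[of 2], rule lipschitz_onI) (use E_up b in \<open>auto simp: dist_norm\<close>)
    moreover have "inj_on E (ball 0 b)" using E_inj b by (auto simp: inj_on_def)
    ultimately have "open (E ` ball 0 b)" by (intro invariance_of_domain open_ball)
    moreover have "0 \<in> E ` ball 0 b" using E0 b(1) by (intro image_eqI[of _ _ 0]) auto
    ultimately show ?thesis unfolding open_contains_ball by blast
  qed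
  define el where "el x = e (E x)" for x
  have el_closed: "el x \<in> carrier G" if "norm x < c1" for x
    unfolding el_def using ER[of x] that by (intro e_closed) auto
  have el_double: "el (2 *\<^sub>R x) = el x \<otimes> el x" if x: "norm (2 *\<^sub>R x) < c1" for x
  proof -
    have "E (2 *\<^sub>R x) = m (E x) (E x)"
      using E_double'[rule_format, of x] x c1(1,2) by (simp add: s_def)
    moreover have "norm (E x) \<le> R0" using x c1(1) by (intro ER0) auto
    ultimately show ?thesis using m_mult[of "E x" "E x"] by (simp add: el_def)
  qed
  define N where "N x = (LEAST n. (1/2)^n * norm x < c1)" for x :: 'e
  define ex where "ex x = el ((1/2)^N x *\<^sub>R x) [^] (2^N x :: nat)" for x
  have N: "(1/2)^N x * norm x < c1" for x
  proof -
    obtain n where "(1/2)^n * norm x < c1"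
      using eventually_half_power_less[OF c1(1), of "norm x"] by (auto simp: eventually_sequentially)
    then show ?thesis unfolding N_def by (rule LeastI)
  qed
  have pow_step: "el ((1/2)^n *\<^sub>R x) = el ((1/2)^(n + k) *\<^sub>R x) [^] (2^k :: nat)"
    if "(1/2)^n * norm x < c1" for n k x
  proof (induction k)
    case 0
    have "el ((1/2)^n *\<^sub>R x) \<in> carrier G" using that by (intro el_closed) simp
    then show ?case by simp
  next
    case (Suc k)
    let ?y = "(1/2)^(n + Suc k) *\<^sub>R x"
    have le: "(1/2)^(n + j) * norm x \<le> (1/2)^n * norm x" for j
      by (intro mult_right_mono power_decreasing) auto
    have y: "el ?y \<in> carrier G" using le[of "Suc k"] that by (intro el_closed) simp
    have "2 *\<^sub>R ?y = (1/2)^(n + k) *\<^sub>R x" by simp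
    moreover have "norm (2 *\<^sub>R ?y) < c1" using le[of k] that by simp
    ultimately have "el ((1/2)^(n + k) *\<^sub>R x) = el ?y [^] (2::nat)"
      using el_double[of ?y] y by (simp add: numeral_2_eq_2)
    then show ?case using Suc.IH y by (simp add: nat_pow_pow)
  qed
  have ex_eq: "ex x = el ((1/2)^n *\<^sub>R x) [^] (2^n :: nat)" if n: "(1/2)^n * norm x < c1" for n x
  proof -
    have "N x \<le> n" unfolding N_def by (rule Least_le) (rule n)
    then obtain k where k: "n = N x + k" using le_Suc_ex by blast
    have "el ((1/2)^n *\<^sub>R x) \<in> carrier G" using n by (intro el_closed) simp
    then show ?thesis
      unfolding ex_def pow_step[OF N, of x k] k by (simp add: nat_pow_pow power_add mult.commute)
  qed
  have ex_small: "ex x = e (E x)" if "norm x < c1" for x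
    using ex_eq[of 0 x] that el_closed[OF that] by (simp add: el_def)
  obtain \<eta> where \<eta>: "\<eta> > 0" "ball 0 \<eta> \<subseteq> E ` ball 0 c1" using E_open[OF c1(1) order.refl] by blast
  define \<mu> where "\<mu> x y = inv_into (ball 0 c1) E (m (E x) (E y))" for x y
  have m_norm: "norm (m a b) \<le> (1 + K * R0) * (norm a + norm b)" if "norm a \<le> R0" "norm b \<le> R0" for a b
  proof -
    have "norm (m a b - a - b) \<le> K * R0 * (norm a + norm b)"
      using m_est[of R0 a b 0 0] that R(1) m_zero[of 0] by simp
    moreover have "norm (m a b) \<le> norm (m a b - a - b) + (norm a + norm b)"
      using norm_triangle_ineq[of "m a b - a - b" "a + b"] norm_triangle_ineq[of a b] by simp
    ultimately show ?thesis by (simp add: distrib_right)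
  qed
  \<comment> \<open>\<open>E\<close> at most doubles norms, so
    \<open>norm (E x) + norm (E y)\<close> is below \<open>4 * \<delta>0\<close>; by
    \<open>m_norm\<close> the product then stays within \<eta>, where \<open>E\<close> can be
    inverted.\<close>
  define \<delta>0 where "\<delta>0 = min c1 (\<eta> / (4 * (1 + K * R0)))"
  have KR: "1 + K * R0 > 0" using K R(1) by (simp add: add_pos_pos)
  have \<delta>0: "0 < \<delta>0" "\<delta>0 \<le> c1" "(1 + K * R0) * (4 * \<delta>0) \<le> \<eta>"
  proof -
    show "0 < \<delta>0" "\<delta>0 \<le> c1" using c1(1) \<eta>(1) KR by (auto simp: \<delta>0_def)
    have "(1 + K * R0) * (4 * \<delta>0) \<le> (1 + K * R0) * (4 * (\<eta> / (4 * (1 + K * R0))))"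
      using KR by (intro mult_left_mono) (auto simp: \<delta>0_def)
    also have "\<dots> = \<eta>"
    proof -
      have "k * (4 * (\<eta> / (4 * k))) = \<eta>" if "k > 0" for k :: real using that by simp
      from this[OF KR] show ?thesis .
    qed
    finally show "(1 + K * R0) * (4 * \<delta>0) \<le> \<eta>" .
  qed
  have \<mu>: "norm (\<mu> x y) < c1 \<and> E (\<mu> x y) = m (E x) (E y)" if x: "norm x < \<delta>0" and y: "norm y < \<delta>0" for x y
  proof -
    have n: "norm x \<le> c1" "norm y \<le> c1" using x y \<delta>0(2) by auto
    have "norm (m (E x) (E y)) \<le> (1 + K * R0) * (norm (E x) + norm (E y))"
      by (rule m_norm[OF ER0[OF n(1)] ER0[OF n(2)]])
    also have "\<dots> < (1 + K * R0) * (4 * \<delta>0)"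
      using En[OF n(1)] En[OF n(2)] x y by (intro mult_strict_left_mono KR) simp
    finally have "m (E x) (E y) \<in> E ` ball 0 c1" using \<delta>0(3) \<eta>(2) by auto
    then have "\<mu> x y \<in> ball 0 c1" "E (\<mu> x y) = m (E x) (E y)"
      unfolding \<mu>_def by (rule inv_into_into, rule f_inv_into_f)
    then show ?thesis by simp
  qed
  have A: "dyadic_exp G UNIV ex \<mu> c1"
  proof (intro dyadic_exp.intro dyadic_exp_axioms.intro)
    show "group G" by (rule is_group)
    show "subspace (UNIV :: 'e set)" by simp
    show "0 < c1" by (rule c1(1))
    show "ex x \<in> carrier G" for x
      unfolding ex_def using N[of x] by (intro nat_pow_closed el_closed) simp
    show "ex x = ex ((1/2) *\<^sub>R x) \<otimes> ex ((1/2) *\<^sub>R x)" for x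
    proof -
      let ?y = "(1/2)^Suc (N x) *\<^sub>R x"
      have le: "(1/2)^Suc (N x) * norm x \<le> (1/2)^N x * norm x" by (intro mult_right_mono) auto
      have n: "(1/2)^Suc (N x) * norm x < c1" by (rule le_less_trans[OF le N])
      have y: "el ?y \<in> carrier G" using n by (intro el_closed) simp
      have "ex ((1/2) *\<^sub>R x) = el ?y [^] (2^N x :: nat)"
        using ex_eq[of "N x" "(1/2) *\<^sub>R x"] n by (simp add: mult.commute)
      moreover have "ex x = el ?y [^] (2^Suc (N x) :: nat)" by (rule ex_eq[OF n])
      ultimately show ?thesis using nat_pow_mult[OF y, of "2^N x" "2^N x"] by (simp add: mult_2)
    qed
    show "x = y" if "norm x < c1" "norm y < c1" "ex x = ex y" for x y
    proof -
      have "E x = E y" by (rule e_inj) (use that ex_small ER in auto)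
      then show ?thesis by (rule E_inj[OF less_imp_le[OF that(1)] less_imp_le[OF that(2)]])
    qed
    show "\<mu> x 0 = x" if x: "norm x < c1" for x
    proof -
      have "m (E x) (E 0) = E x" using m_zero[OF ER0, of x] x by (simp add: E0)
      then have "\<mu> x 0 = inv_into (ball 0 c1) E (E x)" by (simp add: \<mu>_def)
      also have "\<dots> = x" by (rule inv_into_f_f) (use x E_inj in \<open>auto simp: inj_on_def\<close>)
      finally show ?thesis .
    qed
    show "\<exists>\<delta>>0. \<forall>x\<in>UNIV. \<forall>y\<in>UNIV. norm x < \<delta> \<longrightarrow> norm y < \<delta> \<longrightarrow> \<mu> x y \<in> UNIV \<and> ex x \<otimes> ex y = ex (\<mu> x y)"
    proof (intro exI[of _ \<delta>0] conjI ballI impI UNIV_I)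
      show "0 < \<delta>0" by (rule \<delta>0(1))
      fix x y :: 'e assume xy: "norm x < \<delta>0" "norm y < \<delta>0"
      have n: "norm x < c1" "norm y < c1" using xy \<delta>0(2) by auto
      have "ex x \<otimes> ex y = e (m (E x) (E y))"
        using m_mult[OF ER0 ER0, of x y] n by (simp add: ex_small)
      then show "ex x \<otimes> ex y = ex (\<mu> x y)" using \<mu>[OF xy] ex_small[of "\<mu> x y"] by simp
    qed
    show "\<exists>\<delta>>0. \<forall>x\<in>UNIV. \<forall>y\<in>UNIV. \<forall>x'\<in>UNIV. \<forall>y'\<in>UNIV.
        norm x < \<delta> \<longrightarrow> norm y < \<delta> \<longrightarrow> norm x' < \<delta> \<longrightarrow> norm y' < \<delta> \<longrightarrow>
        norm (\<mu> x y - \<mu> x' y' - (x - x') - (y - y')) \<le> \<epsilon> * (norm (x - x') + norm (y - y'))"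
      if ep: "0 < \<epsilon>" for \<epsilon>
    proof -
      \<comment> \<open>The constant 136 is 8 + 128. The 8 comes from the product expressed through
        \<open>E\<close>. The 128 comes from removing \<open>E\<close> from the product coordinates,
        which have norm at most \<open>8 * \<delta>\<close> and move at most four times as far as
        the arguments: 4 times 8 times 4.\<close>
      define \<delta> where "\<delta> = min (min \<delta>0 (\<epsilon> / (136 * K))) (min (1 / (8 * K)) (c / 8))"
      have \<delta>: "0 < \<delta>" "\<delta> \<le> \<delta>0" "8 * \<delta> \<le> c" using \<delta>0(1) ep K c(1) by (auto simp: \<delta>_def)
      have Kd: "136 * K * \<delta> \<le> \<epsilon>" "8 * K * \<delta> \<le> 1"
      proof -
        have "136 * K * \<delta> \<le> 136 * K * (\<epsilon> / (136 * K))" using K by (intro mult_left_mono) (auto simp: \<delta>_def)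
        then show "136 * K * \<delta> \<le> \<epsilon>" using K by simp
        have "8 * K * \<delta> \<le> 8 * K * (1 / (8 * K))" using K by (intro mult_left_mono) (auto simp: \<delta>_def)
        then show "8 * K * \<delta> \<le> 1" using K by simp
      qed
      have prod: "norm (E (\<mu> x y) - E (\<mu> x' y') - (x - x') - (y - y')) \<le> 8 * K * \<delta> * (norm (x - x') + norm (y - y'))"
        if n: "norm x < \<delta>" "norm y < \<delta>" "norm x' < \<delta>" "norm y' < \<delta>" for x y x' y'
      proof -
        let ?S = "norm (x - x') + norm (y - y')"
        have n1: "norm x \<le> c1" "norm y \<le> c1" "norm x' \<le> c1" "norm y' \<le> c1" using n \<delta>(2) \<delta>0(2) by auto
        have n0: "norm x < \<delta>0" "norm y < \<delta>0" "norm x' < \<delta>0" "norm y' < \<delta>0" using n \<delta>(2) by auto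
        have dR: "2 * \<delta> \<le> R0" using \<delta>(1,3) c(2) by simp
        have dc: "\<delta> \<le> c" using \<delta>(1,3) by simp
        have a: "norm (E (\<mu> x y) - E (\<mu> x' y') - (E x - E x') - (E y - E y')) \<le>
            K * (2 * \<delta>) * (norm (E x - E x') + norm (E y - E y'))"
          unfolding conjunct2[OF \<mu>[OF n0(1,2)]] conjunct2[OF \<mu>[OF n0(3,4)]]
          by (rule m_est[OF dR]) (use En n1 n in force)+
        have "norm (E x - E x') + norm (E y - E y') \<le> 2 * ?S"
          using E_up[OF n1(1,3)] E_up[OF n1(2,4)] by simp
        then have "K * (2 * \<delta>) * (norm (E x - E x') + norm (E y - E y')) \<le> K * (2 * \<delta>) * (2 * ?S)"
          using K \<delta>(1) by (intro mult_left_mono) auto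
        also have "\<dots> = 4 * K * \<delta> * ?S" by (simp add: algebra_simps)
        finally have a': "norm (E (\<mu> x y) - E (\<mu> x' y') - (E x - E x') - (E y - E y')) \<le> 4 * K * \<delta> * ?S"
          by (rule order_trans[OF a])
        have b: "norm (E x - E x' - (x - x')) \<le> 4 * K * \<delta> * norm (x - x')"
          by (rule E_lip[OF dc]) (use n in auto)
        have b': "norm (E y - E y' - (y - y')) \<le> 4 * K * \<delta> * norm (y - y')"
          by (rule E_lip[OF dc]) (use n in auto)
        have eq: "E (\<mu> x y) - E (\<mu> x' y') - (x - x') - (y - y') =
          (E (\<mu> x y) - E (\<mu> x' y') - (E x - E x') - (E y - E y')) + ((E x - E x' - (x - x')) + (E y - E y' - (y - y')))"
          by simp
        have "norm (E (\<mu> x y) - E (\<mu> x' y') - (x - x') - (y - y')) \<le>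
          4 * K * \<delta> * ?S + (4 * K * \<delta> * norm (x - x') + 4 * K * \<delta> * norm (y - y'))"
          unfolding eq by (intro norm_triangle_mono a' b b')
        then show ?thesis by (simp add: algebra_simps)
      qed
      have close: "norm (E (\<mu> x y) - E (\<mu> x' y')) \<le> 2 * (norm (x - x') + norm (y - y'))"
        if n: "norm x < \<delta>" "norm y < \<delta>" "norm x' < \<delta>" "norm y' < \<delta>" for x y x' y'
      proof -
        let ?S = "norm (x - x') + norm (y - y')"
        let ?d = "E (\<mu> x y) - E (\<mu> x' y')"
        have "norm (?d - (x - x') - (y - y')) \<le> 1 * ?S"
          using prod[OF n] mult_right_mono[OF Kd(2), of ?S] by simp
        moreover have "norm ?d \<le> norm (?d - (x - x') - (y - y')) + ?S"
          using norm_triangle_ineq[of "?d - (x - x') - (y - y')" "(x - x') + (y - y')"]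
            norm_triangle_ineq[of "x - x'" "y - y'"] by simp
        ultimately show ?thesis by simp
      qed
      have \<mu>0: "\<mu> 0 0 = 0"
        by (rule E_inj) (use \<mu>[of 0 0] \<delta>0(1) m_zero[of 0] R(1) c1(1) E0 in auto)
      have \<mu>_norm: "norm (\<mu> x y) \<le> 8 * \<delta>" if n: "norm x < \<delta>" "norm y < \<delta>" for x y
      proof -
        have "norm (\<mu> x y) < c1" using \<mu>[of x y] n \<delta>(2) by simp
        then have "norm (\<mu> x y) \<le> 2 * norm (E (\<mu> x y))"
          using E_low[of "\<mu> x y" 0] c1(1) by (simp add: E0)
        moreover have "norm (E (\<mu> x y)) \<le> 2 * (norm x + norm y)"
          using close[of x y 0 0] n \<delta>(1) by (simp add: \<mu>0 E0)
        ultimately show ?thesis using n by simp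
      qed
      have "norm (\<mu> x y - \<mu> x' y' - (x - x') - (y - y')) \<le> \<epsilon> * (norm (x - x') + norm (y - y'))"
        if n: "norm x < \<delta>" "norm y < \<delta>" "norm x' < \<delta>" "norm y' < \<delta>" for x y x' y'
      proof -
        let ?S = "norm (x - x') + norm (y - y')"
        let ?v = "\<mu> x y" and ?w = "\<mu> x' y'"
        have vw: "norm ?v \<le> c1" "norm ?w \<le> c1"
          using \<mu>[of x y] \<mu>[of x' y'] n \<delta>(2) by auto
        have "norm (E ?v - E ?w - (?v - ?w)) \<le> 4 * K * (8 * \<delta>) * norm (?v - ?w)"
          by (rule E_lip[OF \<delta>(3) \<mu>_norm[OF n(1,2)] \<mu>_norm[OF n(3,4)]])
        also have "\<dots> \<le> 4 * K * (8 * \<delta>) * (4 * ?S)"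
          using E_low[OF vw] close[OF n] K \<delta>(1) by (intro mult_left_mono) auto
        also have "\<dots> = 128 * K * \<delta> * ?S" by (simp add: algebra_simps)
        finally have a: "norm (E ?v - E ?w - (?v - ?w)) \<le> 128 * K * \<delta> * ?S" .
        have "?v - ?w - (x - x') - (y - y') = (E ?v - E ?w - (x - x') - (y - y')) - (E ?v - E ?w - (?v - ?w))" by simp
        then have "norm (?v - ?w - (x - x') - (y - y')) \<le>
            norm (E ?v - E ?w - (x - x') - (y - y')) + norm (E ?v - E ?w - (?v - ?w))"
          by (metis norm_triangle_ineq4)
        also have "\<dots> \<le> 8 * K * \<delta> * ?S + 128 * K * \<delta> * ?S" by (rule add_mono[OF prod[OF n] a])
        also have "\<dots> = (136 * K * \<delta>) * ?S" by (simp add: algebra_simps)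
        also have "\<dots> \<le> \<epsilon> * ?S" by (rule mult_right_mono[OF Kd(1)]) simp
        finally show ?thesis .
      qed
      then show ?thesis using \<delta>(1) by blast
    qed
  qed
  have B: "\<exists>\<delta>>0. \<forall>x. norm x < \<delta> \<longrightarrow> (\<exists>y. norm y < \<epsilon> \<and> e x = ex y)" if ep: "0 < \<epsilon>" for \<epsilon>
  proof -
    obtain \<delta> where \<delta>: "\<delta> > 0" "ball 0 \<delta> \<subseteq> E ` ball 0 (min \<epsilon> c1)"
      using E_open[of "min \<epsilon> c1"] ep c1(1) by auto
    have "\<exists>y. norm y < \<epsilon> \<and> e x = ex y" if "norm x < \<delta>" for x
    proof -
      have "x \<in> E ` ball 0 (min \<epsilon> c1)" using subsetD[OF \<delta>(2), of x] that by simp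
      then obtain y where "norm y < \<epsilon>" "norm y < c1" "x = E y" by auto
      then show ?thesis using ex_small[of y] by auto
    qed
    then show ?thesis using \<delta>(1) by blast
  qed
  have C: "\<exists>\<delta>>0. \<forall>x. norm x < \<delta> \<longrightarrow> (\<exists>y. norm y < \<epsilon> \<and> ex x = e y)" if ep: "0 < \<epsilon>" for \<epsilon>
  proof (intro exI[of _ "min c1 (\<epsilon> / 2)"] conjI allI impI)
    show "0 < min c1 (\<epsilon> / 2)" using c1(1) ep by simp
    fix x :: 'e assume x: "norm x < min c1 (\<epsilon> / 2)"
    then have "norm (E x) < \<epsilon>" using En[of x] by simp
    then show "\<exists>y. norm y < \<epsilon> \<and> ex x = e y" using ex_small[of x] x by auto
  qed
  from B have B: "\<forall>\<epsilon>>0. \<exists>\<delta>>0. \<forall>x. norm x < \<delta> \<longrightarrow> (\<exists>y. norm y < \<epsilon> \<and> e x = ex y)" by (rule allI[OF impI])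
  from C have C: "\<forall>\<epsilon>>0. \<exists>\<delta>>0. \<forall>x. norm x < \<delta> \<longrightarrow> (\<exists>y. norm y < \<epsilon> \<and> ex x = e y)" by (rule allI[OF impI])
  show ?thesis by (rule exI, rule exI, rule exI, rule conjI[OF A conjI[OF B C]])
qed

end

text \<open>Only differentiability of the first derivatives at the single point \<open>p\<close> is used.\<close>

lemma smooth_strict_estimate:
  fixes M :: "'v::euclidean_space \<Rightarrow> 'w::euclidean_space"
  assumes smooth: "smooth_on S M" and r: "0 < r" "ball p r \<subseteq> S"
  shows "\<exists>C \<rho>0. 0 < C \<and> 0 < \<rho>0 \<and> (\<forall>\<rho>\<le>\<rho>0. \<forall>z\<in>cball p \<rho>. \<forall>z'\<in>cball p \<rho>.
    norm (M z - M z' - frechet_derivative M (at p) (z - z')) \<le> C * \<rho> * norm (z - z'))"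
proof -
  define D where "D z = frechet_derivative M (at z)" for z
  have diff0: "M differentiable (at z)" if "z \<in> S" for z
    using smooth that unfolding smooth_on_def by (metis higher_deriv.simps(1))
  have diff1: "(\<lambda>z. D z v) differentiable (at z)" if "z \<in> S" for z v
  proof -
    have "higher_deriv [v] M differentiable (at z)" using smooth that unfolding smooth_on_def by blast
    then show ?thesis by (simp add: D_def)
  qed
  have pS: "p \<in> S" using r by auto
  have D: "(M has_derivative D z) (at z)" if "z \<in> S" for z
    using diff0[OF that] unfolding D_def by (simp add: frechet_derivative_works)
  have linD: "linear (D z)" if "z \<in> S" for z
    using D[OF that] by (rule has_derivative_linear)
  have "\<exists>C \<delta>. 0 < C \<and> 0 < \<delta> \<and> (\<forall>z. norm (z - p) < \<delta> \<longrightarrow> norm (D z v - D p v) \<le> C * norm (z - p))" for v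
  proof -
    obtain g where g: "((\<lambda>z. D z v) has_derivative g) (at p)"
      using diff1[OF pS, of v] by (auto simp: differentiable_def)
    have lin: "linear g" using g by (rule has_derivative_linear)
    obtain B where B: "B > 0" "\<And>x. norm (g x) \<le> B * norm x" using linear_bounded_pos[OF lin] by metis
    obtain \<delta> where \<delta>: "\<delta> > 0"
      "\<forall>z. norm (z - p) < \<delta> \<longrightarrow> norm (D z v - D p v - g (z - p)) \<le> 1 * norm (z - p)"
      using conjunct2[OF g[unfolded has_derivative_at_alt], rule_format, of 1] by auto
    have "norm (D z v - D p v) \<le> (1 + B) * norm (z - p)" if z: "norm (z - p) < \<delta>" for z
    proof -
      have "norm (D z v - D p v) \<le> norm (D z v - D p v - g (z - p)) + norm (g (z - p))"
        using norm_triangle_ineq[of "D z v - D p v - g (z - p)" "g (z - p)"] by simp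
      also have "\<dots> \<le> 1 * norm (z - p) + B * norm (z - p)"
        using \<delta>(2) z B(2) by (intro add_mono) auto
      finally show ?thesis by (simp only: distrib_right)
    qed
    then show ?thesis using \<delta>(1) B(1) by (intro exI[of _ "1 + B"] exI[of _ \<delta>]) auto
  qed
  then obtain C \<delta> where C: "\<And>v. 0 < C v" "\<And>v. 0 < \<delta> v"
    "\<And>v z. norm (z - p) < \<delta> v \<Longrightarrow> norm (D z v - D p v) \<le> C v * norm (z - p)" by metis
  \<comment> \<open>The second derivatives control one direction at a time; expanding in the basis
    makes the bound uniform over all directions.\<close>
  define K where "K = (\<Sum>b\<in>Basis. C b)"
  have K: "0 < K" unfolding K_def by (intro sum_pos) (auto simp: C)
  define \<rho>0 where "\<rho>0 = min (r / 2) (Min (\<delta> ` Basis) / 2)"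
  have mpos: "0 < Min (\<delta> ` (Basis :: 'v set))" using C(2) by (simp add: Min_gr_iff)
  have \<rho>0: "0 < \<rho>0" "\<rho>0 < r" using r(1) mpos by (auto simp: \<rho>0_def)
  have \<rho>0b: "\<rho>0 < \<delta> b" if "b \<in> Basis" for b
  proof -
    have "Min (\<delta> ` Basis) \<le> \<delta> b" by (rule Min_le) (use that in auto)
    then show ?thesis using mpos unfolding \<rho>0_def by linarith
  qed
  have near: "norm (D z h - D p h) \<le> K * norm (z - p) * norm h" if z: "norm (z - p) \<le> \<rho>0" for z h
  proof -
    have zS: "z \<in> S" using z \<rho>0(2) r(2) by (auto simp: dist_norm norm_minus_commute subset_iff)
    have l: "linear (\<lambda>h. D z h - D p h)" by (rule linear_compose_sub[OF linD[OF zS] linD[OF pS]])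
    have "D z h - D p h = (\<lambda>h. D z h - D p h) (\<Sum>b\<in>Basis. (h \<bullet> b) *\<^sub>R b)"
      by (simp add: euclidean_representation)
    also have "\<dots> = (\<Sum>b\<in>Basis. (h \<bullet> b) *\<^sub>R (D z b - D p b))"
      by (simp only: linear_sum[OF l] linear_scale[OF l])
    finally have "norm (D z h - D p h) = norm (\<Sum>b\<in>Basis. (h \<bullet> b) *\<^sub>R (D z b - D p b))" by simp
    also have "\<dots> \<le> (\<Sum>b\<in>Basis. norm h * (C b * norm (z - p)))"
    proof (rule sum_norm_le)
      fix b :: 'v assume b: "b \<in> Basis"
      have "norm ((h \<bullet> b) *\<^sub>R (D z b - D p b)) = \<bar>h \<bullet> b\<bar> * norm (D z b - D p b)" by simp
      also have "\<dots> \<le> norm h * (C b * norm (z - p))"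
        using Basis_le_norm[OF b, of h] C(3)[of z b] z \<rho>0b[OF b] by (intro mult_mono) auto
      finally show "norm ((h \<bullet> b) *\<^sub>R (D z b - D p b)) \<le> norm h * (C b * norm (z - p))" .
    qed
    also have "\<dots> = K * norm (z - p) * norm h"
      by (simp add: K_def sum_distrib_left sum_distrib_right mult.commute mult.left_commute)
    finally show ?thesis .
  qed
  show ?thesis unfolding D_def[symmetric]
  proof (rule exI[of _ K], rule exI[of _ \<rho>0], intro conjI allI impI ballI K \<rho>0(1))
    fix \<rho> z z' assume \<rho>: "\<rho> \<le> \<rho>0" and z: "z \<in> cball p \<rho>" "z' \<in> cball p \<rho>"
    have sub: "x \<in> S" "norm (x - p) \<le> \<rho>0" "norm (x - p) \<le> \<rho>" if "x \<in> cball p \<rho>" for x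
      using that \<rho> \<rho>0(2) r(2) by (auto simp: dist_norm norm_minus_commute subset_iff)
    \<comment> \<open>The mean value inequality for \<open>M\<close> minus its linear part at
      \<open>p\<close>, whose derivative on the ball has norm at most
      \<open>K * \<rho>\<close>.\<close>
    have "norm ((M z - D p z) - (M z' - D p z')) \<le> K * \<rho> * norm (z - z')"
    proof (rule differentiable_bound[where f = "\<lambda>x. M x - D p x" and f' = "\<lambda>x h. D x h - D p h"])
      show "convex (cball p \<rho>)" by (rule convex_cball)
      fix x assume x: "x \<in> cball p \<rho>"
      show "((\<lambda>x. M x - D p x) has_derivative (\<lambda>h. D x h - D p h)) (at x within cball p \<rho>)"
        by (intro has_derivative_diff has_derivative_at_withinI[OF D[OF sub(1)[OF x]]]
            linear_imp_has_derivative[OF linD[OF pS]])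
      show "onorm (\<lambda>h. D x h - D p h) \<le> K * \<rho>"
      proof (rule onorm_bound)
        have "0 \<le> \<rho>" using sub(3)[OF x] norm_ge_zero order_trans by blast
        then show "0 \<le> K * \<rho>" using K by simp
        fix h
        have "norm (D x h - D p h) \<le> K * norm (x - p) * norm h" by (rule near[OF sub(2)[OF x]])
        also have "\<dots> \<le> K * \<rho> * norm h" using sub(3)[OF x] K by (intro mult_right_mono mult_left_mono) auto
        finally show "norm (D x h - D p h) \<le> K * \<rho> * norm h" .
      qed
    qed (rule z)+
    then show "norm (M z - M z' - D p (z - z')) \<le> K * \<rho> * norm (z - z')"
      by (simp add: linear_diff[OF linD[OF pS]] algebra_simps)
  qed
qed

section \<open>Charts at the identity\<close>

text \<open>A single chart around the identity serves for both factors and for the product.\<close>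

locale chart_group = group G for G (structure) +
  fixes T :: "'a topology" and c :: "'a \<Rightarrow> 'e::euclidean_space" and U :: "'a set"
  assumes tg: "topological_group G T" and chart: "is_chart T c U" and one_U: "\<one> \<in> U"
    and smooth: "smooth_on {(z1, z2). z1 \<in> c ` U \<and> z2 \<in> c ` U \<and> inv_into U c z1 \<otimes> inv_into U c z2 \<in> U}
          (\<lambda>(z1, z2). c (inv_into U c z1 \<otimes> inv_into U c z2))"
begin

definition a :: 'e where "a = c \<one>"
definition e :: "'e \<Rightarrow> 'a" where "e x = inv_into U c (a + x)"

lemma topspace: "topspace T = carrier G" using tg by (simp add: topological_group_def)
lemma open_U: "openin T U" using chart by (simp add: is_chart_def)
lemma U_carrier: "U \<subseteq> carrier G" using openin_subset[OF open_U] topspace by simp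
lemma open_cU: "open (c ` U)" using chart by (simp add: is_chart_def)
lemma homeo: "homeomorphic_map (subtopology T U) (subtopology euclidean (c ` U)) c"
  using chart by (simp add: is_chart_def)
lemma U_top: "topspace (subtopology T U) = U" using openin_subset[OF open_U] by (simp add: Int_absorb1)

lemma inj_c: "inj_on c U"
  using homeomorphic_imp_injective_map[OF homeo] unfolding U_top .

lemma c_e: "a + x \<in> c ` U \<Longrightarrow> e x \<in> U \<and> c (e x) = a + x"
  unfolding e_def by (simp add: inv_into_into f_inv_into_f)

lemma e_c: "y \<in> U \<Longrightarrow> e (c y - a) = y"
  unfolding e_def using inj_c by simp

lemma e_zero: "e 0 = \<one>"
  using e_c[OF one_U] by (simp add: a_def)

text \<open>Together with \<open>nbhd_exists\<close> this translates between neighbourhoods of the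
  identity in \<open>T\<close> and balls around the origin.\<close>

lemma nbhd_pullback:
  assumes "openin T S" "\<one> \<in> S"
  shows "\<exists>\<delta>>0. \<forall>x. norm x < \<delta> \<longrightarrow> a + x \<in> c ` U \<and> e x \<in> S"
proof -
  have "openin (subtopology T U) (S \<inter> U)" using assms(1) by (rule openin_subtopology_Int)
  then have "openin (subtopology euclidean (c ` U)) (c ` (S \<inter> U))"
    using homeomorphic_imp_open_map[OF homeo] unfolding open_map_def by blast
  then have "open (c ` (S \<inter> U))" using open_cU by (simp add: openin_open_eq)
  moreover have "a \<in> c ` (S \<inter> U)" using assms(2) one_U by (auto simp: a_def)
  ultimately obtain \<delta> where \<delta>: "\<delta> > 0" "ball a \<delta> \<subseteq> c ` (S \<inter> U)"
    unfolding open_contains_ball by blast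
  have "a + x \<in> c ` U \<and> e x \<in> S" if "norm x < \<delta>" for x
  proof -
    have "a + x \<in> c ` (S \<inter> U)" using subsetD[OF \<delta>(2), of "a + x"] that by (simp add: dist_norm)
    then obtain y where y: "y \<in> S" "y \<in> U" "a + x = c y" by auto
    have "x = c y - a" using y(3) by (simp add: algebra_simps)
    then have "e x = y" using e_c[OF y(2)] by simp
    then show ?thesis using y by auto
  qed
  then show ?thesis using \<delta>(1) by blast
qed

lemma nbhd_exists:
  assumes "0 < \<epsilon>"
  shows "\<exists>S. openin T S \<and> \<one> \<in> S \<and> S \<subseteq> U \<and> (\<forall>y\<in>S. \<exists>x. norm x < \<epsilon> \<and> y = e x \<and> x = c y - a)"
proof -
  define S where "S = {y \<in> topspace (subtopology T U). c y \<in> c ` U \<inter> ball a \<epsilon>}"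
  have "openin (subtopology euclidean (c ` U)) (c ` U \<inter> ball a \<epsilon>)"
    by (rule openin_open_Int) (rule open_ball)
  then have "openin (subtopology T U) S" unfolding S_def
    by (rule openin_continuous_map_preimage[OF homeomorphic_imp_continuous_map[OF homeo]])
  then have "openin T S" using openin_open_subtopology[OF open_U] by blast
  moreover have "\<one> \<in> S" using one_U assms unfolding S_def U_top by (simp add: a_def)
  moreover have "S \<subseteq> U" unfolding S_def U_top by blast
  moreover have "\<exists>x. norm x < \<epsilon> \<and> y = e x \<and> x = c y - a" if "y \<in> S" for y
  proof (intro exI[of _ "c y - a"] conjI refl)
    have y: "y \<in> U" "c y \<in> ball a \<epsilon>" using that unfolding S_def U_top by blast+
    show "norm (c y - a) < \<epsilon>" using y(2) by (simp add: dist_norm norm_minus_commute)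
    show "y = e (c y - a)" using e_c[OF y(1)] by simp
  qed
  ultimately show ?thesis by blast
qed

lemma continuous_small:
  assumes f: "continuous_map T T f" "f \<one> = \<one>" and ep: "0 < \<epsilon>"
  shows "\<exists>\<delta>>0. \<forall>x. norm x < \<delta> \<longrightarrow> (\<exists>y. norm y < \<epsilon> \<and> f (e x) = e y)"
proof -
  obtain S where S: "openin T S" "\<one> \<in> S" "\<forall>y\<in>S. \<exists>x. norm x < \<epsilon> \<and> y = e x \<and> x = c y - a"
    using nbhd_exists[OF ep] by blast
  have "openin T {x \<in> topspace T. f x \<in> S}" by (rule openin_continuous_map_preimage[OF f(1) S(1)])
  moreover have "\<one> \<in> {x \<in> topspace T. f x \<in> S}" using S(2) f(2) by (simp add: topspace)
  ultimately obtain \<delta> where \<delta>: "\<delta> > 0" "\<forall>x. norm x < \<delta> \<longrightarrow> a + x \<in> c ` U \<and> e x \<in> {x \<in> topspace T. f x \<in> S}"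
    using nbhd_pullback by blast
  have "\<exists>y. norm y < \<epsilon> \<and> f (e x) = e y" if "norm x < \<delta>" for x
  proof -
    have "f (e x) \<in> S" using \<delta>(2) that by blast
    then show ?thesis using S(3) by blast
  qed
  then show ?thesis using \<delta>(1) by blast
qed

lemma continuous_mult: "continuous_map (prod_topology T T) T (\<lambda>(x, y). x \<otimes> y)"
  using tg by (simp add: topological_group_def)

lemma continuous_mult_fun:
  assumes "continuous_map T T f" "continuous_map T T g"
  shows "continuous_map T T (\<lambda>x. f x \<otimes> g x)"
proof -
  have "continuous_map T (prod_topology T T) (\<lambda>x. (f x, g x))"
    by (rule continuous_map_pairedI[OF assms])
  then have "continuous_map T T ((\<lambda>(x, y). x \<otimes> y) \<circ> (\<lambda>x. (f x, g x)))"
    by (rule continuous_map_compose[OF _ continuous_mult])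
  then show ?thesis by (simp add: o_def)
qed

lemma continuous_translation: "g \<in> carrier G \<Longrightarrow> continuous_map T T (\<lambda>x. g \<otimes> x)"
  using continuous_mult_fun[of "\<lambda>_. g" "\<lambda>x. x"] topspace by simp

lemma continuous_conj: "g \<in> carrier G \<Longrightarrow> continuous_map T T (\<lambda>x. g \<otimes> x \<otimes> inv g)"
  using continuous_mult_fun[OF continuous_translation, of g "\<lambda>_. inv g"] topspace by simp

text \<open>Because the identity is neutral, the product in coordinates is the identity map along
  each axis. So its derivative at the centre is addition, and the strict estimate for a smooth map
  becomes \<open>m_est\<close>.\<close>

lemma local_group_exists: "\<exists>m R R0 K. local_group G e m R R0 K"
proof -
  obtain R where R: "R > 0" "\<forall>x. norm x < R \<longrightarrow> a + x \<in> c ` U \<and> e x \<in> U"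
    using nbhd_pullback[OF open_U one_U] by blast
  obtain S where S: "openin T S" "\<one> \<in> S" "S \<subseteq> U" "\<forall>y\<in>S. \<exists>x. norm x < R \<and> y = e x \<and> x = c y - a"
    using nbhd_exists[OF R(1)] by blast
  have "openin (prod_topology T T) {z \<in> topspace (prod_topology T T). (\<lambda>(x, y). x \<otimes> y) z \<in> S}"
    by (rule openin_continuous_map_preimage[OF continuous_mult S(1)])
  moreover have "(\<one>, \<one>) \<in> {z \<in> topspace (prod_topology T T). (\<lambda>(x, y). x \<otimes> y) z \<in> S}"
    using S(2) by (simp add: topspace)
  ultimately have "\<exists>S1 S2. openin T S1 \<and> openin T S2 \<and> \<one> \<in> S1 \<and> \<one> \<in> S2 \<and>
      S1 \<times> S2 \<subseteq> {z \<in> topspace (prod_topology T T). (\<lambda>(x, y). x \<otimes> y) z \<in> S}"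
    by (rule iffD1[OF openin_prod_topology_alt, rule_format])
  then obtain S1 S2 where S12: "openin T S1" "openin T S2" "\<one> \<in> S1" "\<one> \<in> S2"
    "S1 \<times> S2 \<subseteq> {z \<in> topspace (prod_topology T T). (\<lambda>(x, y). x \<otimes> y) z \<in> S}"
    by (elim exE conjE)
  obtain d1 where d1: "d1 > 0" "\<forall>x. norm x < d1 \<longrightarrow> a + x \<in> c ` U \<and> e x \<in> S1"
    using nbhd_pullback[OF S12(1,3)] by blast
  obtain d2 where d2: "d2 > 0" "\<forall>x. norm x < d2 \<longrightarrow> a + x \<in> c ` U \<and> e x \<in> S2"
    using nbhd_pullback[OF S12(2,4)] by blast
  define d where "d = min d1 d2"
  have d: "d > 0" using d1(1) d2(1) by (simp add: d_def)
  have dS: "e x \<otimes> e y \<in> S" if "norm x < d" "norm y < d" for x y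
  proof -
    have "(e x, e y) \<in> S1 \<times> S2" using d1(2) d2(2) that by (simp add: d_def)
    from subsetD[OF S12(5) this] show ?thesis by simp
  qed
  have dU: "a + x \<in> c ` U" if "norm x < d" for x using d1(2) that by (simp add: d_def)
  define M where "M = (\<lambda>(z1, z2). c (inv_into U c z1 \<otimes> inv_into U c z2))"
  define D where "D = {(z1, z2). z1 \<in> c ` U \<and> z2 \<in> c ` U \<and> inv_into U c z1 \<otimes> inv_into U c z2 \<in> U}"
  have Me: "M (a + x, a + y) = c (e x \<otimes> e y)" for x y by (simp add: M_def e_def)
  have "ball (a, a) d \<subseteq> D"
  proof
    fix z assume z: "z \<in> ball (a, a) d"
    define x where "x = fst z - a"
    define y where "y = snd z - a"
    have zxy: "z = (a + x, a + y)" by (simp add: x_def y_def)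
    have "norm (x, y) < d" using z unfolding zxy by (simp add: dist_norm norm_Pair)
    then have n: "norm x < d" "norm y < d"
      using norm_fst_le[of x y] norm_snd_le[of y x] by auto
    show "z \<in> D" unfolding zxy D_def using dU[OF n(1)] dU[OF n(2)] dS[OF n] S(3) by (auto simp: e_def)
  qed
  from smooth_strict_estimate[OF smooth[folded M_def D_def] d this]
  obtain C \<rho>0 where C: "0 < C" "0 < \<rho>0" and est': "\<forall>\<rho>\<le>\<rho>0. \<forall>z\<in>cball (a, a) \<rho>. \<forall>z'\<in>cball (a, a) \<rho>.
    norm (M z - M z' - frechet_derivative M (at (a, a)) (z - z')) \<le> C * \<rho> * norm (z - z')"
    by (elim exE conjE)
  define L where "L = frechet_derivative M (at (a, a))"
  have linL: "linear L"
  proof -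
    have "(a, a) \<in> D" using \<open>ball (a, a) d \<subseteq> D\<close> d by auto
    then have "M differentiable (at (a, a))"
      using smooth[folded M_def D_def] unfolding smooth_on_def by (metis higher_deriv.simps(1))
    then have "(M has_derivative L) (at (a, a))" unfolding L_def by (simp add: frechet_derivative_works)
    then show ?thesis by (rule has_derivative_linear)
  qed
  have est: "norm (M (a + x, a + y) - M (a + x', a + y') - L (x - x', y - y')) \<le>
      2 * C * \<rho> * (norm (x - x') + norm (y - y'))"
    if \<rho>: "2 * \<rho> \<le> \<rho>0" and n: "norm x \<le> \<rho>" "norm y \<le> \<rho>" "norm x' \<le> \<rho>" "norm y' \<le> \<rho>" for \<rho> x y x' y'
  proof -
    \<comment> \<open>The radius doubles because the norm of a pair is bounded by the sum of the
      norms of its components.\<close>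
    have cb: "(a + u, a + v) \<in> cball (a, a) (2 * \<rho>)" if "norm u \<le> \<rho>" "norm v \<le> \<rho>" for u v
    proof -
      have "dist (a, a) (a + u, a + v) = norm (u, v)" by (simp add: dist_Pair_Pair norm_Pair dist_norm)
      also have "\<dots> \<le> norm u + norm v" by (rule norm_Pair_le)
      finally show ?thesis using that by simp
    qed
    have "norm (M (a + x, a + y) - M (a + x', a + y') - L ((a + x, a + y) - (a + x', a + y'))) \<le>
        C * (2 * \<rho>) * norm ((a + x, a + y) - (a + x', a + y'))"
      using est'[rule_format, OF \<rho> cb[OF n(1,2)] cb[OF n(3,4)]] by (simp only: L_def)
    also have "(a + x, a + y) - (a + x', a + y') = (x - x', y - y')" by simp
    also have "C * (2 * \<rho>) * norm (x - x', y - y') \<le> C * (2 * \<rho>) * (norm (x - x') + norm (y - y'))"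
    proof (rule mult_left_mono[OF norm_Pair_le])
      have "0 \<le> \<rho>" using n(1) norm_ge_zero order_trans by blast
      then show "0 \<le> C * (2 * \<rho>)" using C(1) by simp
    qed
    finally show ?thesis by simp
  qed
  have ec: "e x \<in> carrier G" if "norm x < d" for x
    using c_e[OF dU[OF that]] U_carrier by blast
  have M_left: "M (a + x, a + 0) = a + x" if "norm x < d" for x
    unfolding Me using ec[OF that] c_e[OF dU[OF that]] by (simp add: e_zero)
  have M_right: "M (a + 0, a + x) = a + x" if "norm x < d" for x
    unfolding Me using ec[OF that] c_e[OF dU[OF that]] by (simp add: e_zero)
  have scale: "\<exists>t>0. t \<le> \<epsilon> \<and> t * norm h < d \<and> 2 * (t * norm h) \<le> \<rho>0" if ep: "0 < \<epsilon>" for \<epsilon> and h :: 'e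
  proof -
    have "\<forall>\<^sub>F k in sequentially. (1/2)^k * 1 < \<epsilon> \<and> (1/2)^k * norm h < d \<and> (1/2)^k * (2 * norm h) < \<rho>0"
      using ep d C(2) by (intro eventually_conj eventually_half_power_less)
    then obtain k where "(1/2)^k * 1 < \<epsilon>" "(1/2)^k * norm h < d" "(1/2)^k * (2 * norm h) < \<rho>0"
      by (auto simp: eventually_sequentially)
    then show ?thesis by (intro exI[of _ "(1/2)^k"]) auto
  qed
  \<comment> \<open>The deviation is quadratic in \<open>t\<close> while both sides are linear in
    \<open>t\<close>; dividing by a small \<open>t\<close> identifies the derivative.\<close>
  have L_eq: "L v = h" if L: "\<And>t. \<lbrakk>0 < t; t * norm h < d; 2 * (t * norm h) \<le> \<rho>0\<rbrakk> \<Longrightarrow>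
      norm (t *\<^sub>R h - t *\<^sub>R L v) \<le> 2 * C * (t * norm h) * (t * norm h)" for v h
  proof -
    have "norm (h - L v) \<le> \<epsilon> * (2 * C * norm h * norm h)" if ep: "0 < \<epsilon>" for \<epsilon>
    proof -
      obtain t where t: "t > 0" "t \<le> \<epsilon>" "t * norm h < d" "2 * (t * norm h) \<le> \<rho>0" using scale[OF ep] by blast
      have "t * norm (h - L v) = norm (t *\<^sub>R h - t *\<^sub>R L v)"
        using t(1) by (simp flip: scaleR_diff_right)
      also have "\<dots> \<le> 2 * C * (t * norm h) * (t * norm h)" by (rule L[OF t(1,3,4)])
      also have "\<dots> = t * (t * (2 * C * norm h * norm h))" by simp
      finally have "norm (h - L v) \<le> t * (2 * C * norm h * norm h)" using t(1) by (rule mult_left_le_imp_le)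
      also have "\<dots> \<le> \<epsilon> * (2 * C * norm h * norm h)" using t(2) C(1) by (intro mult_right_mono) auto
      finally show ?thesis .
    qed
    then have "norm (h - L v) \<le> 0" by (rule le_zero_if_small_multiples)
    then show ?thesis by simp
  qed
  have L1: "L (h, 0) = h" for h
  proof (rule L_eq)
    fix t :: real assume t: "0 < t" "t * norm h < d" "2 * (t * norm h) \<le> \<rho>0"
    have "norm (M (a + t *\<^sub>R h, a + 0) - M (a + 0, a + 0) - L (t *\<^sub>R h - 0, 0 - 0)) \<le>
        2 * C * (t * norm h) * (norm (t *\<^sub>R h - 0) + norm (0 - 0 :: 'e))"
      by (rule est[OF t(3)]) (use t(1) in auto)
    moreover have "L (t *\<^sub>R h, 0) = t *\<^sub>R L (h, 0)" using linear_scale[OF linL, of t "(h, 0)"] by simp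
    ultimately show "norm (t *\<^sub>R h - t *\<^sub>R L (h, 0)) \<le> 2 * C * (t * norm h) * (t * norm h)"
      using M_left[of "t *\<^sub>R h"] M_left[of 0] t(1,2) d by simp
  qed
  have L2: "L (0, h) = h" for h
  proof (rule L_eq)
    fix t :: real assume t: "0 < t" "t * norm h < d" "2 * (t * norm h) \<le> \<rho>0"
    have "norm (M (a + 0, a + t *\<^sub>R h) - M (a + 0, a + 0) - L (0 - 0, t *\<^sub>R h - 0)) \<le>
        2 * C * (t * norm h) * (norm (0 - 0 :: 'e) + norm (t *\<^sub>R h - 0))"
      by (rule est[OF t(3)]) (use t(1) in auto)
    moreover have "L (0, t *\<^sub>R h) = t *\<^sub>R L (0, h)" using linear_scale[OF linL, of t "(0, h)"] by simp
    ultimately show "norm (t *\<^sub>R h - t *\<^sub>R L (0, h)) \<le> 2 * C * (t * norm h) * (t * norm h)"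
      using M_right[of "t *\<^sub>R h"] M_right[of 0] t(1,2) d by simp
  qed
  have L: "L (h, k) = h + k" for h k
    using linear_add[OF linL, of "(h, 0)" "(0, k)"] L1[of h] L2[of k] by simp
  define m where "m x y = c (e x \<otimes> e y) - a" for x y
  define R0 where "R0 = min (d / 2) (min (R / 2) (\<rho>0 / 2))"
  have "local_group G e m R R0 (2 * C)"
  proof (intro local_group.intro local_group_axioms.intro)
    show "group G" by (rule is_group)
    show "0 < R0" "R0 < R" "0 < 2 * C" using d R(1) C by (auto simp: R0_def)
    show "e x \<in> carrier G" if "norm x < R" for x using R(2) that U_carrier by blast
    show "e 0 = \<one>" by (rule e_zero)
    show "x = y" if "norm x < R" "norm y < R" "e x = e y" for x y
    proof -
      have cx: "c (e x) = a + x" using c_e[of x] R(2) that(1) by simp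
      have cy: "c (e y) = a + y" using c_e[of y] R(2) that(2) by simp
      show ?thesis by (rule add_left_imp_eq[OF cx[unfolded that(3), unfolded cy, symmetric]])
    qed
    show "norm (m x y) < R \<and> e x \<otimes> e y = e (m x y)" if "norm x \<le> R0" "norm y \<le> R0" for x y
    proof -
      have "norm x < d" "norm y < d" using that d by (auto simp: R0_def)
      then have "e x \<otimes> e y \<in> S" by (rule dS)
      from bspec[OF S(4) this] obtain z where z: "norm z < R" "e x \<otimes> e y = e z" "z = c (e x \<otimes> e y) - a"
        by (elim exE conjE)
      have "m x y = z" unfolding m_def by (rule z(3)[symmetric])
      with z(1,2) show ?thesis by (simp only:)
    qed
    show "norm (m x y - m x' y' - (x - x') - (y - y')) \<le> 2 * C * \<rho> * (norm (x - x') + norm (y - y'))"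
      if \<rho>: "\<rho> \<le> R0" and n: "norm x \<le> \<rho>" "norm y \<le> \<rho>" "norm x' \<le> \<rho>" "norm y' \<le> \<rho>" for \<rho> x y x' y'
    proof -
      have "2 * \<rho> \<le> \<rho>0" using \<rho> by (auto simp: R0_def)
      moreover have "m x y - m x' y' - (x - x') - (y - y') =
          M (a + x, a + y) - M (a + x', a + y') - L (x - x', y - y')"
        unfolding Me L m_def by (simp add: algebra_simps)
      ultimately show ?thesis using est[OF _ n] by (simp only:)
    qed
  qed
  then show ?thesis by blast
qed

text \<open>Continuity is transferred from \<open>e\<close> to \<open>ex\<close> by passing from
  \<open>ex\<close> to \<open>e\<close>, through the continuous map, and back. This serves
  inversion, conjugation and \<phi> alike.\<close>

lemma exp_group_exists:
  assumes cg: "compactly_generated G T"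
  shows "\<exists>ex \<mu> r0. exp_group G (UNIV :: 'e set) ex \<mu> r0 \<and>
    (\<forall>\<phi>. continuous_map T T \<phi> \<longrightarrow> \<phi> \<one> = \<one> \<longrightarrow> exp_group.small_cts (UNIV :: 'e set) ex \<phi>)"
proof -
  obtain m R R0 K where "local_group G e m R R0 K" using local_group_exists by blast
  then interpret L: local_group G e m R R0 K .
  obtain ex \<mu> r0 where dy: "dyadic_exp G (UNIV :: 'e set) ex \<mu> r0"
    and e_ex: "\<forall>\<epsilon>>0. \<exists>\<delta>>0. \<forall>x. norm x < \<delta> \<longrightarrow> (\<exists>y. norm y < \<epsilon> \<and> e x = ex y)"
    and ex_e: "\<forall>\<epsilon>>0. \<exists>\<delta>>0. \<forall>x. norm x < \<delta> \<longrightarrow> (\<exists>y. norm y < \<epsilon> \<and> ex x = e y)"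
    using L.dyadic_exp_exists by (elim exE conjE)
  interpret dyadic_exp G "UNIV :: 'e set" ex \<mu> r0 by (rule dy)
  have small: "\<exists>\<delta>>0. \<forall>x\<in>UNIV. norm x < \<delta> \<longrightarrow> (\<exists>y\<in>UNIV. norm y < \<epsilon> \<and> f (ex x) = ex y)"
    if f: "continuous_map T T f" "f \<one> = \<one>" and ep: "0 < \<epsilon>" for f \<epsilon>
  proof -
    obtain d1 where d1: "d1 > 0" "\<forall>x. norm x < d1 \<longrightarrow> (\<exists>y. norm y < \<epsilon> \<and> e x = ex y)"
      using e_ex ep by blast
    obtain d2 where d2: "d2 > 0" "\<forall>x. norm x < d2 \<longrightarrow> (\<exists>y. norm y < d1 \<and> f (e x) = e y)"
      using continuous_small[OF f d1(1)] by blast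
    obtain d3 where d3: "d3 > 0" "\<forall>x. norm x < d3 \<longrightarrow> (\<exists>y. norm y < d2 \<and> ex x = e y)"
      using ex_e d2(1) by blast
    have "\<exists>y. norm y < \<epsilon> \<and> f (ex x) = ex y" if x: "norm x < d3" for x
    proof -
      obtain u where u: "norm u < d2" "ex x = e u" using d3(2) x by blast
      obtain v where v: "norm v < d1" "f (e u) = e v" using d2(2) u(1) by blast
      obtain w where "norm w < \<epsilon>" "e v = ex w" using d1(2) v(1) by blast
      then show ?thesis using u(2) v(2) by (intro exI[of _ w]) simp
    qed
    then show ?thesis using d3(1) by blast
  qed
  have "continuous_map T T (\<lambda>x. inv x)" using tg by (simp add: topological_group_def)
  from small[OF this inv_one half_gt_zero[OF r0]]
  have neg: "ex (- x) = inv (ex x)" for x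
    by (rule ex_uminus) simp
  obtain S where "openin T S" "\<one> \<in> S" "S \<subseteq> range ex"
  proof -
    obtain \<delta> where \<delta>: "\<delta> > 0" "\<forall>x. norm x < \<delta> \<longrightarrow> (\<exists>y. norm y < 1 \<and> e x = ex y)"
      using e_ex zero_less_one by blast
    obtain S where S: "openin T S" "\<one> \<in> S" "\<forall>y\<in>S. \<exists>x. norm x < \<delta> \<and> y = e x \<and> x = c y - a"
      using nbhd_exists[OF \<delta>(1)] by blast
    have "S \<subseteq> range ex"
    proof
      fix y assume "y \<in> S"
      then obtain x where "norm x < \<delta>" "y = e x" using S(3) by blast
      then show "y \<in> range ex" using \<delta>(2) by blast
    qed
    then show thesis using S(1,2) by (rule that[rotated 2])
  qed
  note S = this
  obtain Q where Q: "compactin T Q" "generate G Q = carrier G"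
    using cg unfolding compactly_generated_def by blast
  have Qc: "Q \<subseteq> carrier G" using compactin_subset_topspace[OF Q(1)] topspace by simp
  \<comment> \<open>\<open>O' g\<close> is the translate by \<open>g\<close> of a neighbourhood of
    the identity made of exponentials. Finitely many translates cover the compact generating set,
    and their base points together with the range of \<open>ex\<close> generate.\<close>
  define O' where "O' g = {x \<in> topspace T. inv g \<otimes> x \<in> S}" for g
  have "openin T (O' g)" if "g \<in> Q" for g
    unfolding O'_def
    by (rule openin_continuous_map_preimage[OF continuous_translation S(1)]) (use that Qc in auto)
  moreover have "Q \<subseteq> \<Union>(O' ` Q)"
  proof
    fix g assume g: "g \<in> Q"
    then have "g \<in> O' g" using Qc S(2) by (auto simp: O'_def topspace)
    then show "g \<in> \<Union>(O' ` Q)" using g by blast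
  qed
  ultimately obtain \<F> where \<F>: "finite \<F>" "\<F> \<subseteq> O' ` Q" "Q \<subseteq> \<Union>\<F>"
    using compactinD[OF Q(1), of "O' ` Q"] by blast
  obtain F where F: "finite F" "F \<subseteq> Q" "\<F> = O' ` F" using finite_subset_image[OF \<F>(1,2)] by blast
  have gc: "F \<union> range ex \<subseteq> carrier G" using F(2) Qc ex_closed by blast
  have "Q \<subseteq> generate G (F \<union> range ex)"
  proof
    fix x assume x: "x \<in> Q"
    then obtain g where g: "g \<in> F" "x \<in> O' g" using \<F>(3) F(3) by blast
    have gx: "g \<in> carrier G" "x \<in> carrier G" using g(1) F(2) Qc x by blast+
    have s: "inv g \<otimes> x \<in> range ex" using g(2) S(3) by (auto simp: O'_def)
    have "g \<otimes> (inv g \<otimes> x) \<in> generate G (F \<union> range ex)"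
      by (intro generate.eng generate.incl UnI1 UnI2 g(1) s)
    then show "x \<in> generate G (F \<union> range ex)" using r_cancel_inv[OF gx] by simp
  qed
  then have "generate G Q \<subseteq> generate G (F \<union> range ex)"
    by (rule generate_subgroup_incl[OF _ generate_is_subgroup[OF gc]])
  then have gen: "generate G (F \<union> range ex) = carrier G"
    using Q(2) generate_incl[OF gc] by blast
  have eg: "exp_group G (UNIV :: 'e set) ex \<mu> r0"
  proof (intro exp_group.intro exp_group_axioms.intro dy)
    show "ex ((s + t) *\<^sub>R x) = ex (s *\<^sub>R x) \<otimes> ex (t *\<^sub>R x)" for x s t
      by (rule ex_add_real[OF neg]) simp
    show "\<exists>\<delta>>0. \<forall>x\<in>UNIV. norm x < \<delta> \<longrightarrow> (\<exists>y\<in>UNIV. norm y < \<epsilon> \<and> g \<otimes> ex x \<otimes> inv g = ex y)"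
      if "g \<in> carrier G" "0 < \<epsilon>" for g \<epsilon>
      by (rule small[OF continuous_conj[OF that(1)] _ that(2)]) (use that(1) in simp)
    show "\<exists>S. finite S \<and> generate G (S \<union> range ex) = carrier G" using F(1) gen by blast
  qed
  moreover have "exp_group.small_cts (UNIV :: 'e set) ex \<phi>" if "continuous_map T T \<phi>" "\<phi> \<one> = \<one>" for \<phi>
    unfolding exp_group.small_cts_def[OF eg] using small[OF that] by blast
  ultimately show ?thesis by blast
qed

end

section \<open>Lie groups and twisted classes\<close>

theorem balanced_lie_group:
  fixes G :: "'a monoid"
  assumes lie: "lie_group TYPE('e::euclidean_space) G T" and cg: "compactly_generated G T"
    and nil: "lower_central G n = {\<one>\<^bsub>G\<^esub>}"
    and \<phi>: "\<phi> \<in> hom G G" "\<phi> ` carrier G = carrier G" "continuous_map T T \<phi>"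
  shows "balanced G \<phi> (carrier G)"
proof -
  have tg: "topological_group G T" using lie by (simp add: lie_group_def)
  then have G: "group G" and top: "topspace T = carrier G" by (simp_all add: topological_group_def)
  interpret group G by (rule G)
  consider "T = discrete_topology (carrier G)" | A where "lie_atlas G T (A :: (('a \<Rightarrow> 'e) \<times> 'a set) set)"
    using lie unfolding lie_group_def by blast
  then show ?thesis
  proof cases
    case 1
    obtain Q where Q: "compactin T Q" "generate G Q = carrier G"
      using cg unfolding compactly_generated_def by blast
    \<comment> \<open>Compact subsets of a discrete space are finite, so this is the finitely
      generated case.\<close>
    have "finite Q" using Q(1) unfolding 1 by (simp add: compactin_discrete_topology)
    then show ?thesis by (rule balanced_finitely_generated_nilpotent[OF G nil _ Q(2) \<phi>(1)])
  next
    case 2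
    note atlas = 2[unfolded lie_atlas_def]
    have charts: "\<forall>(c, U)\<in>A. is_chart T c U" by (rule atlas[THEN conjunct1])
    have cover: "(\<Union>(c, U)\<in>A. U) = topspace T" by (rule atlas[THEN conjunct2, THEN conjunct1])
    have smooth: "\<forall>(c1, U1)\<in>A. \<forall>(c2, U2)\<in>A. \<forall>(d, V)\<in>A.
        smooth_on {(z1, z2). z1 \<in> c1 ` U1 \<and> z2 \<in> c2 ` U2 \<and>
                     inv_into U1 c1 z1 \<otimes>\<^bsub>G\<^esub> inv_into U2 c2 z2 \<in> V}
          (\<lambda>(z1, z2). d (inv_into U1 c1 z1 \<otimes>\<^bsub>G\<^esub> inv_into U2 c2 z2))"
      by (rule atlas[THEN conjunct2, THEN conjunct2, THEN conjunct2, THEN conjunct1])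
    have "\<one>\<^bsub>G\<^esub> \<in> (\<Union>(c, U)\<in>A. U)" unfolding cover top by (rule one_closed)
    then obtain c U where cU: "(c, U) \<in> A" "\<one>\<^bsub>G\<^esub> \<in> U" by blast
    have "is_chart T c U" using bspec[OF charts cU(1)] by simp
    moreover have "smooth_on {(z1, z2). z1 \<in> c ` U \<and> z2 \<in> c ` U \<and>
        inv_into U c z1 \<otimes>\<^bsub>G\<^esub> inv_into U c z2 \<in> U} (\<lambda>(z1, z2). c (inv_into U c z1 \<otimes>\<^bsub>G\<^esub> inv_into U c z2))"
      using bspec[OF bspec[OF bspec[OF smooth cU(1), simplified] cU(1), simplified] cU(1)] by simp
    ultimately have "chart_group G T c U"
      using G tg cU(2) by (intro chart_group.intro chart_group_axioms.intro)
    from chart_group.exp_group_exists[OF this cg] obtain ex \<mu> r0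
      where eg: "exp_group G (UNIV :: 'e set) ex \<mu> r0"
        and sc: "\<forall>\<phi>. continuous_map T T \<phi> \<longrightarrow> \<phi> \<one>\<^bsub>G\<^esub> = \<one>\<^bsub>G\<^esub> \<longrightarrow> exp_group.small_cts (UNIV :: 'e set) ex \<phi>"
      by (elim exE conjE)
    have "exp_group.small_cts (UNIV :: 'e set) ex \<phi>"
      using sc \<phi>(3) hom_one[OF \<phi>(1) G G] by blast
    then show ?thesis by (rule balanced_exp_group[OF eg nil \<phi>(1,2)])
  qed
qed

theorem theorem3p3:
  fixes G :: "('a, 'b) monoid_scheme" and T :: "'a topology" and \<phi> :: "'a \<Rightarrow> 'a"
  assumes "lie_group TYPE('e::euclidean_space) G T"
    and "compactly_generated G T"
    and "nilpotent_group G"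
    and "cont_aut G T \<phi>"
  shows "infinite (twisted_classes G \<phi>) \<longleftrightarrow> infinite (Fix G \<phi>)"
proof -
  \<comment> \<open>The extra record fields are dropped because the inductions run over
    \<open>'a monoid\<close>, the type in which the quotients are built. All notions involved depend
    only on the carrier, the product and the unit.\<close>
  define H :: "'a monoid" where "H = \<lparr>carrier = carrier G, monoid.mult = (\<otimes>\<^bsub>G\<^esub>), one = \<one>\<^bsub>G\<^esub>\<rparr>"
  have H [simp]: "carrier H = carrier G" "(\<otimes>\<^bsub>H\<^esub>) = (\<otimes>\<^bsub>G\<^esub>)" "\<one>\<^bsub>H\<^esub> = \<one>\<^bsub>G\<^esub>" by (simp_all add: H_def)
  have invH [simp]: "m_inv H = m_inv G" by (simp add: m_inv_def fun_eq_iff)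
  have tg: "topological_group G T" using assms(1) by (simp add: lie_group_def)
  then have G: "group G" and top: "topspace T = carrier G" by (simp_all add: topological_group_def)
  interpret group G by (rule G)
  have groupH: "group H" by (rule groupI) (auto simp: m_assoc intro: l_inv_ex)
  interpret id: group_hom G H "\<lambda>x. x"
    by (rule group_hom.intro[OF G groupH group_hom_axioms.intro]) (simp add: hom_def)
  have "lie_group TYPE('e) H T \<longleftrightarrow> lie_group TYPE('e) G T"
    unfolding lie_group_def topological_group_def lie_atlas_def H invH by (simp only: groupH G)
  then have lie: "lie_group TYPE('e) H T" using assms(1) by (rule iffD2)
  have cg: "compactly_generated H T"
  proof -
    obtain Q where Q: "compactin T Q" "generate G Q = carrier G"
      using assms(2) unfolding compactly_generated_def by blast
    have "Q \<subseteq> carrier G" using compactin_subset_topspace[OF Q(1)] top by simp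
    then have "generate H Q = carrier H" using id.generate_img[of Q] Q(2) by simp
    then show ?thesis using Q(1) unfolding compactly_generated_def by blast
  qed
  obtain n where n: "lower_central G n = {\<one>\<^bsub>G\<^esub>}" using assms(3) unfolding nilpotent_group_def by blast
  have "lower_central H n \<subseteq> {\<one>\<^bsub>H\<^esub>}"
    using id.lower_central_surj[of n] unfolding n H by (simp only: image_ident)
  then have nil: "lower_central H n = {\<one>\<^bsub>H\<^esub>}"
    using subgroup.one_closed[OF group.lower_central_subgroup[OF groupH, of n]] by blast
  have \<phi>: "\<phi> \<in> hom G G" "\<phi> ` carrier G = carrier G" "continuous_map T T \<phi>"
    using assms(4) by (auto simp: cont_aut_def iso_def bij_betw_def)
  have "\<phi> \<in> hom H H" using \<phi>(1) unfolding hom_def H .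
  then have "balanced H \<phi> (carrier H)"
    by (rule balanced_lie_group[OF lie cg nil _ _ \<phi>(3)]) (unfold H, rule \<phi>(2))
  then have "balanced G \<phi> (carrier G)" unfolding balanced_def twisted_finite_def H invH .
  then show ?thesis
    using finite_twisted_classes_iff[OF G \<phi>(1)] by (simp add: balanced_def Fix_def)
qed

end
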